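(* Let $\beta>0$ and let $X_0(u)=-iAu$. A Borel probability measure $\mu$ on $H^{-s}$ is a $(\beta,X_0)$-KMS state if and only if $\mu$ is the Gaussian measure $\mu_{\beta,0}$.
   Context: Setting. $H$ is an infinite-dimensional separable complex Hilbert space with inner product $\langle\cdot,\cdot\rangle$ antilinear in the left variable, and $\langle\cdot,\cdot\rangle_{H,\mathbb{R}}=\mathrm{Re}\langle\cdot,\cdot\rangle$. $A$ is a positive self-adjoint operator on $H$ with $A\ge c\,\mathds{1}$ for some $c>0$ and compact resolvent; $\{e_j\}_{j\ge1}$ is an orthonormal basis of $H$ with $Ae_j=\lambda_je_j$, and $f_j=ie_j$. Fix $s\ge0$ with $\sum_j\lambda_j^{-(1+s)}<\infty$. $H^s=D(A^{s/2})$ with $\langle x,y\rangle_{H^s}=\langle A^{s/2}x,A^{s/2}y\rangle$, and $H^{-s}$ is the completion of $H$ for $\langle x,y\rangle_{H^{-s}}=\langle A^{-s/2}x,A^{-s/2}y\rangle$. $\langle\cdot,\cdot\rangle_{H,\mathbb{R}}$ extends to the real duality pairing between $H^{-s}$ and $H^s$. Gaussian measure. $\mu_{\beta,0}$ is the unique centered Gaussian Borel probability measure on $H^{-s}$ with $\int e^{i\langle w,u\rangle_{H,\mathbb{R}}}d\mu_{\beta,0}(u)=e^{-\frac1{2\beta}\langle w,A^{-1}w\rangle}$ for $w\in H^s$ (equivalently, with covariance operator $\beta^{-1}A^{-(1+s)}$ on $H^{-s}$). Cylindrical functions. $\mathscr{C}^\infty_{c,cyl}(H^{-s})$ is the set of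 $F:H^{-s}\to\mathbb{R}$ of the form $F(u)=\varphi(\langle u,e_1\rangle_{H,\mathbb{R}},\dots,\langle u,e_n\rangle_{H,\mathbb{R}};\langle u,f_1\rangle_{H,\mathbb{R}},\dots,\langle u,f_n\rangle_{H,\mathbb{R}})$ with $n\in\mathbb{N}$, $\varphi\in\mathscr{C}_c^\infty(\mathbb{R}^{2n})$. Let $\partial_{e_j}F,\partial_{f_j}F$ be the directional derivatives; $\nabla F=\sum_j\partial_{e_j}F\,e_j+\partial_{f_j}F\,f_j$; $\{F,G\}=\sum_j\big(\partial_{e_j}F\,\partial_{f_j}G-\partial_{e_j}G\,\partial_{f_j}F\big)$ (finite sums). KMS. A Borel probability measure $\mu$ on $H^{-s}$ is a $(\beta,X_0)$-KMS state if for all $F,G\in\mathscr{C}^\infty_{c,cyl}(H^{-s})$ $$\int\{F,G\}\,d\mu=\beta\int\mathrm{Re}\langle\nabla F(u),X_0(u)\rangle\,G(u)\,d\mu,$$ where $\mathrm{Re}\langle\nabla F(u),X_0(u)\rangle=\sum_j\partial_{e_j}F(u)\langle-iAu,e_j\rangle_{H,\mathbb{R}}+\partial_{f_j}F(u)\langle-iAu,f_j\rangle_{H,\mathbb{R}}=\sum_j\lambda_j\big(\partial_{e_j}F\,\langle u,f_j\rangle_{H,\mathbb{R}}-\partial_{f_j}F\,\langle u,e_j\rangle_{H,\mathbb{R}}\big)$, a bounded continuous function of $u$. *)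

theory Defs
  imports "HOL-Probability.Probability"
begin

section \<open>Complex Hilbert spaces\<close>

text \<open>The complex inner product is antilinear in its left argument; its real part is the real
  inner product that induces the norm, the topology and the Borel sets.\<close>

class complex_hilbert = real_inner + complete_space +
  fixes scaleC :: "complex \<Rightarrow> 'a \<Rightarrow> 'a"  (infixr \<open>*\<^sub>C\<close> 75)
    and cinner :: "'a \<Rightarrow> 'a \<Rightarrow> complex"
  assumes scaleC_add_right: "z *\<^sub>C (x + y) = z *\<^sub>C x + z *\<^sub>C y"
    and scaleC_add_left: "(z + w) *\<^sub>C x = z *\<^sub>C x + w *\<^sub>C x"
    and scaleC_scaleC: "z *\<^sub>C w *\<^sub>C x = (z * w) *\<^sub>C x"
    and scaleC_of_real: "complex_of_real r *\<^sub>C x = r *\<^sub>R x"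
    and cinner_commute: "cinner x y = cnj (cinner y x)"
    and cinner_add_right: "cinner x (y + y') = cinner x y + cinner x y'"
    and cinner_scaleC_right: "cinner x (z *\<^sub>C y) = z * cinner x y"
    and Re_cinner: "Re (cinner x y) = inner x y"

definition orthonormal_basis :: "(nat \<Rightarrow> 'h::complex_hilbert) \<Rightarrow> bool" where
  "orthonormal_basis e \<longleftrightarrow>
     (\<forall>i j. cinner (e i) (e j) = (if i = j then 1 else 0)) \<and>
     (\<forall>x. (\<lambda>j. cinner (e j) x *\<^sub>C e j) sums x)"

section \<open>Unbounded operators\<close>

text \<open>An unbounded operator is given by its domain \<open>D\<close> and a function \<open>A\<close>, of which
  only the values on \<open>D\<close> matter.\<close>

definition densely_defined_linear :: "'h::complex_hilbert set \<Rightarrow> ('h \<Rightarrow> 'h) \<Rightarrow> bool" where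
  "densely_defined_linear D A \<longleftrightarrow>
     0 \<in> D \<and> (\<forall>x\<in>D. \<forall>y\<in>D. x + y \<in> D \<and> A (x + y) = A x + A y) \<and>
     (\<forall>z. \<forall>x\<in>D. z *\<^sub>C x \<in> D \<and> A (z *\<^sub>C x) = z *\<^sub>C A x) \<and>
     closure D = UNIV"

definition adjoint_graph :: "'h::complex_hilbert set \<Rightarrow> ('h \<Rightarrow> 'h) \<Rightarrow> ('h \<times> 'h) set" where
  "adjoint_graph D A = {(y, z). \<forall>x\<in>D. cinner y (A x) = cinner z x}"

definition self_adjoint :: "'h::complex_hilbert set \<Rightarrow> ('h \<Rightarrow> 'h) \<Rightarrow> bool" where
  "self_adjoint D A \<longleftrightarrow>
     densely_defined_linear D A \<and> adjoint_graph D A = (\<lambda>x. (x, A x)) ` D"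

definition compact_operator :: "('h::complex_hilbert \<Rightarrow> 'h) \<Rightarrow> bool" where
  "compact_operator T \<longleftrightarrow> compact (closure (T ` cball 0 1))"

definition compact_resolvent :: "'h::complex_hilbert set \<Rightarrow> ('h \<Rightarrow> 'h) \<Rightarrow> bool" where
  "compact_resolvent D A \<longleftrightarrow>
     (\<exists>z. bij_betw (\<lambda>x. A x - z *\<^sub>C x) D UNIV \<and>
          compact_operator (inv_into D (\<lambda>x. A x - z *\<^sub>C x)))"

section \<open>The scale of spaces\<close>

text \<open>\<open>opow_dom e l r\<close> and \<open>opow e l r\<close> are the domain of \<open>A\<^sup>r\<close> and the operator \<open>A\<^sup>r\<close>
  for the operator \<open>A\<close> with orthonormal eigenbasis \<open>e\<close> and eigenvalues \<open>l\<close>.\<close>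

definition opow_dom :: "(nat \<Rightarrow> 'h::complex_hilbert) \<Rightarrow> (nat \<Rightarrow> real) \<Rightarrow> real \<Rightarrow> 'h set" where
  "opow_dom e l r = {x. summable (\<lambda>j. (l j powr r * cmod (cinner (e j) x))\<^sup>2)}"

definition opow :: "(nat \<Rightarrow> 'h::complex_hilbert) \<Rightarrow> (nat \<Rightarrow> real) \<Rightarrow> real \<Rightarrow> 'h \<Rightarrow> 'h" where
  "opow e l r x = (\<Sum>j. l j powr r *\<^sub>R cinner (e j) x *\<^sub>C e j)"

definition sobolev :: "(nat \<Rightarrow> 'h::complex_hilbert) \<Rightarrow> (nat \<Rightarrow> real) \<Rightarrow> real \<Rightarrow> 'h set" where
  "sobolev e l s = opow_dom e l (s / 2)"

text \<open>\<open>H\<^sup>-\<^sup>s\<close> is given up to isomorphism: a Hilbert space \<open>'k\<close> together with a map \<open>\<iota>\<close>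
  that exhibits it as the completion of \<open>'h\<close> for a second inner product.\<close>

definition is_completion ::
    "('h \<Rightarrow> 'h \<Rightarrow> complex) \<Rightarrow> ('h::complex_hilbert \<Rightarrow> 'k::complex_hilbert) \<Rightarrow> bool" where
  "is_completion ip \<iota> \<longleftrightarrow>
     (\<forall>x y. \<iota> (x + y) = \<iota> x + \<iota> y) \<and> (\<forall>z x. \<iota> (z *\<^sub>C x) = z *\<^sub>C \<iota> x) \<and>
     (\<forall>x y. cinner (\<iota> x) (\<iota> y) = ip x y) \<and> closure (range \<iota>) = UNIV"

definition neg_sobolev_ip ::
    "(nat \<Rightarrow> 'h::complex_hilbert) \<Rightarrow> (nat \<Rightarrow> real) \<Rightarrow> real \<Rightarrow> 'h \<Rightarrow> 'h \<Rightarrow> complex" where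
  "neg_sobolev_ip e l s x y = cinner (opow e l (- s / 2) x) (opow e l (- s / 2) y)"

text \<open>The continuous extension to \<open>'k\<close> of a function \<open>f\<close> on \<open>S\<close>, where \<open>\<iota> ` S\<close> is dense.\<close>

definition cont_ext :: "('h \<Rightarrow> 'k::topological_space) \<Rightarrow> 'h set \<Rightarrow> ('h \<Rightarrow> real) \<Rightarrow> 'k \<Rightarrow> real" where
  "cont_ext \<iota> S f = (THE g. continuous_on UNIV g \<and> (\<forall>x\<in>S. g (\<iota> x) = f x))"

text \<open>The real duality pairing of \<open>w \<in> H\<^sup>s\<close> and \<open>u \<in> H\<^sup>-\<^sup>s\<close>.\<close>

definition pairing :: "('h::complex_hilbert \<Rightarrow> 'k::complex_hilbert) \<Rightarrow> 'h \<Rightarrow> 'k \<Rightarrow> real" where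
  "pairing \<iota> w = cont_ext \<iota> UNIV (\<lambda>x. Re (cinner w x))"

section \<open>The Gaussian measure\<close>

definition borel_prob :: "'k::topological_space measure \<Rightarrow> bool" where
  "borel_prob \<mu> \<longleftrightarrow> prob_space \<mu> \<and> sets \<mu> = sets borel"

text \<open>The Dirac measure at \<open>0\<close> is the degenerate normal distribution.\<close>

definition centered_gaussian :: "'k::real_normed_vector measure \<Rightarrow> bool" where
  "centered_gaussian \<mu> \<longleftrightarrow> borel_prob \<mu> \<and>
     (\<forall>f :: 'k \<Rightarrow> real. bounded_linear f \<longrightarrow>
        distr \<mu> borel f = return borel 0 \<or>
        (\<exists>\<sigma>>0. distr \<mu> borel f = density lborel (\<lambda>x. ennreal (normal_density 0 \<sigma> x))))"

definition gaussian_state ::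
    "'h::complex_hilbert set \<Rightarrow> ('h \<Rightarrow> 'h) \<Rightarrow> (nat \<Rightarrow> 'h) \<Rightarrow> (nat \<Rightarrow> real) \<Rightarrow> real \<Rightarrow>
     ('h \<Rightarrow> 'k::complex_hilbert) \<Rightarrow> real \<Rightarrow> 'k measure" where
  "gaussian_state D A e l s \<iota> \<beta> =
     (THE \<mu>. centered_gaussian \<mu> \<and>
        (\<forall>w\<in>sobolev e l s.
           (LINT u|\<mu>. exp (\<i> * complex_of_real (pairing \<iota> w u))) =
           exp (- (cinner w (inv_into D A w) / (2 * complex_of_real \<beta>)))))"

section \<open>Smooth functions with compact support\<close>

text \<open>The dimension \<open>m\<close> is quantified in the definition of cylindrical functions, so \<open>\<real>\<^sup>m\<close>
  is the set of real sequences vanishing from index \<open>m\<close> on; the product topology induces the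
  Euclidean topology on it.\<close>

definition Rn :: "nat \<Rightarrow> (nat \<Rightarrow> real) set" where
  "Rn m = {x. \<forall>i\<ge>m. x i = 0}"

definition partial_deriv :: "nat \<Rightarrow> ((nat \<Rightarrow> real) \<Rightarrow> real) \<Rightarrow> (nat \<Rightarrow> real) \<Rightarrow> real" where
  "partial_deriv i \<phi> x = deriv (\<lambda>t. \<phi> (x(i := t))) (x i)"

text \<open>\<open>Ck m k \<phi>\<close>: all partial derivatives of \<open>\<phi>\<close> of order at most \<open>k\<close> exist and are
  continuous on \<open>\<real>\<^sup>m\<close>.\<close>

primrec Ck :: "nat \<Rightarrow> nat \<Rightarrow> ((nat \<Rightarrow> real) \<Rightarrow> real) \<Rightarrow> bool" where
  "Ck m 0 \<phi> \<longleftrightarrow> continuous_on (Rn m) \<phi>"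
| "Ck m (Suc k) \<phi> \<longleftrightarrow> continuous_on (Rn m) \<phi> \<and>
     (\<forall>i<m. (\<forall>x\<in>Rn m. (\<lambda>t. \<phi> (x(i := t))) differentiable (at (x i))) \<and>
            Ck m k (partial_deriv i \<phi>))"

definition Cc_infty :: "nat \<Rightarrow> ((nat \<Rightarrow> real) \<Rightarrow> real) set" where
  "Cc_infty m = {\<phi>. (\<forall>k. Ck m k \<phi>) \<and> compact (closure {x \<in> Rn m. \<phi> x \<noteq> 0})}"

section \<open>Cylindrical functions and KMS states\<close>

text \<open>The coordinates of \<open>u\<close> along \<open>e\<^sub>0, \<dots>, e\<^sub>n\<^sub>-\<^sub>1\<close>, followed by those along
  \<open>f\<^sub>j = \<i> e\<^sub>j\<close> for \<open>j < n\<close>.\<close>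

definition coords ::
    "('h::complex_hilbert \<Rightarrow> 'k::complex_hilbert) \<Rightarrow> (nat \<Rightarrow> 'h) \<Rightarrow> nat \<Rightarrow> 'k \<Rightarrow> nat \<Rightarrow> real" where
  "coords \<iota> e n u = (\<lambda>i. if i < n then pairing \<iota> (e i) u
                         else if i < 2 * n then pairing \<iota> (\<i> *\<^sub>C e (i - n)) u
                         else 0)"

definition cyl ::
    "('h::complex_hilbert \<Rightarrow> 'k::complex_hilbert) \<Rightarrow> (nat \<Rightarrow> 'h) \<Rightarrow> ('k \<Rightarrow> real) set" where
  "cyl \<iota> e = {\<lambda>u. \<phi> (coords \<iota> e n u) | n \<phi>. 1 \<le> n \<and> \<phi> \<in> Cc_infty (2 * n)}"

definition dir_deriv :: 
    "('h::complex_hilbert \<Rightarrow> 'k::complex_hilbert) \<Rightarrow> 'h \<Rightarrow> ('k \<Rightarrow> real) \<Rightarrow> 'k \<Rightarrow> real" where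
  "dir_deriv \<iota> v F u = deriv (\<lambda>t. F (u + t *\<^sub>R \<iota> v)) 0"

text \<open>For cylindrical functions the two series below have finitely many nonzero terms.\<close>

definition grad ::
    "('h::complex_hilbert \<Rightarrow> 'k::complex_hilbert) \<Rightarrow> (nat \<Rightarrow> 'h) \<Rightarrow> ('k \<Rightarrow> real) \<Rightarrow> 'k \<Rightarrow> 'h" where
  "grad \<iota> e F u =
     (\<Sum>j. dir_deriv \<iota> (e j) F u *\<^sub>R e j + dir_deriv \<iota> (\<i> *\<^sub>C e j) F u *\<^sub>R \<i> *\<^sub>C e j)"

definition poisson ::
    "('h::complex_hilbert \<Rightarrow> 'k::complex_hilbert) \<Rightarrow> (nat \<Rightarrow> 'h) \<Rightarrow>
     ('k \<Rightarrow> real) \<Rightarrow> ('k \<Rightarrow> real) \<Rightarrow> 'k \<Rightarrow> real" where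
  "poisson \<iota> e F G u =
     (\<Sum>j. dir_deriv \<iota> (e j) F u * dir_deriv \<iota> (\<i> *\<^sub>C e j) G u
         - dir_deriv \<iota> (e j) G u * dir_deriv \<iota> (\<i> *\<^sub>C e j) F u)"

text \<open>The values of a vector field \<open>X\<close> such as \<open>u \<mapsto> - \<i> A u\<close> lie outside \<open>H\<^sup>-\<^sup>s\<close> in
  general; only their real pairing with finite combinations \<open>w\<close> of the \<open>e\<^sub>j\<close> is used.
  A vector field is therefore a function \<open>X\<close> for which \<open>X u w\<close> is the pairing of \<open>X(u)\<close>
  and \<open>w\<close>.  For such \<open>w\<close>, \<open>linear_field D A \<iota> u w\<close> is the continuous extension
  in \<open>u\<close>, from \<open>D(A)\<close> to \<open>H\<^sup>-\<^sup>s\<close>, of the real inner product of \<open>w\<close> and \<open>- \<i> A u\<close>.\<close>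

definition linear_field ::
    "'h::complex_hilbert set \<Rightarrow> ('h \<Rightarrow> 'h) \<Rightarrow> ('h \<Rightarrow> 'k::complex_hilbert) \<Rightarrow> 'k \<Rightarrow> 'h \<Rightarrow> real" where
  "linear_field D A \<iota> u w = cont_ext \<iota> D (\<lambda>x. Re (cinner w ((- \<i>) *\<^sub>C A x))) u"

definition kms_state ::
    "('h::complex_hilbert \<Rightarrow> 'k::complex_hilbert) \<Rightarrow> (nat \<Rightarrow> 'h) \<Rightarrow> real \<Rightarrow>
     ('k \<Rightarrow> 'h \<Rightarrow> real) \<Rightarrow> 'k measure \<Rightarrow> bool" where
  "kms_state \<iota> e \<beta> X \<mu> \<longleftrightarrow> borel_prob \<mu> \<and>
     (\<forall>F\<in>cyl \<iota> e. \<forall>G\<in>cyl \<iota> e.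
        (LINT u|\<mu>. poisson \<iota> e F G u) = \<beta> * (LINT u|\<mu>. X u (grad \<iota> e F u) * G u))"

end

theory Submission
  imports Defs "HOL-Real_Asymp.Real_Asymp"
begin

text \<open>
  In the real coordinates of \<open>u\<close> along \<open>e\<^sub>j\<close> and \<open>\<i> e\<^sub>j\<close>, the Gaussian measure is a product of
  centred normal laws with inverse variances \<open>\<beta> \<lambda>\<^sub>j\<close>, and the KMS identity follows from Gaussian
  integration by parts because the mixed second derivatives cancel in the Poisson bracket.
  Conversely, testing a KMS state with a coordinate function \<open>F\<close>, cut off outside the support of
  \<open>G\<close>, gives back the integration by parts formula \<open>\<integral> \<partial>\<^sub>i G d\<mu> = \<beta> \<lambda> \<integral> x\<^sub>i G d\<mu>\<close>.  With
  \<open>G \<approx> x\<^sub>i\<close> it bounds the second moments; with \<open>G \<approx> cos (t \<theta> + b)\<close>, \<open>\<theta>\<close> a linear form, it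
  becomes a linear differential equation in \<open>t\<close> for the characteristic function of \<open>\<theta>\<close>, whose
  solution is Gaussian.  Characteristic functions determine the law of the coordinates, and the law
  of the coordinates determines the measure because \<open>u\<close> is a measurable function of them.
\<close>

text \<open>Test functions have compact support in their variables, so neither a coordinate nor a
  cosine is admissible, and a KMS state comes with no moments. All limits therefore run over cutoffs
  \<open>\<eta> (x r / a)\<close> with growing a: their derivatives are of order 1 / a and stay
  bounded when multiplied by \<open>x i\<close>. The second moments so obtained supply the
  domination that the cosine test functions need. On the side of measures, the product law on
  sequences exists for any positive variances; that it comes from a measure on \<open>'k\<close> is
  a matter of the trace, since the expected squared norm of the random series is 1 / \<beta> times
  the sum of \<open>l j powr (- (1 + s))\<close> over both real coordinates of each j. Equality of
  laws on sequences is reduced to the one-dimensional theorem of Levy by treating one coordinate at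
  a time.\<close>

lemma bounded_integrable:
  fixes f :: "'a \<Rightarrow> 'b::{banach, second_countable_topology}"
  assumes "prob_space M" "f \<in> borel_measurable M" "\<And>x. norm (f x) \<le> B"
  shows "integrable M f"
proof -
  interpret prob_space M by fact
  show ?thesis
    using assms by (intro integrable_const_bound[where B=B]) auto
qed

lemma integrable_mult_bounded:
  fixes f g :: "'a \<Rightarrow> real"
  assumes "integrable M f" "g \<in> borel_measurable M" "\<And>x. \<bar>g x\<bar> \<le> B"
  shows "integrable M (\<lambda>x. f x * g x)"
proof (rule Bochner_Integration.integrable_bound)
  show "integrable M (\<lambda>x. B * f x)" using assms(1) by simp
  show "AE x in M. norm (f x * g x) \<le> norm (B * f x)"
  proof (rule AE_I2)
    fix x
    have "\<bar>g x\<bar> \<le> \<bar>B\<bar>" using assms(3)[of x] by linarith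
    then show "norm (f x * g x) \<le> norm (B * f x)"
      using mult_left_mono[of "\<bar>g x\<bar>" "\<bar>B\<bar>" "\<bar>f x\<bar>"] by (simp add: abs_mult mult.commute)
  qed
qed (use assms in measurable)

lemma integrable_of_square:
  fixes f :: "'a \<Rightarrow> real"
  assumes "prob_space M" "f \<in> borel_measurable M" "integrable M (\<lambda>x. (f x)\<^sup>2)"
  shows "integrable M f"
proof -
  interpret prob_space M by fact
  show ?thesis
    using assms(2,3) by (rule square_integrable_imp_integrable)
qed

text \<open>Since sin y = cos (y - pi / 2), cosine integrals with an arbitrary phase b carry the
  whole characteristic function. This is why the real identities below are stated with a
  phase.\<close>

lemma integral_iexp:
  assumes "prob_space M" and [measurable]: "f \<in> borel_measurable M"
  shows "(LINT x|M. iexp (f x)) = complex_of_real (\<integral>x. cos (f x) \<partial>M) + \<i> * complex_of_real (\<integral>x. cos (f x - pi / 2) \<partial>M)"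
proof -
  have 1: "iexp (f x) = complex_of_real (cos (f x)) + \<i> * complex_of_real (cos (f x - pi / 2))" for x
    by (simp add: exp_Euler cos_diff cos_of_real sin_of_real flip: of_real_mult)
  have "integrable M (\<lambda>x. cos (f x))" "integrable M (\<lambda>x. cos (f x - pi/2))"
    by (intro bounded_integrable[where B=1] assms(1); simp)+
  then show ?thesis
    unfolding 1 by (subst Bochner_Integration.integral_add) auto
qed

section \<open>Measures on sequences\<close>

lemma sets_PiM_borel: "sets (PiM UNIV (\<lambda>_::nat. borel :: real measure)) = sets borel"
  by (rule sets_PiM_equal_borel)

lemma measurable_coord [measurable]:
  "(\<lambda>x. x k) \<in> borel_measurable (borel :: (nat \<Rightarrow> real) measure)"
  by (intro borel_measurable_continuous_onI) simp

text \<open>After normalisation W becomes a probability density, and the hypothesis says that X has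
  the same characteristic function under both weighted measures; Levy's theorem applies. The weight
  carries the information about all other coordinates.\<close>

lemma weighted_marginal_eqI:
  fixes X W :: "'a \<Rightarrow> real"
  assumes P: "prob_space P" "prob_space Q" "sets P = sets N" "sets Q = sets N"
    and [measurable]: "X \<in> borel_measurable N" "W \<in> borel_measurable N"
    and W: "\<And>x. 0 \<le> W x" "\<And>x. W x \<le> C"
    and eq: "\<And>t b. (\<integral>x. W x * cos (t * X x + b) \<partial>P) = (\<integral>x. W x * cos (t * X x + b) \<partial>Q)"
    and B[measurable]: "B \<in> sets borel"
  shows "(\<integral>x. W x * indicator B (X x) \<partial>P) = (\<integral>x. W x * indicator B (X x) \<partial>Q)"
proof -
  define c where "c = (\<integral>x. W x \<partial>P)"
  \<comment> \<open>At t = b = 0 the cosine is 1, so both weighted measures have the same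
    mass.\<close>
  have cQ: "c = (\<integral>x. W x \<partial>Q)"
    using eq[of 0 0] by (simp add: c_def)
  have C0: "0 \<le> C" using W order_trans by blast
  have intW: "integrable R (\<lambda>x. W x * f x)"
    if "prob_space R" "sets R = sets N" "f \<in> borel_measurable N" "\<And>x. \<bar>f x\<bar> \<le> 1"
    for R and f :: "'a \<Rightarrow> real"
  proof (rule bounded_integrable[where B=C])
    show "(\<lambda>x. W x * f x) \<in> borel_measurable R"
      using that(2,3) measurable_cong_sets[OF that(2) refl] by measurable
    show "norm (W x * f x) \<le> C" for x
      using mult_mono[OF W(2) that(4)[of x] C0] W(1)[of x] by (simp add: abs_mult)
  qed fact
  have intW1: "integrable R W" if "prob_space R" "sets R = sets N" for R
    using intW[OF that, of "\<lambda>_. 1"] by simp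
  show ?thesis
  \<comment> \<open>Normalising requires c \<noteq> 0; if the mass is zero, the nonnegative W
    vanishes almost everywhere.\<close>
  proof (cases "c = 0")
    case True
    have "(\<integral>x. W x * indicator B (X x) \<partial>R) = 0"
      if R: "prob_space R" "sets R = sets N" "(\<integral>x. W x \<partial>R) = 0" for R
    proof -
      have "AE x in R. W x = 0"
        using integral_nonneg_eq_0_iff_AE[OF intW1[OF R(1,2)]] W(1) R(3) by simp
      then have "AE x in R. W x * indicator B (X x) = 0" by auto
      then show ?thesis by (rule integral_eq_zero_AE)
    qed
    then show ?thesis using True cQ c_def P by metis
  next
    case False
    then have c: "c > 0"
      using W(1) by (simp add: c_def order_less_le)
    define D where "D R = distr (density R (\<lambda>x. ennreal (W x / c))) borel X" for R :: "'a measure"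
    have int: "(\<integral>x. f x \<partial>D R) = (\<integral>x. W x * f (X x) \<partial>R) / c"
      if "sets R = sets N" "f \<in> borel_measurable borel" for R and f :: "real \<Rightarrow> real"
    proof -
      note that(1)[measurable_cong] that(2)[measurable]
      show ?thesis
        unfolding D_def using c W(1)
        by (subst integral_distr, simp, simp, subst integral_density) auto
    qed
    have rd: "real_distribution (D R)"
      if R: "prob_space R" "sets R = sets N" "(\<integral>x. W x \<partial>R) = c" for R
    proof -
      note R(2)[measurable_cong]
      have "emeasure (density R (\<lambda>x. ennreal (W x / c))) (space R) = (\<integral>\<^sup>+x. ennreal (W x / c) \<partial>R)"
        by (subst emeasure_density) (auto intro!: nn_integral_cong)
      also have "\<dots> = ennreal (\<integral>x. W x / c \<partial>R)"
        using c W(1) intW1[OF R(1,2)] by (intro nn_integral_eq_integral) auto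
      also have "\<dots> = 1" using R(3) c by simp
      finally have "prob_space (density R (\<lambda>x. ennreal (W x / c)))"
        by (intro prob_spaceI) simp
      then interpret pd: prob_space "density R (\<lambda>x. ennreal (W x / c))" .
      have "prob_space (D R)" unfolding D_def by (rule pd.prob_space_distr) simp
      then show ?thesis
        by (simp add: real_distribution_def real_distribution_axioms_def D_def)
    qed
    have ind: "measure (D R) B = (\<integral>x. W x * indicator B (X x) \<partial>R) / c"
      if "sets R = sets N" for R
    proof -
      have "(\<integral>x. indicator B x \<partial>D R) = measure (D R) B"
        using B by (simp add: D_def)
      then show ?thesis using int[OF that, of "indicator B"] by simp
    qed
    have "char (D P) t = char (D Q) t" for t
    proof -
      have co: "char (D R) t = complex_of_real (\<integral>x. cos (t * x) \<partial>D R) + \<i> * complex_of_real (\<integral>x. cos (t * x - pi / 2) \<partial>D R)"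
        if "real_distribution (D R)" for R
      proof -
        interpret real_distribution "D R" by fact
        show ?thesis
          unfolding char_def by (rule integral_iexp) (simp_all add: prob_space_axioms)
      qed
      have e: "(\<integral>x. cos (t * x + b) \<partial>D P) = (\<integral>x. cos (t * x + b) \<partial>D Q)" for b
        using int[where R=P and f="\<lambda>x. cos (t * x + b)"] int[where R=Q and f="\<lambda>x. cos (t * x + b)"] P c_def cQ eq by simp
      from co[OF rd[of P]] co[OF rd[of Q]] e[of 0] e[of "- pi/2"]
      show ?thesis using P c_def cQ by simp
    qed
    then have "D P = D Q"
      using rd[of P] rd[of Q] P c_def cQ by (intro Levy_uniqueness) auto
    then show ?thesis
      using ind[of P] ind[of Q] P c_def cQ c by simp
  qed
qed

text \<open>In \<open>E N k B t b\<close> the coordinates below k are tested by indicators and those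
  from k up to N by a cosine. Each step of the induction on k trades one frequency for an indicator;
  at k = N only the measure of a cylinder set is left, and such sets generate the product
  \<sigma>-algebra.\<close>

theorem prob_eqI_char:
  fixes P Q :: "(nat \<Rightarrow> real) measure"
  assumes P: "prob_space P" "prob_space Q" "sets P = sets borel" "sets Q = sets borel"
    and eq: "\<And>N t b. (\<integral>x. cos ((\<Sum>i<N. t i * x i) + b) \<partial>P) = (\<integral>x. cos ((\<Sum>i<N. t i * x i) + b) \<partial>Q)"
  shows "P = Q"
proof -
  have [measurable_cong]: "sets P = sets borel" "sets Q = sets borel" by fact+
  define E where "E N k B t b R = (\<integral>x. (\<Prod>i<k. indicator (B i) (x i)) * cos ((\<Sum>i\<in>{k..<N}. t i * x i) + b) \<partial>R)"
    for N k :: nat and B t b and R :: "(nat \<Rightarrow> real) measure"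
  have step: "E N k B t b P = E N k B t b Q"
    if "\<And>i. B i \<in> sets borel" "k \<le> N" for N k t b and B :: "nat \<Rightarrow> real set"
    using that
  proof (induction k arbitrary: B t b)
    case 0
    then show ?case using eq[of t N b] by (simp add: E_def atLeast0LessThan)
  next
    case (Suc k)
    note [measurable] = Suc.prems(1)
    define W :: "(nat \<Rightarrow> real) \<Rightarrow> real" where "W x = (\<Prod>i<k. indicator (B i) (x i))" for x
    define \<theta> :: "(nat \<Rightarrow> real) \<Rightarrow> real" where "\<theta> x = (\<Sum>i\<in>{Suc k..<N}. t i * x i) + b" for x
    have Wm[measurable]: "W \<in> borel_measurable borel" and [measurable]: "\<theta> \<in> borel_measurable borel"
      unfolding W_def \<theta>_def by measurable
    have W01: "0 \<le> W x" "W x \<le> 1" for x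
      unfolding W_def by (auto intro!: prod_nonneg prod_le_1 simp: indicator_def)
    have IH: "(\<integral>x. W x * cos (\<tau> * x k + (\<Sum>i\<in>{Suc k..<N}. t i * x i) + b) \<partial>P) =
              (\<integral>x. W x * cos (\<tau> * x k + (\<Sum>i\<in>{Suc k..<N}. t i * x i) + b) \<partial>Q)" for t \<tau> b
    proof -
      have s: "(\<Sum>i\<in>{k..<N}. (t(k := \<tau>)) i * x i) = \<tau> * x k + (\<Sum>i\<in>{Suc k..<N}. t i * x i)" for x
        using Suc.prems(2) by (subst sum.atLeast_Suc_lessThan) auto
      show ?thesis
        using Suc.IH[of B "t(k := \<tau>)" b] Suc.prems by (simp only: E_def s W_def add.assoc)
    qed
    have int: "integrable R (\<lambda>x. W x * f x)"
      if "R = P \<or> R = Q" "f \<in> borel_measurable borel" "\<And>x. \<bar>f x\<bar> \<le> 1" for R f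
    proof (rule bounded_integrable[where B=1])
      show "prob_space R" using P that by auto
      have "sets R = sets borel" using P that by auto
      note [measurable_cong] = this and [measurable] = that(2)
      show "(\<lambda>x. W x * f x) \<in> borel_measurable R" by measurable
      show "norm (W x * f x) \<le> 1" for x
        using mult_mono[OF W01(2)[of x] that(3)[of x]] W01(1)[of x] by (simp add: abs_mult)
    qed
    \<comment> \<open>Zero frequencies remove the coordinates above k from the cosine.\<close>
    have base: "(\<integral>x. W x * cos (\<tau> * x k + b') \<partial>P) = (\<integral>x. W x * cos (\<tau> * x k + b') \<partial>Q)" for \<tau> b'
      using IH[of \<tau> "\<lambda>_. 0" b'] by simp
    have A: "(\<integral>x. W x * indicator (B k) (x k) \<partial>P) = (\<integral>x. W x * indicator (B k) (x k) \<partial>Q)"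
      by (rule weighted_marginal_eqI[where N=borel and C=1]) (use P W01 base in auto)
    \<comment> \<open>A weight must be nonnegative, so the cosine of the remaining coordinates
      enters as 1 + cos \<theta>, and the surplus is subtracted again by means of \<open>A\<close>.
      The product of the two cosines splits into the cosines of the sum and of the difference of the
      angles, both covered by \<open>IH\<close>.\<close>
    have exp: "(\<integral>x. W x * (1 + cos (\<theta> x)) * cos (\<tau> * x k + b') \<partial>R) =
          (\<integral>x. W x * cos (\<tau> * x k + b') \<partial>R) + (1/2) * (\<integral>x. W x * cos (\<tau> * x k + (\<Sum>i\<in>{Suc k..<N}. t i * x i) + (b + b')) \<partial>R)
           + (1/2) * (\<integral>x. W x * cos ((-\<tau>) * x k + (\<Sum>i\<in>{Suc k..<N}. t i * x i) + (b - b')) \<partial>R)"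
      if "R = P \<or> R = Q" for R \<tau> b'
    proof -
      have pt: "W x * (1 + cos (\<theta> x)) * cos (\<tau> * x k + b') = W x * cos (\<tau> * x k + b') +
         (1/2) * (W x * cos (\<tau> * x k + (\<Sum>i\<in>{Suc k..<N}. t i * x i) + (b + b'))) +
         (1/2) * (W x * cos ((-\<tau>) * x k + (\<Sum>i\<in>{Suc k..<N}. t i * x i) + (b - b')))" for x
      proof -
        have 1: "\<tau> * x k + (\<Sum>i\<in>{Suc k..<N}. t i * x i) + (b + b') = \<theta> x + (\<tau> * x k + b')"
          and 2: "(-\<tau>) * x k + (\<Sum>i\<in>{Suc k..<N}. t i * x i) + (b - b') = \<theta> x - (\<tau> * x k + b')"
          by (simp_all add: \<theta>_def)
        show ?thesis unfolding 1 2 cos_add[of "\<theta> x"] cos_diff[of "\<theta> x"] by (simp add: algebra_simps)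
      qed
      have "integrable R (\<lambda>x. W x * cos (\<tau> * x k + b'))"
        "integrable R (\<lambda>x. W x * cos (\<tau> * x k + (\<Sum>i\<in>{Suc k..<N}. t i * x i) + (b + b')))"
        "integrable R (\<lambda>x. W x * cos ((-\<tau>) * x k + (\<Sum>i\<in>{Suc k..<N}. t i * x i) + (b - b')))"
        by (intro int that; measurable; simp)+
      then show ?thesis
        unfolding pt by (simp del: mult_minus_left)
    qed
    have Bq: "(\<integral>x. W x * (1 + cos (\<theta> x)) * indicator (B k) (x k) \<partial>P) = (\<integral>x. W x * (1 + cos (\<theta> x)) * indicator (B k) (x k) \<partial>Q)"
    proof (rule weighted_marginal_eqI[where N=borel and C=2])
      show "0 \<le> W x * (1 + cos (\<theta> x))" for x
        by (intro mult_nonneg_nonneg W01) (use cos_ge_minus_one[of "\<theta> x"] in linarith)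
      show "W x * (1 + cos (\<theta> x)) \<le> 2" for x
        using mult_mono[OF W01(2)[of x], of "1 + cos (\<theta> x)" 2] cos_ge_minus_one[of "\<theta> x"] cos_le_one[of "\<theta> x"] by simp
      show "(\<integral>x. W x * (1 + cos (\<theta> x)) * cos (\<tau> * x k + b') \<partial>P) = (\<integral>x. W x * (1 + cos (\<theta> x)) * cos (\<tau> * x k + b') \<partial>Q)" for \<tau> b'
        unfolding exp[OF disjI1[OF refl]] exp[OF disjI2[OF refl]]
          base IH[of \<tau> t "b + b'"] IH[of "-\<tau>" t "b - b'"] ..
    qed (use P in auto)
    have sp: "E N (Suc k) B t b R = (\<integral>x. W x * (1 + cos (\<theta> x)) * indicator (B k) (x k) \<partial>R) - (\<integral>x. W x * indicator (B k) (x k) \<partial>R)"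
      if "R = P \<or> R = Q" for R
    proof -
      have 1: "W x * (1 + cos (\<theta> x)) * indicator (B k) (x k) = W x * (cos (\<theta> x) * indicator (B k) (x k)) + W x * indicator (B k) (x k)" for x
        by (simp add: algebra_simps)
      have "integrable R (\<lambda>x. W x * (cos (\<theta> x) * indicator (B k) (x k)))" "integrable R (\<lambda>x. W x * indicator (B k) (x k))"
        by (intro int that; (measurable; fail)?; simp add: indicator_def)+
      then show ?thesis
        unfolding 1 by (simp add: E_def W_def \<theta>_def mult_ac)
    qed
    show ?case using sp[of P] sp[of Q] A Bq by simp
  qed
  show ?thesis
  proof (rule measure_eqI_PiM_infinite[where I=UNIV and M="\<lambda>_. borel"])
    show "sets P = sets (PiM UNIV (\<lambda>_. borel))" "sets Q = sets (PiM UNIV (\<lambda>_. borel))"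
      using P sets_PiM_borel by auto
    show "finite_measure P" using P(1) by (simp add: prob_space_def)
    fix A :: "nat \<Rightarrow> real set" and J :: "nat set"
    assume J: "finite J" and A: "\<And>i. i \<in> J \<Longrightarrow> A i \<in> sets borel"
    obtain N where N: "J \<subseteq> {..<N}" using J finite_nat_iff_bounded by blast
    \<comment> \<open>Leaving the coordinates outside J unconstrained turns J into the initial
      segment below N.\<close>
    define B where "B i = (if i \<in> J then A i else UNIV)" for i
    have B: "B i \<in> sets borel" for i using A by (auto simp: B_def)
    have S: "prod_emb UNIV (\<lambda>_. borel) J (Pi\<^sub>E J A) = {x. \<forall>i<N. x i \<in> B i}"
      using N by (auto simp: prod_emb_def B_def PiE_def restrict_def Pi_def extensional_def)
    have ind: "(\<Prod>i<N. indicator (B i) (x i)) = (indicator {x. \<forall>i<N. x i \<in> B i} x :: real)" for x :: "nat \<Rightarrow> real"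
      by (auto simp: indicator_def prod_eq_1_iff)
    have meas: "{x. \<forall>i<N. x i \<in> B i} \<in> sets (borel :: (nat \<Rightarrow> real) measure)"
    proof -
      note [measurable] = B
      have "{x \<in> space (borel :: (nat \<Rightarrow> real) measure). \<forall>i\<in>{..<N}. x i \<in> B i} \<in> sets borel" by measurable
      then show ?thesis by simp
    qed
    have "E N N B (\<lambda>_. 0) 0 R = measure R {x. \<forall>i<N. x i \<in> B i}" if "sets R = sets borel" for R
    proof -
      have "E N N B (\<lambda>_. 0) 0 R = (\<integral>x. indicator {x. \<forall>i<N. x i \<in> B i} x \<partial>R)"
        unfolding E_def ind by simp
      also have "\<dots> = measure R ({x. \<forall>i<N. x i \<in> B i} \<inter> space R)"
        by simp
      finally show ?thesis
        using sets_eq_imp_space_eq[OF that] by simp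
    qed
    then have "measure P {x. \<forall>i<N. x i \<in> B i} = measure Q {x. \<forall>i<N. x i \<in> B i}"
      using step[of B N N "\<lambda>_. 0" 0] B P by simp
    then show "emeasure P (prod_emb UNIV (\<lambda>_. borel) J (Pi\<^sub>E J A)) = emeasure Q (prod_emb UNIV (\<lambda>_. borel) J (Pi\<^sub>E J A))"
      unfolding S using P by (simp add: finite_measure.emeasure_eq_measure prob_space_def)
  qed
qed

lemma continuous_on_fun_upd_const:
  fixes x :: "'i \<Rightarrow> 'b::topological_space"
  shows "continuous_on S (\<lambda>t. x(i := t))"
proof (rule continuous_on_coordinatewise_then_product)
  show "continuous_on S (\<lambda>t. (x(i := t)) j)" for j by (cases "j = i") auto
qed

section \<open>Gaussian integration by parts\<close>

lemma tendsto_normal_density_0: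
  assumes "\<sigma> > 0"
  shows "(normal_density 0 \<sigma> \<longlongrightarrow> 0) at_top" "(normal_density 0 \<sigma> \<longlongrightarrow> 0) at_bot"
  unfolding normal_density_def using assms by real_asymp+

text \<open>The density d of variance 1 / k satisfies d' = - k x d, so the difference of the two
  integrands is the derivative of d h, which tends to 0 at both ends because h is bounded.\<close>

lemma stein_normal:
  fixes h h' :: "real \<Rightarrow> real"
  assumes k: "k > 0" and h: "\<And>x. (h has_real_derivative h' x) (at x)"
    and h': "continuous_on UNIV h'" and B: "\<And>x. \<bar>h x\<bar> \<le> B" "\<And>x. \<bar>h' x\<bar> \<le> B"
  shows "(\<integral>x. h' x \<partial>density lborel (normal_density 0 (1 / sqrt k))) =
    k * (\<integral>x. x * h x \<partial>density lborel (normal_density 0 (1 / sqrt k)))"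
proof -
  define \<sigma> where "\<sigma> = 1 / sqrt k"
  have \<sigma>: "\<sigma> > 0" "1 / \<sigma>\<^sup>2 = k" using k by (auto simp: \<sigma>_def power_divide)
  let ?d = "normal_density 0 \<sigma>"
  have hc: "continuous_on UNIV h" using h by (meson DERIV_continuous_on)
  have [measurable]: "h \<in> borel_measurable borel" "h' \<in> borel_measurable borel"
    using hc h' by (auto intro: borel_measurable_continuous_onI)
  have dd: "(?d has_real_derivative (- k * x * ?d x)) (at x)" for x
    unfolding normal_density_def using \<sigma>
    by (auto intro!: derivative_eq_intros simp: field_simps power2_eq_square)
  have dx: "integrable lborel (\<lambda>x. ?d x * x)"
    by (rule integrable_normal_moment_nz_1[OF \<sigma>(1)])
  have i1: "integrable lborel (\<lambda>x. ?d x * h' x)"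
    by (rule integrable_mult_bounded[where B=B]) (use B \<sigma> in auto)
  have i2: "integrable lborel (\<lambda>x. (?d x * x) * h x)"
    by (rule integrable_mult_bounded[where B=B]) (use B dx in auto)
  have "(LBINT x=-\<infinity>..\<infinity>. ?d x * h' x - k * ((?d x * x) * h x)) = 0 - 0"
  proof (rule interval_integral_FTC_integrable[where F="\<lambda>x. ?d x * h x"])
    show "((\<lambda>x. ?d x * h x) has_vector_derivative ?d x * h' x - k * ((?d x * x) * h x)) (at x)" for x
      unfolding has_real_derivative_iff_has_vector_derivative[symmetric]
      by (rule derivative_eq_intros dd h)+ (simp add: algebra_simps)
    show "isCont (\<lambda>x. ?d x * h' x - k * ((?d x * x) * h x)) x" for x
    proof -
      have "isCont h x" "isCont h' x" using hc h' by (auto simp: continuous_on_eq_continuous_at)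
      moreover have "isCont ?d x" using dd by (rule DERIV_isCont)
      ultimately show ?thesis by (intro continuous_intros)
    qed
    show "set_integrable lborel (einterval (-\<infinity>) \<infinity>) (\<lambda>x. ?d x * h' x - k * ((?d x * x) * h x))"
      using i1 i2 by (simp add: set_integrable_def)
    have l: "((\<lambda>x. ?d x * h x) \<longlongrightarrow> 0) F" if "(?d \<longlongrightarrow> 0) F" for F
    proof (rule tendsto_0_le[OF that, where K=B])
      show "\<forall>\<^sub>F x in F. norm (?d x * h x) \<le> norm (?d x) * B"
        using B(1) by (intro always_eventually) (simp add: abs_mult mult_left_mono)
    qed
    show "(((\<lambda>x. ?d x * h x) \<circ> real_of_ereal) \<longlongrightarrow> 0) (at_right (-\<infinity>))"
      "(((\<lambda>x. ?d x * h x) \<circ> real_of_ereal) \<longlongrightarrow> 0) (at_left \<infinity>)"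
      using l tendsto_normal_density_0[OF \<sigma>(1)] by (simp_all add: ereal_tendsto_simps1)
  qed simp
  then have "(\<integral>x. ?d x * h' x \<partial>lborel) = k * (\<integral>x. (?d x * x) * h x \<partial>lborel)"
    using i1 i2 by (simp add: interval_lebesgue_integral_def set_lebesgue_integral_def)
  then show ?thesis
    unfolding \<sigma>_def[symmetric] using \<sigma> by (simp add: integral_density mult.assoc)
qed

text \<open>The parameter is the inverse variance: it is the factor produced by integration by
  parts, and for the KMS condition it is \<beta> times an eigenvalue.\<close>

definition gauss_seq :: "(nat \<Rightarrow> real) \<Rightarrow> (nat \<Rightarrow> real) measure" where
  "gauss_seq k = PiM UNIV (\<lambda>i. density lborel (normal_density 0 (1 / sqrt (k i))))"

lemma sets_gauss_seq [measurable_cong, simp]: "sets (gauss_seq k) = sets borel"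
proof -
  have "sets (gauss_seq k) = sets (PiM UNIV (\<lambda>_::nat. borel :: real measure))"
    unfolding gauss_seq_def by (intro sets_PiM_cong) auto
  then show ?thesis by (simp add: sets_PiM_borel)
qed

lemma space_gauss_seq [simp]: "space (gauss_seq k) = UNIV"
  using sets_eq_imp_space_eq[OF sets_gauss_seq] by simp

lemma prob_space_gauss_seq: "(\<And>i. k i > 0) \<Longrightarrow> prob_space (gauss_seq k)"
  unfolding gauss_seq_def by (intro prob_space_PiM prob_space_normal_density) simp

lemma distr_gauss_seq_coord:
  assumes "\<And>i. k i > 0"
  shows "distr (gauss_seq k) borel (\<lambda>x. x i) = density lborel (normal_density 0 (1 / sqrt (k i)))"
proof -
  let ?M = "\<lambda>i. density lborel (normal_density 0 (1 / sqrt (k i)))"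
  have "distr (PiM UNIV ?M) (?M i) (\<lambda>x. x i) = ?M i"
    using assms by (intro distr_PiM_component prob_space_normal_density) auto
  moreover have "distr (PiM UNIV ?M) (?M i) (\<lambda>x. x i) = distr (PiM UNIV ?M) borel (\<lambda>x. x i)"
    by (rule distr_cong) auto
  ultimately show ?thesis by (simp add: gauss_seq_def)
qed

lemma gauss_seq_second_moment:
  assumes k: "\<And>i. k i > 0"
  shows "integrable (gauss_seq k) (\<lambda>x. (x i)\<^sup>2)" "(\<integral>x. (x i)\<^sup>2 \<partial>gauss_seq k) = 1 / k i"
proof -
  let ?\<sigma> = "1 / sqrt (k i)"
  have s: "?\<sigma> > 0" using k by simp
  have "integrable lborel (\<lambda>x. normal_density 0 ?\<sigma> x * x\<^sup>2)"
    using integrable_normal_moment[OF s, of 0 2] by simp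
  then have "integrable (distr (gauss_seq k) borel (\<lambda>x. x i)) (\<lambda>y. y\<^sup>2)"
    unfolding distr_gauss_seq_coord[OF k] by (simp add: integrable_density)
  then show "integrable (gauss_seq k) (\<lambda>x. (x i)\<^sup>2)"
    by (simp add: integrable_distr_eq)
  have "(\<integral>x. (x i)\<^sup>2 \<partial>gauss_seq k) = (\<integral>y. y\<^sup>2 \<partial>distr (gauss_seq k) borel (\<lambda>x. x i))"
    by (simp add: integral_distr)
  also have "\<dots> = (\<integral>y. normal_density 0 ?\<sigma> y * y\<^sup>2 \<partial>lborel)"
    unfolding distr_gauss_seq_coord[OF k] by (simp add: integral_density)
  also have "\<dots> = 1 / k i"
    using integral_normal_moment_even[OF s, of 0 1] k[of i] by (simp add: power_divide)
  finally show "(\<integral>x. (x i)\<^sup>2 \<partial>gauss_seq k) = 1 / k i" .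
qed

lemma integrable_gauss_seq_coord:
  assumes "\<And>i. k i > 0"
  shows "integrable (gauss_seq k) (\<lambda>x. x i)"
  by (rule integrable_of_square[OF prob_space_gauss_seq[OF assms] _ gauss_seq_second_moment(1)[OF assms]])
     measurable

text \<open>Replacing coordinate i by an independent copy does not change the product law. Fubini
  then reduces the identity to \<open>stein_normal\<close> on each line parallel to the i-th
  axis.\<close>

lemma stein_gauss_seq:
  fixes H H' :: "(nat \<Rightarrow> real) \<Rightarrow> real"
  assumes k: "\<And>i. k i > 0"
    and H: "continuous_on UNIV H" "\<And>x. \<bar>H x\<bar> \<le> B"
    and H': "continuous_on UNIV H'" "\<And>x. \<bar>H' x\<bar> \<le> B"
    and D: "\<And>x t. ((\<lambda>t. H (x(i := t))) has_real_derivative H' (x(i := t))) (at t)"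
  shows "(\<integral>x. H' x \<partial>gauss_seq k) = k i * (\<integral>x. x i * H x \<partial>gauss_seq k)"
proof -
  let ?N = "density lborel (normal_density 0 (1 / sqrt (k i)))"
  interpret G: prob_space "gauss_seq k" by (rule prob_space_gauss_seq[OF k])
  interpret N: prob_space ?N by (rule prob_space_normal_density) (simp add: k)
  interpret NG: pair_prob_space ?N "gauss_seq k" ..
  have [measurable]: "H \<in> borel_measurable borel" "H' \<in> borel_measurable borel"
    using H H' by (auto intro: borel_measurable_continuous_onI)
  let ?u = "\<lambda>(t, x). x(i := t) :: nat \<Rightarrow> real"
  have eq: "distr (?N \<Otimes>\<^sub>M gauss_seq k) (gauss_seq k) ?u = gauss_seq k"
    unfolding gauss_seq_def
    using distr_pair_PiM_eq_PiM[of UNIV "\<lambda>i. density lborel (normal_density 0 (1 / sqrt (k i)))" i]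
    by (simp add: k prob_space_normal_density)
  have [measurable]: "?u \<in> measurable (?N \<Otimes>\<^sub>M gauss_seq k) (gauss_seq k)"
    unfolding gauss_seq_def case_prod_beta' by (rule measurable_fun_upd[where J=UNIV]) auto
  have fub: "(\<integral>x. f x \<partial>gauss_seq k) = (\<integral>x. (\<integral>t. f (x(i := t)) \<partial>?N) \<partial>gauss_seq k)"
    if f: "integrable (gauss_seq k) f" for f :: "(nat \<Rightarrow> real) \<Rightarrow> real"
  proof -
    have "integrable (distr (?N \<Otimes>\<^sub>M gauss_seq k) (gauss_seq k) ?u) f" using f eq by simp
    then have "integrable (?N \<Otimes>\<^sub>M gauss_seq k) (\<lambda>p. f (?u p))"
      by (rule integrable_distr[rotated]) measurable
    then have i: "integrable (?N \<Otimes>\<^sub>M gauss_seq k) (\<lambda>(t, x). f (x(i := t)))"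
      by (simp add: case_prod_beta')
    have "(\<integral>x. f x \<partial>gauss_seq k) = (\<integral>p. f (?u p) \<partial>(?N \<Otimes>\<^sub>M gauss_seq k))"
      using f by (subst eq[symmetric], subst integral_distr) auto
    also have "\<dots> = (\<integral>p. (case p of (t, x) \<Rightarrow> f (x(i := t))) \<partial>(?N \<Otimes>\<^sub>M gauss_seq k))"
      by (simp add: case_prod_beta')
    also have "\<dots> = (\<integral>x. (\<integral>t. f (x(i := t)) \<partial>?N) \<partial>gauss_seq k)"
      using NG.integral_snd[OF i] by simp
    finally show ?thesis .
  qed
  have i1: "integrable (gauss_seq k) H'"
    by (rule bounded_integrable[where B=B]) (use G.prob_space_axioms H' in auto)
  have i2: "integrable (gauss_seq k) (\<lambda>x. x i * H x)"
    by (rule integrable_mult_bounded[where B=B]) (use integrable_gauss_seq_coord[OF k] H in auto)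
  have "(\<integral>t. H' (x(i := t)) \<partial>?N) = k i * (\<integral>t. t * H (x(i := t)) \<partial>?N)" for x
  proof (rule stein_normal[where B=B])
    show "continuous_on UNIV (\<lambda>t. H' (x(i := t)))"
    proof (rule continuous_on_compose2[OF H'(1)])
      show "continuous_on UNIV (\<lambda>t. x(i := t))" by (rule continuous_on_fun_upd_const)
    qed auto
  qed (use k D H H' in auto)
  then show ?thesis
    unfolding fub[OF i1] fub[OF i2] by simp
qed

text \<open>Real part of the Taylor estimate for the exponential of i h, rotated by x. An error
  quadratic in h becomes |h| times a second moment in the difference quotient of a characteristic
  function.\<close>

lemma cos_taylor_bound:
  fixes x h :: real
  shows "\<bar>cos (x + h) - cos x + h * sin x\<bar> \<le> h\<^sup>2"
proof -
  have "cmod (iexp h - (\<Sum>k\<le>1. (\<i> * h) ^ k / fact k)) \<le> \<bar>h\<bar> ^ Suc 1 / fact (Suc 1)"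
    by (rule iexp_approx1)
  then have "cmod (iexp x * (iexp h - (1 + \<i> * h))) \<le> h\<^sup>2 / 2"
    by (simp add: norm_mult power2_eq_square)
  then have "\<bar>Re (iexp x * (iexp h - (1 + \<i> * h)))\<bar> \<le> h\<^sup>2 / 2"
    using abs_Re_le_cmod order_trans by blast
  moreover have "Re (iexp x * (iexp h - (1 + \<i> * h))) = cos (x + h) - cos x + h * sin x"
    by (simp add: cis_conv_exp[symmetric] cos_add algebra_simps)
  ultimately show ?thesis by (smt (verit) field_sum_of_halves zero_le_power2)
qed

text \<open>Both for the Gaussian law and for a KMS state, the characteristic function is found from
  the differential equation that integration by parts yields along rays.\<close>

lemma char_from_stein:
  fixes P :: "(nat \<Rightarrow> real) measure"
  assumes P: "prob_space P" and [measurable_cong]: "sets P = sets borel"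
    and sq: "\<And>i. i < N \<Longrightarrow> integrable P (\<lambda>x. (x i)\<^sup>2)"
    and k: "\<And>i. k i > 0"
    and stein: "\<And>w b i. i < N \<Longrightarrow>
      - w i * (\<integral>x. sin ((\<Sum>j<N. w j * x j) + b) \<partial>P) = k i * (\<integral>x. x i * cos ((\<Sum>j<N. w j * x j) + b) \<partial>P)"
  shows "(\<integral>x. cos ((\<Sum>j<N. w j * x j) + b) \<partial>P) = cos b * exp (- (\<Sum>j<N. (w j)\<^sup>2 / k j) / 2)"
proof -
  interpret prob_space P by fact
  define \<theta> where "\<theta> x = (\<Sum>j<N. w j * x j)" for x :: "nat \<Rightarrow> real"
  define q where "q = (\<Sum>j<N. (w j)\<^sup>2 / k j)"
  have [measurable]: "\<theta> \<in> borel_measurable borel" unfolding \<theta>_def by measurable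
  have xi: "integrable P (\<lambda>x. x i)" if "i < N" for i
    by (rule integrable_of_square[OF P]) (use sq that in measurable)
  have th2: "integrable P (\<lambda>x. (\<theta> x)\<^sup>2)"
  proof (rule Bochner_Integration.integrable_bound)
    show "integrable P (\<lambda>x. (\<Sum>j<N. (w j)\<^sup>2) * (\<Sum>j<N. (x j)\<^sup>2))"
      using sq by (intro integrable_mult_right Bochner_Integration.integrable_sum) auto
    show "AE x in P. norm ((\<theta> x)\<^sup>2) \<le> norm ((\<Sum>j<N. (w j)\<^sup>2) * (\<Sum>j<N. (x j)\<^sup>2))"
      using Cauchy_Schwarz_ineq_sum[of w _ "{..<N}"]
      by (intro AE_I2) (auto simp: \<theta>_def intro: order_trans[OF _ abs_ge_self])
  qed measurable
  have th: "integrable P \<theta>"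
    by (rule integrable_of_square[OF P _ th2]) measurable
  have icos: "integrable P (\<lambda>x. cos (t * \<theta> x + b))" and isin: "integrable P (\<lambda>x. sin (t * \<theta> x + b))" for t
    by (intro bounded_integrable[where B=1] P; simp)+
  have ths: "integrable P (\<lambda>x. \<theta> x * sin (t * \<theta> x + b))" for t
    by (rule integrable_mult_bounded[where B=1]) (use th in auto)
  define C where "C t = (\<integral>x. cos (t * \<theta> x + b) \<partial>P)" for t
  have thsin: "(\<integral>x. \<theta> x * sin (t * \<theta> x + b) \<partial>P) = t * q * C t" for t
  proof -
    have ic: "integrable P (\<lambda>x. x j * cos ((\<Sum>i<N. (t * w i) * x i) + (b - pi / 2)))" if "j < N" for j
      by (rule integrable_mult_bounded[where B=1]) (use xi that in auto)
    have e: "(\<Sum>i<N. (t * w i) * x i) = t * \<theta> x" for x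
      by (simp add: \<theta>_def sum_distrib_left mult.assoc)
    \<comment> \<open>A phase shift by - pi / 2 turns the hypothesis about \<open>x i\<close> times
      a cosine into one about \<open>x j\<close> times a sine, the term that the derivative of C
      contains.\<close>
    have s1: "sin (y + (b - pi/2)) = - cos (y + b)" and s2: "cos (y + (b - pi/2)) = sin (y + b)" for y
    proof -
      have 1: "y + (b - pi/2) = (y + b) - pi/2" by simp
      show "sin (y + (b - pi/2)) = - cos (y + b)" "cos (y + (b - pi/2)) = sin (y + b)"
        unfolding 1 sin_diff cos_diff by simp_all
    qed
    have j: "(\<integral>x. x j * sin (t * \<theta> x + b) \<partial>P) = t * w j / k j * C t" if "j < N" for j
    proof -
      have "t * w j * C t = k j * (\<integral>x. x j * sin (t * \<theta> x + b) \<partial>P)"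
        using stein[OF that, of "\<lambda>i. t * w i" "b - pi/2"] unfolding e s1 s2 by (simp add: C_def)
      then show ?thesis using k[of j] by (simp add: field_simps)
    qed
    have "(\<integral>x. \<theta> x * sin (t * \<theta> x + b) \<partial>P) = (\<integral>x. (\<Sum>j<N. w j * (x j * sin (t * \<theta> x + b))) \<partial>P)"
      by (simp add: \<theta>_def sum_distrib_right mult.assoc)
    also have "\<dots> = (\<Sum>j<N. w j * (\<integral>x. x j * sin (t * \<theta> x + b) \<partial>P))"
      using ic by (subst Bochner_Integration.integral_sum) (auto simp: e s2)
    also have "\<dots> = t * q * C t"
      by (simp add: j q_def sum_distrib_left sum_distrib_right power2_eq_square mult_ac)
    finally show ?thesis .
  qed
  have DC: "(C has_real_derivative - (t * q * C t)) (at t)" for t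
  proof -
    \<comment> \<open>The second moment of \<theta> bounds the Taylor error uniformly, which
      justifies differentiating under the integral.\<close>
    define E where "E = (\<integral>x. (\<theta> x)\<^sup>2 \<partial>P)"
    have bd: "\<bar>(C (t + h) - C t) / h - - (t * q * C t)\<bar> \<le> \<bar>h\<bar> * E" if "h \<noteq> 0" for h
    proof -
      define g where "g x = cos ((t + h) * \<theta> x + b) - cos (t * \<theta> x + b) + h * (\<theta> x * sin (t * \<theta> x + b))" for x
      have ig: "integrable P g"
        unfolding g_def
        by (intro Bochner_Integration.integrable_add Bochner_Integration.integrable_diff
            icos integrable_mult_right ths)
      have "C (t + h) - C t + h * (t * q * C t) = (\<integral>x. g x \<partial>P)"
        unfolding g_def using icos ths thsin[of t] by (simp add: C_def)
      moreover have "\<bar>\<integral>x. g x \<partial>P\<bar> \<le> (\<integral>x. \<bar>g x\<bar> \<partial>P)"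
        by (rule integral_abs_bound)
      moreover have "(\<integral>x. \<bar>g x\<bar> \<partial>P) \<le> (\<integral>x. h\<^sup>2 * (\<theta> x)\<^sup>2 \<partial>P)"
      proof (rule integral_mono[OF integrable_abs[OF ig] integrable_mult_right[OF th2]])
        fix x
        have "(t + h) * \<theta> x + b = (t * \<theta> x + b) + h * \<theta> x" by (simp add: distrib_right)
        then show "\<bar>g x\<bar> \<le> h\<^sup>2 * (\<theta> x)\<^sup>2"
          using cos_taylor_bound[of "t * \<theta> x + b" "h * \<theta> x"]
          by (simp only: power_mult_distrib mult.assoc g_def)
      qed
      moreover have "(\<integral>x. h\<^sup>2 * (\<theta> x)\<^sup>2 \<partial>P) = h\<^sup>2 * E" by (simp add: E_def)
      ultimately have "\<bar>C (t + h) - C t + h * (t * q * C t)\<bar> \<le> h\<^sup>2 * E" by linarith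
      then have "\<bar>C (t + h) - C t + h * (t * q * C t)\<bar> / \<bar>h\<bar> \<le> (h\<^sup>2 * E) / \<bar>h\<bar>"
        by (intro divide_right_mono) auto
      moreover have "(C (t + h) - C t) / h - - (t * q * C t) = (C (t + h) - C t + h * (t * q * C t)) / h"
        using that by (simp add: field_simps)
      moreover have "(h\<^sup>2 * E) / \<bar>h\<bar> = \<bar>h\<bar> * E"
        using that by (simp add: field_simps power2_eq_square abs_if)
      ultimately show ?thesis by (simp add: abs_divide)
    qed
    have "((\<lambda>h. (C (t + h) - C t) / h - - (t * q * C t)) \<longlongrightarrow> 0) (at 0)"
    proof (rule Lim_null_comparison)
      show "\<forall>\<^sub>F h in at 0. norm ((C (t + h) - C t) / h - - (t * q * C t)) \<le> \<bar>h\<bar> * E"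
        using bd by (auto simp: eventually_at_filter)
      have "((\<lambda>h::real. \<bar>h\<bar> * E) \<longlongrightarrow> \<bar>0\<bar> * E) (at 0)" by (intro tendsto_intros)
      then show "((\<lambda>h::real. \<bar>h\<bar> * E) \<longlongrightarrow> 0) (at 0)" by simp
    qed
    then show ?thesis unfolding DERIV_def by (rule LIM_zero_cancel)
  qed
  \<comment> \<open>The equation C' = - t q C makes V constant; t = 1 is the claimed value and t = 0
    gives cos b.\<close>
  define V where "V t = C t * exp (q * t\<^sup>2 / 2)" for t
  have "(V has_real_derivative 0) (at t)" for t
    unfolding V_def by (rule derivative_eq_intros DC refl | simp)+
  then have "V 1 = V 0"
    by (intro DERIV_isconst_all) auto
  moreover have "C 0 = cos b" by (simp add: C_def prob_space)
  ultimately have "C 1 = cos b * exp (- q / 2)"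
    by (simp add: V_def exp_minus field_simps)
  then show ?thesis by (simp add: C_def q_def \<theta>_def)
qed

lemma char_gauss_seq:
  assumes k: "\<And>i. k i > 0"
  shows "(\<integral>x. cos ((\<Sum>j<N. w j * x j) + b) \<partial>gauss_seq k) = cos b * exp (- (\<Sum>j<N. (w j)\<^sup>2 / k j) / 2)"
proof (rule char_from_stein[OF prob_space_gauss_seq[OF k]])
  fix w b i assume i: "i < N"
  let ?\<theta> = "\<lambda>x::nat \<Rightarrow> real. (\<Sum>j<N. w j * x j) + b"
  have c: "continuous_on UNIV ?\<theta>" by (intro continuous_intros continuous_on_product_coordinates)
  have "(\<integral>x. - w i * sin (?\<theta> x) \<partial>gauss_seq k) = k i * (\<integral>x. x i * cos (?\<theta> x) \<partial>gauss_seq k)"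
  proof (rule stein_gauss_seq[OF k, where B="max 1 \<bar>w i\<bar>"])
    fix x :: "nat \<Rightarrow> real" and t
    have "?\<theta> (x(i := t)) = w i * t + (\<Sum>j\<in>{..<N}-{i}. w j * x j) + b" for t
      using i by (subst sum.remove[of _ i]) auto
    then show "((\<lambda>t. cos (?\<theta> (x(i := t)))) has_real_derivative - w i * sin (?\<theta> (x(i := t)))) (at t)"
      by (auto intro!: derivative_eq_intros simp del: fun_upd_apply)
  next
    show "\<bar>- w i * sin (?\<theta> x)\<bar> \<le> max 1 \<bar>w i\<bar>" for x
      using mult_left_mono[OF abs_sin_le_one, of "\<bar>w i\<bar>" "?\<theta> x"] by (simp add: abs_mult max.coboundedI2)
    show "\<bar>cos (?\<theta> x)\<bar> \<le> max 1 \<bar>w i\<bar>" for x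
      using abs_cos_le_one[of "?\<theta> x"] by linarith
  qed (use c in \<open>auto intro!: continuous_intros\<close>)
  then show "- w i * (\<integral>x. sin (?\<theta> x) \<partial>gauss_seq k) = k i * (\<integral>x. x i * cos (?\<theta> x) \<partial>gauss_seq k)"
    by simp
qed (use k gauss_seq_second_moment(1)[OF k] in auto)

lemma continuous_on_coord [continuous_intros]:
  fixes S :: "('i \<Rightarrow> 'b::topological_space) set"
  shows "continuous_on S (\<lambda>x. x i)"
  by (rule continuous_on_subset[OF continuous_on_product_coordinates subset_UNIV])

section \<open>Smooth functions of one variable\<close>

text \<open>The derivative is existentially quantified, so that closure properties are shown by
  exhibiting a formula for it; the base case demands that the last derivative be continuous.\<close>

primrec diffk :: "nat \<Rightarrow> (real \<Rightarrow> real) \<Rightarrow> bool" where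
  "diffk 0 f \<longleftrightarrow> continuous_on UNIV f"
| "diffk (Suc k) f \<longleftrightarrow> (\<exists>f'. (\<forall>x. (f has_real_derivative f' x) (at x)) \<and> diffk k f')"

lemma diffk_SucI: "(\<And>x. (f has_real_derivative f' x) (at x)) \<Longrightarrow> diffk k f' \<Longrightarrow> diffk (Suc k) f"
  by auto

lemma diffk_Suc_imp: "diffk (Suc k) f \<Longrightarrow> diffk k f"
proof (induction k arbitrary: f)
  case 0
  then show ?case by (auto intro: DERIV_continuous_on)
next
  case (Suc k)
  then show ?case by (metis diffk.simps(2))
qed

lemma diffk_continuous: "diffk k f \<Longrightarrow> continuous_on UNIV f"
  by (induction k) (use diffk_Suc_imp in auto)

lemma diffk_const: "diffk k (\<lambda>_. c)"
  by (induction k arbitrary: c) (auto intro!: exI[of _ "\<lambda>_. 0"])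

lemma diffk_ident: "diffk k (\<lambda>x. x)"
proof (cases k)
  case (Suc k')
  show ?thesis
    unfolding Suc by (rule diffk_SucI[where f'="\<lambda>_. 1"]) (auto simp: diffk_const)
qed simp

lemma diffk_add: "diffk k f \<Longrightarrow> diffk k g \<Longrightarrow> diffk k (\<lambda>x. f x + g x)"
proof (induction k arbitrary: f g)
  case (Suc k)
  from Suc.prems obtain f' g' where
    fg: "\<And>x. (f has_real_derivative f' x) (at x)" "\<And>x. (g has_real_derivative g' x) (at x)"
    "diffk k f'" "diffk k g'" by auto
  show ?case
    by (rule diffk_SucI[where f'="\<lambda>x. f' x + g' x"]) (use fg Suc.IH in \<open>auto intro: DERIV_add\<close>)
qed (auto intro: continuous_on_add)

lemma diffk_mult: "diffk k f \<Longrightarrow> diffk k g \<Longrightarrow> diffk k (\<lambda>x. f x * g x)"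
proof (induction k arbitrary: f g)
  case (Suc k)
  from Suc.prems obtain f' g' where
    fg: "\<And>x. (f has_real_derivative f' x) (at x)" "\<And>x. (g has_real_derivative g' x) (at x)"
    "diffk k f'" "diffk k g'" by auto
  have "diffk k f" "diffk k g" using Suc.prems diffk_Suc_imp by blast+
  then show ?case
    by (intro diffk_SucI[where f'="\<lambda>x. f' x * g x + g' x * f x"] diffk_add Suc.IH DERIV_mult fg)
qed (auto intro: continuous_on_mult)

lemma diffk_affine: "diffk k f \<Longrightarrow> diffk k (\<lambda>x. f (a * x + b))"
proof (induction k arbitrary: f)
  case 0
  then show ?case by (auto intro!: continuous_on_compose2[of UNIV f] continuous_intros)
next
  case (Suc k)
  from Suc.prems obtain f' where
    f: "\<And>x. (f has_real_derivative f' x) (at x)" "diffk k f'" by auto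
  show ?case
  proof (rule diffk_SucI[where f'="\<lambda>x. f' (a * x + b) * a"])
    show "((\<lambda>x. f (a * x + b)) has_real_derivative f' (a * x + b) * a) (at x)" for x
      by (rule DERIV_chain2[OF f(1)]) (auto intro!: derivative_eq_intros)
    show "diffk k (\<lambda>x. f' (a * x + b) * a)"
      by (intro diffk_mult diffk_const Suc.IH f)
  qed
qed

text \<open>For p = 1 this is the classical smooth function that vanishes to infinite order at 0.
  The polynomial factor makes the family closed under differentiation, so smoothness is one
  induction.\<close>

definition flat :: "real poly \<Rightarrow> real \<Rightarrow> real" where
  "flat p x = (if x > 0 then poly p (1 / x) * exp (- (1 / x)) else 0)"

lemma poly_exp_tendsto_0: "((\<lambda>y. poly p y * exp (- y)) \<longlongrightarrow> (0::real)) at_top"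
proof -
  have "((\<lambda>y. \<Sum>i\<le>degree p. coeff p i * (y ^ i / exp y)) \<longlongrightarrow> (\<Sum>i\<le>degree p. coeff p i * 0)) at_top"
    by (intro tendsto_intros tendsto_power_div_exp_0)
  then show ?thesis
    by (simp add: poly_altdef sum_distrib_right exp_minus divide_inverse mult.assoc)
qed

text \<open>Differentiating \<open>p(1/x) exp(-1/x)\<close> gives \<open>q(1/x) exp(-1/x)\<close> with
  \<open>q(y) = y\<^sup>2 (p(y) - p'(y))\<close>.\<close>

lemma flat_derivative:
  "(flat p has_real_derivative flat ([:0, 0, 1:] * (p - pderiv p)) x) (at x)"
proof -
  let ?q = "[:0, 0, 1:] * (p - pderiv p)"
  consider "x > 0" | "x < 0" | "x = 0" by linarith
  then show ?thesis
  proof cases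
    case 1
    have "((\<lambda>x. poly p (1 / x) * exp (- (1 / x))) has_real_derivative flat ?q x) (at x)"
      using 1 by (auto intro!: derivative_eq_intros DERIV_chain2[OF poly_DERIV]
        simp: flat_def field_simps power2_eq_square)
    then show ?thesis
      by (rule has_field_derivative_transform_within_open[of _ _ _ "{0<..}"]) (use 1 in \<open>auto simp: flat_def\<close>)
  next
    case 2
    have "((\<lambda>_. 0) has_real_derivative flat ?q x) (at x)"
      using 2 by (simp add: flat_def)
    then show ?thesis
      by (rule has_field_derivative_transform_within_open[of _ _ _ "{..<0}"]) (use 2 in \<open>auto simp: flat_def\<close>)
  next
    case 3
    have "((\<lambda>h. flat p h / h) \<longlongrightarrow> 0) (at 0)"
    proof (rule filterlim_split_at)
      have "\<forall>\<^sub>F h in at_left 0. flat p h / h = 0"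
        by (auto simp: flat_def eventually_at_filter)
      then show "((\<lambda>h. flat p h / h) \<longlongrightarrow> 0) (at_left 0)"
        by (rule tendsto_eventually)
      have "((\<lambda>h. poly ([:0, 1:] * p) (inverse h) * exp (- inverse h)) \<longlongrightarrow> 0) (at_right 0)"
        by (rule filterlim_compose[OF poly_exp_tendsto_0 filterlim_inverse_at_top_right])
      moreover have "\<forall>\<^sub>F h in at_right 0. poly ([:0, 1:] * p) (inverse h) * exp (- inverse h) = flat p h / h"
        by (auto simp: flat_def eventually_at_filter inverse_eq_divide)
      ultimately show "((\<lambda>h. flat p h / h) \<longlongrightarrow> 0) (at_right 0)"
        by (rule Lim_transform_eventually)
    qed
    then show ?thesis using 3 by (simp add: DERIV_def flat_def)
  qed
qed

lemma diffk_flat: "diffk k (flat p)"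
proof (induction k arbitrary: p)
  case 0
  show ?case by (auto intro: DERIV_continuous_on flat_derivative)
qed (blast intro: diffk_SucI flat_derivative)

text \<open>The product \<rho> of \<open>flat 1\<close> and its mirror image is positive exactly on
  (0, 1). Its antiderivative P climbs from 0 to \<open>P 1\<close> and is constant on either side;
  two shifted copies of P, one of them reflected, multiply to a plateau.\<close>

lemma smooth_plateau:
  obtains \<eta> :: "real \<Rightarrow> real" where "\<And>k. diffk k \<eta>" "\<And>x. 0 \<le> \<eta> x" "\<And>x. \<eta> x \<le> 1"
    "\<And>x. \<bar>x\<bar> \<le> 1 \<Longrightarrow> \<eta> x = 1" "\<And>x. \<bar>x\<bar> \<ge> 2 \<Longrightarrow> \<eta> x = 0"
proof -
  define \<rho> where "\<rho> x = flat 1 x * flat 1 ((-1) * x + 1)" for x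
  have \<rho>: "diffk k \<rho>" for k
    unfolding \<rho>_def by (intro diffk_mult diffk_flat diffk_affine)
  have \<rho>0: "\<rho> x \<ge> 0" "x \<le> 0 \<Longrightarrow> \<rho> x = 0" "x \<ge> 1 \<Longrightarrow> \<rho> x = 0" "0 < x \<Longrightarrow> x < 1 \<Longrightarrow> \<rho> x > 0" for x
    by (auto simp: \<rho>_def flat_def)
  have "\<exists>F. \<forall>x::real. - \<infinity> < ereal x \<longrightarrow> ereal x < \<infinity> \<longrightarrow> (F has_vector_derivative \<rho> x) (at x)"
    by (rule einterval_antiderivative)
      (use diffk_continuous[OF \<rho>] in \<open>auto simp: continuous_on_eq_continuous_at\<close>)
  then obtain F where F: "\<And>x. (F has_real_derivative \<rho> x) (at x)"
    by (auto simp: has_real_derivative_iff_has_vector_derivative)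
  define P where "P x = F x - F 0" for x
  have P: "(P has_real_derivative \<rho> x) (at x)" for x
    unfolding P_def by (auto intro!: derivative_eq_intros F)
  have Pk: "diffk k P" for k
  proof (cases k)
    case 0
    then show ?thesis using P by (auto intro: DERIV_continuous_on)
  qed (use P \<rho> in \<open>auto intro: diffk_SucI\<close>)
  have mono: "P x \<le> P y" if "x \<le> y" for x y
    using that by (rule DERIV_nonneg_imp_nondecreasing) (use P \<rho>0 in blast)
  have P00: "P 0 = 0" by (simp add: P_def)
  have P0: "P x = 0" if "x \<le> 0" for x
  proof (cases "x = 0")
    case False
    have "P 0 = P x"
    proof (rule DERIV_isconst_end[where f=P and a=x and b=0])
      show "x < 0" using False that by simp
      show "continuous_on {x..0} P" using diffk_continuous[OF Pk] continuous_on_subset by blast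
      show "(P has_real_derivative 0) (at y)" if "x < y" "y < 0" for y
        using P[of y] \<rho>0(2)[of y] that by simp
    qed
    then show ?thesis using P00 by simp
  qed (simp add: P00)
  have P1: "P x = P 1" if "x \<ge> 1" for x
  proof (cases "x = 1")
    case False
    show ?thesis
    proof (rule DERIV_isconst_end[where f=P and a=1 and b=x])
      show "1 < x" using False that by simp
      show "continuous_on {1..x} P" using diffk_continuous[OF Pk] continuous_on_subset by blast
      show "(P has_real_derivative 0) (at y)" if "1 < y" "y < x" for y
        using P[of y] \<rho>0(3)[of y] that by simp
    qed
  qed simp
  have pos: "P 1 > 0"
  proof -
    have "P 0 < P 1"
    proof (rule DERIV_pos_imp_increasing_open[where f=P])
      show "\<exists>y. (P has_real_derivative y) (at x) \<and> 0 < y" if "0 < x" "x < 1" for x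
        using P \<rho>0(4)[OF that] by blast
      show "continuous_on {0..1} P"
        using diffk_continuous[OF Pk] by (rule continuous_on_subset) simp
    qed simp
    then show ?thesis by (simp add: P00)
  qed
  have bd0: "0 \<le> P x" for x using mono[of 0 x] P0[of x] P00 by (cases "x \<le> 0") auto
  have bd1: "P x \<le> P 1" for x using mono[of x 1] P1[of x] by (cases "x \<le> 1") auto
  \<comment> \<open>\<open>P (x + 2)\<close> has reached \<open>P 1\<close> at x = -1 and vanishes
    up to x = -2; the second factor is its mirror image. The written factors 1 and -1 match the form
    of \<open>diffk_affine\<close>.\<close>
  define \<eta> where "\<eta> x = (P (1 * x + 2) * P ((-1) * x + 2)) * (1 / (P 1 * P 1))" for x
  show thesis
  proof
    show "diffk k \<eta>" for k
      unfolding \<eta>_def by (intro diffk_mult diffk_const diffk_affine Pk)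
    show "0 \<le> \<eta> x" for x using bd0 pos by (simp add: \<eta>_def)
    show "\<eta> x \<le> 1" for x
    proof -
      have "P (1 * x + 2) * P ((-1) * x + 2) \<le> P 1 * P 1"
        by (intro mult_mono bd0 bd1)
      then show ?thesis using pos by (simp add: \<eta>_def divide_le_eq)
    qed
    show "\<eta> x = 1" if "\<bar>x\<bar> \<le> 1" for x
      using P1[of "x + 2"] P1[of "2 - x"] that pos by (simp add: \<eta>_def abs_le_iff)
    show "\<eta> x = 0" if "\<bar>x\<bar> \<ge> 2" for x
      using that P0[of "x + 2"] P0[of "2 - x"] by (auto simp: \<eta>_def abs_if split: if_splits)
  qed
qed

section \<open>The classes \<open>C\<^sup>k\<close> on sequences\<close>

lemma Rn_upd: "x \<in> Rn m \<Longrightarrow> i < m \<Longrightarrow> x(i := t) \<in> Rn m"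
  by (simp add: Rn_def)

lemma closed_Rn: "closed (Rn m)"
proof -
  have "Rn m = (\<Inter>i\<in>{m..}. {x. x i = 0})" by (auto simp: Rn_def)
  also have "closed \<dots>"
    by (intro closed_INT ballI closed_Collect_eq) (auto intro: continuous_intros)
  finally show ?thesis .
qed

lemma partial_deriv_eqI:
  "((\<lambda>t. \<phi> (x(i := t))) has_real_derivative d) (at (x i)) \<Longrightarrow> partial_deriv i \<phi> x = d"
  by (simp add: partial_deriv_def DERIV_imp_deriv)

text \<open>Changing a coordinate below m does not leave \<open>Rn m\<close>, so partial derivatives
  see only the values there. This allows a derivative to be replaced by a formula that agrees with
  it on \<open>Rn m\<close> alone.\<close>

lemma Ck_cong:
  assumes "\<And>x. x \<in> Rn m \<Longrightarrow> \<phi> x = \<psi> x"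
  shows "Ck m k \<phi> = Ck m k \<psi>"
  using assms
proof (induction k arbitrary: \<phi> \<psi>)
  case 0
  then show ?case by (simp cong: continuous_on_cong)
next
  case (Suc k)
  have u: "\<phi> (x(i := t)) = \<psi> (x(i := t))" if "x \<in> Rn m" "i < m" for x i t
    using Suc.prems Rn_upd that by blast
  have "Ck m k (partial_deriv i \<phi>) = Ck m k (partial_deriv i \<psi>)" if "i < m" for i
    by (rule Suc.IH) (simp add: partial_deriv_def u that)
  moreover have "continuous_on (Rn m) \<phi> = continuous_on (Rn m) \<psi>"
    by (rule continuous_on_cong) (use Suc.prems in auto)
  ultimately show ?case using u by simp
qed

lemma Ck_continuous: "Ck m k \<phi> \<Longrightarrow> continuous_on (Rn m) \<phi>"
  by (cases k) auto

lemma Ck_Suc_imp: "Ck m (Suc k) \<phi> \<Longrightarrow> Ck m k \<phi>"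
  by (induction k arbitrary: \<phi>) auto

lemma Ck_SucI:
  assumes "continuous_on (Rn m) \<phi>"
    and "\<And>i x. i < m \<Longrightarrow> x \<in> Rn m \<Longrightarrow> ((\<lambda>t. \<phi> (x(i := t))) has_real_derivative \<phi>' i x) (at (x i))"
    and "\<And>i. i < m \<Longrightarrow> Ck m k (\<phi>' i)"
  shows "Ck m (Suc k) \<phi>"
proof -
  have "Ck m k (partial_deriv i \<phi>)" if "i < m" for i
    using assms(3)[OF that] Ck_cong[of m "partial_deriv i \<phi>" "\<phi>' i"] partial_deriv_eqI assms(2) that by metis
  moreover have "(\<lambda>t. \<phi> (x(i := t))) differentiable (at (x i))" if "i < m" "x \<in> Rn m" for i x
    using assms(2)[OF that] by (meson real_differentiable_def)
  ultimately show ?thesis using assms(1) by simp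
qed

text \<open>The hypothesis is applied at the point \<open>x(i := t)\<close>, which gives the
  derivative along the whole line through x, the form that mean value arguments need.\<close>

lemma Ck_SucD:
  assumes "Ck m (Suc k) \<phi>" "i < m" "x \<in> Rn m"
  shows "((\<lambda>t. \<phi> (x(i := t))) has_real_derivative partial_deriv i \<phi> (x(i := t))) (at t)"
proof -
  let ?y = "x(i := t)"
  have "(\<lambda>s. \<phi> (?y(i := s))) differentiable (at (?y i))"
    using assms(1,2) Rn_upd[OF assms(3,2), of t] unfolding Ck.simps by blast
  then have "((\<lambda>s. \<phi> (?y(i := s))) has_real_derivative partial_deriv i \<phi> ?y) (at (?y i))"
    unfolding partial_deriv_def by (simp only: DERIV_deriv_iff_real_differentiable)
  then show ?thesis by simp
qed

lemma Ck_partial: "Ck m (Suc k) \<phi> \<Longrightarrow> i < m \<Longrightarrow> Ck m k (partial_deriv i \<phi>)"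
  by simp

lemma Ck_const: "Ck m k (\<lambda>_. c)"
proof (induction k arbitrary: c)
  case (Suc k)
  show ?case by (rule Ck_SucI[where \<phi>'="\<lambda>_ _. 0"]) (use Suc in auto)
qed simp

lemma Ck_add: "Ck m k \<phi> \<Longrightarrow> Ck m k \<psi> \<Longrightarrow> Ck m k (\<lambda>x. \<phi> x + \<psi> x)"
proof (induction k arbitrary: \<phi> \<psi>)
  case (Suc k)
  show ?case
  proof (rule Ck_SucI[where \<phi>'="\<lambda>i x. partial_deriv i \<phi> x + partial_deriv i \<psi> x"])
    fix i x assume "i < m" "x \<in> Rn m"
    then show "((\<lambda>t. \<phi> (x(i := t)) + \<psi> (x(i := t))) has_real_derivative partial_deriv i \<phi> x + partial_deriv i \<psi> x) (at (x i))"
      using DERIV_add[OF Ck_SucD[OF Suc.prems(1), of i x "x i"] Ck_SucD[OF Suc.prems(2), of i x "x i"]]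
      by (simp del: fun_upd_apply)
  qed (use Suc in \<open>auto intro: continuous_on_add\<close>)
qed (auto intro: continuous_on_add)

lemma Ck_mult: "Ck m k \<phi> \<Longrightarrow> Ck m k \<psi> \<Longrightarrow> Ck m k (\<lambda>x. \<phi> x * \<psi> x)"
proof (induction k arbitrary: \<phi> \<psi>)
  case (Suc k)
  have l: "Ck m k \<phi>" "Ck m k \<psi>" using Suc.prems Ck_Suc_imp by blast+
  show ?case
  proof (rule Ck_SucI[where \<phi>'="\<lambda>i x. partial_deriv i \<phi> x * \<psi> x + partial_deriv i \<psi> x * \<phi> x"])
    fix i x assume "i < m" "x \<in> Rn m"
    then show "((\<lambda>t. \<phi> (x(i := t)) * \<psi> (x(i := t))) has_real_derivative partial_deriv i \<phi> x * \<psi> x + partial_deriv i \<psi> x * \<phi> x) (at (x i))"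
      using DERIV_mult[OF Ck_SucD[OF Suc.prems(1), of i x "x i"] Ck_SucD[OF Suc.prems(2), of i x "x i"]]
      by (simp del: fun_upd_apply)
  next
    show "Ck m k (\<lambda>x. partial_deriv i \<phi> x * \<psi> x + partial_deriv i \<psi> x * \<phi> x)" if "i < m" for i
      using Suc.prems that by (intro Ck_add Suc.IH l Ck_partial)
  qed (use Suc.prems in \<open>auto intro: continuous_on_mult\<close>)
qed (auto intro: continuous_on_mult)

lemma Ck_prod: "(\<And>i. i \<in> I \<Longrightarrow> Ck m k (\<phi> i)) \<Longrightarrow> Ck m k (\<lambda>x. \<Prod>i\<in>I. \<phi> i x)"
proof (induction I rule: infinite_finite_induct)
  case (insert j I)
  then show ?case by (simp add: Ck_mult)
qed (simp_all add: Ck_const)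

lemma Ck_coord: "diffk k h \<Longrightarrow> i < m \<Longrightarrow> Ck m k (\<lambda>x. h (x i))"
proof (induction k arbitrary: h)
  case 0
  then show ?case
    by (auto intro!: continuous_on_compose2[of UNIV h] continuous_intros)
next
  case (Suc k)
  then obtain h' where h: "\<And>x. (h has_real_derivative h' x) (at x)" "diffk k h'" by auto
  show ?case
  proof (rule Ck_SucI[where \<phi>'="\<lambda>j x. if j = i then h' (x i) else 0"])
    show "continuous_on (Rn m) (\<lambda>x. h (x i))"
      using diffk_continuous[OF Suc.prems(1)]
      by (auto intro!: continuous_on_compose2[of UNIV h] continuous_intros)
    show "Ck m k (\<lambda>x. if j = i then h' (x i) else 0)" for j
      using Suc.IH[OF h(2)] Suc.prems(2) Ck_const by (cases "j = i") auto
  qed (use h in auto)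
qed

text \<open>Differentiation multiplies by \<open>w i\<close> and shifts the phase by pi / 2, so with
  b arbitrary the induction stays inside the family.\<close>

lemma Ck_cos_linear:
  fixes w :: "nat \<Rightarrow> real"
  shows "Ck m k (\<lambda>x. cos ((\<Sum>j<m. w j * x j) + b))"
proof (induction k arbitrary: b)
  case 0
  show ?case by (auto intro!: continuous_intros)
next
  case (Suc k)
  show ?case
  proof (rule Ck_SucI[where \<phi>'="\<lambda>i x. w i * cos ((\<Sum>j<m. w j * x j) + (b + pi / 2))"])
    show "continuous_on (Rn m) (\<lambda>x. cos ((\<Sum>j<m. w j * x j) + b))"
      by (auto intro!: continuous_intros)
    fix i and x :: "nat \<Rightarrow> real" assume i: "i < m"
    have s: "(\<Sum>j<m. w j * (x(i := t)) j) = w i * t + (\<Sum>j\<in>{..<m}-{i}. w j * x j)" for t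
      using i by (subst sum.remove[of _ i]) auto
    have s': "(\<Sum>j<m. w j * x j) = w i * x i + (\<Sum>j\<in>{..<m}-{i}. w j * x j)"
      using i by (subst sum.remove[of _ i]) auto
    have "cos (y + (b + pi / 2)) = - sin (y + b)" for y
      using cos_add[of "y + b" "pi / 2"] by (simp add: add.assoc)
    then show "((\<lambda>t. cos ((\<Sum>j<m. w j * (x(i := t)) j) + b)) has_real_derivative w i * cos ((\<Sum>j<m. w j * x j) + (b + pi / 2))) (at (x i))"
      unfolding s s' by (auto intro!: derivative_eq_intros)
  next
    show "Ck m k (\<lambda>x. w i * cos ((\<Sum>j<m. w j * x j) + (b + pi / 2)))" for i
      by (intro Ck_mult Ck_const Suc.IH)
  qed
qed

text \<open>Tychonoff's theorem for a product of compact intervals.\<close>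

lemma compact_box:
  fixes r :: "'i \<Rightarrow> real"
  shows "compact {x. \<forall>i. \<bar>x i\<bar> \<le> r i}"
proof -
  have "compactin (product_topology (\<lambda>_. euclidean) UNIV) (PiE UNIV (\<lambda>i. {- r i..r i}))"
    by (subst compactin_PiE) (auto simp: compactin_euclidean_iff)
  moreover have "PiE UNIV (\<lambda>i. {- r i..r i}) = {x. \<forall>i. \<bar>x i\<bar> \<le> r i}"
    by (auto simp: PiE_def abs_le_iff minus_le_iff)
  ultimately show ?thesis by (simp add: euclidean_product_topology compactin_euclidean_iff)
qed

lemma Cc_inftyI:
  assumes "\<And>k. Ck m k \<phi>" and "\<And>x i. x \<in> Rn m \<Longrightarrow> \<phi> x \<noteq> 0 \<Longrightarrow> i < m \<Longrightarrow> \<bar>x i\<bar> \<le> R"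
  shows "\<phi> \<in> Cc_infty m"
proof -
  \<comment> \<open>Radius 0 from index m on, where elements of \<open>Rn m\<close> vanish, puts the
    support into a box of the whole sequence space.\<close>
  let ?K = "{x. \<forall>i. \<bar>x i\<bar> \<le> (if i < m then R else 0)}"
  have "{x \<in> Rn m. \<phi> x \<noteq> 0} \<subseteq> ?K" using assms(2) by (auto simp: Rn_def)
  then have "closure {x \<in> Rn m. \<phi> x \<noteq> 0} \<subseteq> ?K"
    by (intro closure_minimal compact_imp_closed compact_box)
  then have "closure {x \<in> Rn m. \<phi> x \<noteq> 0} = ?K \<inter> closure {x \<in> Rn m. \<phi> x \<noteq> 0}" by blast
  also have "compact \<dots>" by (intro compact_Int_closed compact_box closed_closure)
  finally show ?thesis using assms(1) by (simp add: Cc_infty_def)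
qed

lemma Cc_infty_support:
  assumes "\<phi> \<in> Cc_infty m"
  obtains R where "R > 0" "\<And>x i. x \<in> Rn m \<Longrightarrow> \<phi> x \<noteq> 0 \<Longrightarrow> \<bar>x i\<bar> \<le> R"
proof -
  let ?S = "{x \<in> Rn m. \<phi> x \<noteq> 0}"
  have c: "compact (closure ?S)" using assms by (simp add: Cc_infty_def)
  have "\<exists>r. \<forall>x\<in>closure ?S. \<bar>x i\<bar> \<le> r" for i
  proof -
    have "compact ((\<lambda>x. x i) ` closure ?S)"
      by (rule compact_continuous_image[OF _ c]) (auto intro!: continuous_intros)
    then show ?thesis by (auto dest!: compact_imp_bounded simp: bounded_iff)
  qed
  then obtain r where r: "\<And>i x. x \<in> ?S \<Longrightarrow> \<bar>x i\<bar> \<le> r i"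
    using closure_subset by (metis (no_types, lifting) subset_iff)
  show thesis
  proof
    show "1 + (\<Sum>i<m. \<bar>r i\<bar>) > 0" by (simp add: add_pos_nonneg sum_nonneg)
    fix x i assume x: "x \<in> Rn m" "\<phi> x \<noteq> 0"
    show "\<bar>x i\<bar> \<le> 1 + (\<Sum>i<m. \<bar>r i\<bar>)"
    proof (cases "i < m")
      case True
      then have "\<bar>r i\<bar> \<le> (\<Sum>i<m. \<bar>r i\<bar>)" by (intro member_le_sum) auto
      then show ?thesis using r[of x i] x by auto
    qed (use x in \<open>simp add: Rn_def sum_nonneg\<close>)
  qed
qed

lemma Cc_infty_bounded:
  assumes "\<phi> \<in> Cc_infty m"
  obtains B where "\<And>x. x \<in> Rn m \<Longrightarrow> \<bar>\<phi> x\<bar> \<le> B"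
proof -
  let ?S = "{x \<in> Rn m. \<phi> x \<noteq> 0}"
  have c: "compact (closure ?S)" using assms by (simp add: Cc_infty_def)
  have "closure ?S \<subseteq> Rn m" by (intro closure_minimal closed_Rn) auto
  moreover have "continuous_on (Rn m) \<phi>" using assms Ck_continuous by (auto simp: Cc_infty_def)
  ultimately have "compact (\<phi> ` closure ?S)"
    using c compact_continuous_image continuous_on_subset by blast
  then have "\<exists>B. \<forall>x\<in>closure ?S. \<bar>\<phi> x\<bar> \<le> B"
    by (auto dest!: compact_imp_bounded simp: bounded_iff)
  then obtain B where B: "\<And>x. x \<in> closure ?S \<Longrightarrow> \<bar>\<phi> x\<bar> \<le> B"
    by blast
  show thesis
  proof
    show "\<bar>\<phi> x\<bar> \<le> \<bar>B\<bar>" if "x \<in> Rn m" for x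
      using B[of x] closure_subset[of ?S] that by (cases "\<phi> x = 0") fastforce+
  qed
qed

text \<open>If some coordinate j of x exceeds R in absolute value, it still does so after a small
  change of coordinate i, even when i = j. Hence \<phi> vanishes near x along that line, and so does
  its derivative.\<close>

lemma partial_deriv_support:
  assumes R: "\<And>x i. x \<in> Rn m \<Longrightarrow> \<phi> x \<noteq> 0 \<Longrightarrow> \<bar>x i\<bar> \<le> R"
    and "i < m" and x: "x \<in> Rn m" "partial_deriv i \<phi> x \<noteq> 0"
  shows "\<bar>x j\<bar> \<le> R"
proof (rule ccontr)
  assume j: "\<not> \<bar>x j\<bar> \<le> R"
  define S where "S = {t. R < \<bar>(x(i := t)) j\<bar>}"
  have "open S"
    unfolding S_def by (cases "i = j") (auto intro!: open_Collect_less continuous_intros)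
  moreover have "\<phi> (x(i := t)) = 0" if "t \<in> S" for t
  proof (rule ccontr)
    assume "\<phi> (x(i := t)) \<noteq> 0"
    then have "\<bar>(x(i := t)) j\<bar> \<le> R" by (rule R[OF Rn_upd[OF x(1) \<open>i < m\<close>]])
    then show False using that by (simp add: S_def)
  qed
  moreover have "x i \<in> S" using j by (auto simp: S_def)
  ultimately have "((\<lambda>t. \<phi> (x(i := t))) has_real_derivative 0) (at (x i))"
    by (intro has_field_derivative_transform_within_open[OF DERIV_const[of 0]]) auto
  then show False using x(2) partial_deriv_eqI by blast
qed

lemma Cc_infty_partial:
  assumes "\<phi> \<in> Cc_infty m" "i < m"
  shows "partial_deriv i \<phi> \<in> Cc_infty m"
proof -
  obtain R where R: "R > 0" "\<And>x i. x \<in> Rn m \<Longrightarrow> \<phi> x \<noteq> 0 \<Longrightarrow> \<bar>x i\<bar> \<le> R"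
    using Cc_infty_support[OF assms(1)] by blast
  have C: "Ck m k \<phi>" for k using assms by (simp add: Cc_infty_def)
  show ?thesis
  proof (rule Cc_inftyI[where R=R])
    show "Ck m k (partial_deriv i \<phi>)" for k using C[of "Suc k"] assms(2) by simp
    show "\<bar>x j\<bar> \<le> R" if "x \<in> Rn m" "partial_deriv i \<phi> x \<noteq> 0" for x j
      using partial_deriv_support[of m \<phi> R i x j] R(2) assms(2) that by blast
  qed
qed

text \<open>Schwarz's theorem: both mixed derivatives are limits of the same second difference, by
  applying the mean value theorem twice in either order.\<close>

lemma mixed_derivatives_eq:
  fixes f f1 f2 f12 f21 :: "real \<Rightarrow> real \<Rightarrow> real"
  assumes 1: "\<And>s t. ((\<lambda>s. f s t) has_real_derivative f1 s t) (at s)"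
    and 2: "\<And>s t. ((\<lambda>t. f s t) has_real_derivative f2 s t) (at t)"
    and 12: "\<And>s t. ((\<lambda>t. f1 s t) has_real_derivative f12 s t) (at t)"
    and 21: "\<And>s t. ((\<lambda>s. f2 s t) has_real_derivative f21 s t) (at s)"
    and c: "continuous_on UNIV (\<lambda>p. f12 (fst p) (snd p))" "continuous_on UNIV (\<lambda>p. f21 (fst p) (snd p))"
  shows "f12 a b = f21 a b"
proof -
  have "\<exists>p q. fst p \<in> {a<..<a + h} \<and> snd p \<in> {b<..<b + h} \<and> fst q \<in> {a<..<a + h} \<and> snd q \<in> {b<..<b + h} \<and>
      f12 (fst p) (snd p) = f21 (fst q) (snd q)" if h: "h > 0" for h
  proof -
    have mvt: "\<exists>z. u < z \<and> z < u + h \<and> g (u + h) - g u = h * g' z"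
      if "\<And>x. (g has_real_derivative g' x) (at x)" for g g' :: "real \<Rightarrow> real" and u
      using MVT2[of u "u + h" g g'] h that by force
    obtain s where s: "a < s" "s < a + h"
      "(f (a + h) (b + h) - f (a + h) b) - (f a (b + h) - f a b) = h * (f1 s (b + h) - f1 s b)"
      using mvt[of "\<lambda>s. f s (b + h) - f s b" "\<lambda>s. f1 s (b + h) - f1 s b" a, OF DERIV_diff[OF 1 1]] by blast
    obtain t where t: "b < t" "t < b + h" "f1 s (b + h) - f1 s b = h * f12 s t"
      using mvt[of "f1 s" "f12 s" b, OF 12] by blast
    obtain t' where t': "b < t'" "t' < b + h"
      "(f (a + h) (b + h) - f a (b + h)) - (f (a + h) b - f a b) = h * (f2 (a + h) t' - f2 a t')"
      using mvt[of "\<lambda>t. f (a + h) t - f a t" "\<lambda>t. f2 (a + h) t - f2 a t" b, OF DERIV_diff[OF 2 2]] by blast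
    obtain s' where s': "a < s'" "s' < a + h" "f2 (a + h) t' - f2 a t' = h * f21 s' t'"
      using mvt[of "\<lambda>s. f2 s t'" "\<lambda>s. f21 s t'" a, OF 21] by blast
    have "h * (h * f12 s t) = (f (a + h) (b + h) - f (a + h) b) - (f a (b + h) - f a b)"
      using s(3) t(3) by simp
    also have "\<dots> = (f (a + h) (b + h) - f a (b + h)) - (f (a + h) b - f a b)" by simp
    also have "\<dots> = h * (h * f21 s' t')"
      using t'(3) s'(3) by simp
    finally have "h * (h * f12 s t) = h * (h * f21 s' t')" .
    then have "f12 s t = f21 s' t'" using h by simp
    then show ?thesis
      using s(1,2) t(1,2) t'(1,2) s'(1,2) by (intro exI[of _ "(s, t)"] exI[of _ "(s', t')"]) simp
  qed
  then have "\<forall>n. \<exists>p q. fst p \<in> {a<..<a + 1 / real (Suc n)} \<and> snd p \<in> {b<..<b + 1 / real (Suc n)} \<and>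
      fst q \<in> {a<..<a + 1 / real (Suc n)} \<and> snd q \<in> {b<..<b + 1 / real (Suc n)} \<and>
      f12 (fst p) (snd p) = f21 (fst q) (snd q)"
    by simp
  then obtain p q where pq:
    "\<And>n. fst (p n) \<in> {a<..<a + 1 / real (Suc n)}" "\<And>n. snd (p n) \<in> {b<..<b + 1 / real (Suc n)}"
    "\<And>n. fst (q n) \<in> {a<..<a + 1 / real (Suc n)}" "\<And>n. snd (q n) \<in> {b<..<b + 1 / real (Suc n)}"
    "\<And>n. f12 (fst (p n)) (snd (p n)) = f21 (fst (q n)) (snd (q n))"
    by metis
  have sq: "x \<longlonglongrightarrow> c" if "\<And>n. x n \<in> {c<..<c + 1 / real (Suc n)}" for x :: "nat \<Rightarrow> real" and c
  proof (rule tendsto_sandwich[of "\<lambda>_. c" _ _ "\<lambda>n. c + 1 / real (Suc n)"])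
    have "(\<lambda>n. c + 1 / real (Suc n)) \<longlonglongrightarrow> c + 0"
      by (intro tendsto_intros LIMSEQ_Suc[OF lim_1_over_n])
    then show "(\<lambda>n. c + 1 / real (Suc n)) \<longlonglongrightarrow> c" by simp
    show "\<forall>\<^sub>F n in sequentially. c \<le> x n" "\<forall>\<^sub>F n in sequentially. x n \<le> c + 1 / real (Suc n)"
      using that by (auto simp: less_imp_le)
  qed simp
  have "(\<lambda>n. (fst (p n), snd (p n))) \<longlonglongrightarrow> (a, b)" "(\<lambda>n. (fst (q n), snd (q n))) \<longlonglongrightarrow> (a, b)"
    by (intro tendsto_Pair sq pq)+
  then have "p \<longlonglongrightarrow> (a, b)" "q \<longlonglongrightarrow> (a, b)" by simp_all
  moreover have "isCont (\<lambda>p. f12 (fst p) (snd p)) (a, b)" "isCont (\<lambda>p. f21 (fst p) (snd p)) (a, b)"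
    using c by (simp_all add: continuous_on_eq_continuous_at)
  ultimately have "(\<lambda>n. f12 (fst (p n)) (snd (p n))) \<longlonglongrightarrow> f12 a b"
    and "(\<lambda>n. f21 (fst (q n)) (snd (q n))) \<longlonglongrightarrow> f21 a b"
    using isCont_tendsto_compose[of "(a, b)" "\<lambda>p. f12 (fst p) (snd p)" p]
      isCont_tendsto_compose[of "(a, b)" "\<lambda>p. f21 (fst p) (snd p)" q] by simp_all
  then show ?thesis using pq(5) LIMSEQ_unique by simp
qed

lemma partial_deriv_commute:
  assumes C: "Ck m 2 \<phi>" and ij: "i < m" "j < m" and x: "x \<in> Rn m"
  shows "partial_deriv i (partial_deriv j \<phi>) x = partial_deriv j (partial_deriv i \<phi>) x"
proof (cases "i = j")
  case False
  have C': "Ck m (Suc (Suc 0)) \<phi>" using C by (simp add: numeral_2_eq_2)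
  let ?y = "\<lambda>s t. x(i := s, j := t)"
  \<comment> \<open>Both orders of the updates are needed: the variable of differentiation has to be
    the outer one.\<close>
  have y': "?y s t = x(j := t, i := s)" for s t using False by (simp add: fun_upd_twist)
  have Rn: "x(i := s) \<in> Rn m" "x(j := s) \<in> Rn m" "?y s t \<in> Rn m" for s t
    using x ij by (simp_all add: Rn_def)
  have cont: "continuous_on UNIV (\<lambda>p. \<psi> (?y (fst p) (snd p)))" if "continuous_on (Rn m) \<psi>" for \<psi> :: "(nat \<Rightarrow> real) \<Rightarrow> real"
  proof (rule continuous_on_compose2[OF that])
    show "continuous_on UNIV (\<lambda>p. ?y (fst p) (snd p))"
    proof (rule continuous_on_coordinatewise_then_product)
      fix k show "continuous_on UNIV (\<lambda>p. (?y (fst p) (snd p)) k)"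
        by (cases "k = j"; cases "k = i") (auto intro!: continuous_intros)
    qed
  qed (use Rn in auto)
  have "partial_deriv j (partial_deriv i \<phi>) (?y (x i) (x j)) = partial_deriv i (partial_deriv j \<phi>) (?y (x i) (x j))"
  proof (rule mixed_derivatives_eq[where f="\<lambda>s t. \<phi> (?y s t)" and ?f1.0="\<lambda>s t. partial_deriv i \<phi> (?y s t)"
      and ?f2.0="\<lambda>s t. partial_deriv j \<phi> (?y s t)" and ?f12.0="\<lambda>s t. partial_deriv j (partial_deriv i \<phi>) (?y s t)"
      and ?f21.0="\<lambda>s t. partial_deriv i (partial_deriv j \<phi>) (?y s t)"])
    fix s t
    show "((\<lambda>s. \<phi> (?y s t)) has_real_derivative partial_deriv i \<phi> (?y s t)) (at s)"
      unfolding y' by (rule Ck_SucD[OF C' ij(1) Rn(2)])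
    show "((\<lambda>t. \<phi> (?y s t)) has_real_derivative partial_deriv j \<phi> (?y s t)) (at t)"
      by (rule Ck_SucD[OF C' ij(2) Rn(1)])
    show "((\<lambda>t. partial_deriv i \<phi> (?y s t)) has_real_derivative partial_deriv j (partial_deriv i \<phi>) (?y s t)) (at t)"
      by (rule Ck_SucD[OF Ck_partial[OF C' ij(1)] ij(2) Rn(1)])
    show "((\<lambda>s. partial_deriv j \<phi> (?y s t)) has_real_derivative partial_deriv i (partial_deriv j \<phi>) (?y s t)) (at s)"
      unfolding y' by (rule Ck_SucD[OF Ck_partial[OF C' ij(2)] ij(1) Rn(2)])
  qed (intro cont; use C' ij in auto)+
  then show ?thesis by simp
qed simp

section \<open>The KMS condition on sequences\<close>

text \<open>Sequences interleave the coordinates along \<open>e\<^sub>j\<close> (index \<open>2 j\<close>) and along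
  \<open>\<i> e\<^sub>j\<close> (index \<open>2 j + 1\<close>), whereas cylindrical functions of order \<open>n\<close> see the block of
  all \<open>e\<^sub>j\<close> followed by the block of all \<open>\<i> e\<^sub>j\<close>.\<close>

definition pair_index :: "nat \<Rightarrow> nat \<Rightarrow> nat" where
  "pair_index n i = (if i < n then 2 * i else 2 * (i - n) + 1)"

definition block_index :: "nat \<Rightarrow> nat \<Rightarrow> nat" where
  "block_index n k = (if even k then k div 2 else n + k div 2)"

text \<open>The zeros from index \<open>2 * n\<close> on place the result in
  \<open>Rn (2 * n)\<close>, where the functions of \<open>Cc_infty (2 * n)\<close> are
  controlled.\<close>

definition to_blocks :: "nat \<Rightarrow> (nat \<Rightarrow> real) \<Rightarrow> nat \<Rightarrow> real" where
  "to_blocks n x = (\<lambda>i. if i < 2 * n then x (pair_index n i) else 0)"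

definition cylseq :: "nat \<Rightarrow> ((nat \<Rightarrow> real) \<Rightarrow> real) set" where
  "cylseq n = {\<lambda>x. \<phi> (to_blocks n x) | \<phi>. \<phi> \<in> Cc_infty (2 * n)}"

lemma pair_index_less: "i < 2 * n \<Longrightarrow> pair_index n i < 2 * n"
  by (auto simp: pair_index_def)

lemma block_index_less: "k < 2 * n \<Longrightarrow> block_index n k < 2 * n"
  by (auto simp: block_index_def)

lemma pair_block [simp]: "k < 2 * n \<Longrightarrow> pair_index n (block_index n k) = k"
  by (auto simp: pair_index_def block_index_def elim!: evenE oddE)

lemma block_pair [simp]: "i < 2 * n \<Longrightarrow> block_index n (pair_index n i) = i"
  by (auto simp: pair_index_def block_index_def)

lemma to_blocks_block_index: "k < 2 * n \<Longrightarrow> to_blocks n x (block_index n k) = x k"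
  by (simp add: to_blocks_def block_index_less)

lemma to_blocks_in_Rn: "to_blocks n x \<in> Rn (2 * n)"
  by (simp add: to_blocks_def Rn_def)

lemma continuous_on_to_blocks: "continuous_on S (to_blocks n)"
proof (rule continuous_on_coordinatewise_then_product)
  show "continuous_on S (\<lambda>x. to_blocks n x i)" for i
    by (cases "i < 2 * n") (auto simp: to_blocks_def intro: continuous_intros)
qed

lemma to_blocks_upd:
  assumes "k < 2 * n"
  shows "to_blocks n (x(k := t)) = (to_blocks n x)(block_index n k := t)"
proof
  fix i
  show "to_blocks n (x(k := t)) i = ((to_blocks n x)(block_index n k := t)) i"
    using assms block_index_less[OF assms] by (auto simp: to_blocks_def)
qed

lemma to_blocks_upd_ge:
  assumes "2 * n \<le> k"
  shows "to_blocks n (x(k := t)) = to_blocks n x"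
  using assms pair_index_less[of _ n] by (fastforce simp: to_blocks_def)

lemma cylseq_continuous:
  assumes "F \<in> cylseq n"
  shows "continuous_on UNIV F"
proof -
  obtain \<phi> where \<phi>: "\<phi> \<in> Cc_infty (2 * n)" "F = (\<lambda>x. \<phi> (to_blocks n x))"
    using assms by (auto simp: cylseq_def)
  then have "continuous_on (Rn (2 * n)) \<phi>" using Ck_continuous by (auto simp: Cc_infty_def)
  then show ?thesis
    unfolding \<phi>(2) using to_blocks_in_Rn
    by (intro continuous_on_compose2[OF _ continuous_on_to_blocks]) auto
qed

lemma cylseq_bounded:
  assumes "F \<in> cylseq n"
  shows "\<exists>B. \<forall>x. \<bar>F x\<bar> \<le> B"
proof -
  obtain \<phi> where \<phi>: "\<phi> \<in> Cc_infty (2 * n)" "F = (\<lambda>x. \<phi> (to_blocks n x))"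
    using assms by (auto simp: cylseq_def)
  then show ?thesis using Cc_infty_bounded to_blocks_in_Rn by metis
qed

lemma Cc_infty_SucD:
  assumes "\<phi> \<in> Cc_infty m" "i < m" "x \<in> Rn m"
  shows "((\<lambda>t. \<phi> (x(i := t))) has_real_derivative partial_deriv i \<phi> (x(i := t))) (at t)"
  using assms by (intro Ck_SucD[of m 0]) (simp only: Cc_infty_def mem_Collect_eq, blast+)

lemma partial_deriv_blocks:
  assumes "\<phi> \<in> Cc_infty (2 * n)" "k < 2 * n"
  shows "partial_deriv k (\<lambda>x. \<phi> (to_blocks n x)) x = partial_deriv (block_index n k) \<phi> (to_blocks n x)"
proof (rule partial_deriv_eqI)
  show "((\<lambda>t. \<phi> (to_blocks n (x(k := t)))) has_real_derivative
      partial_deriv (block_index n k) \<phi> (to_blocks n x)) (at (x k))"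
    using Cc_infty_SucD[OF assms(1) block_index_less[OF assms(2)] to_blocks_in_Rn, of x "x k"]
    unfolding to_blocks_upd[OF assms(2), symmetric] by (simp del: fun_upd_apply)
qed

lemma partial_deriv_blocks_ge:
  assumes "2 * n \<le> k"
  shows "partial_deriv k (\<lambda>x. \<phi> (to_blocks n x)) x = 0"
  by (rule partial_deriv_eqI) (simp add: to_blocks_upd_ge[OF assms] del: fun_upd_apply)

lemma cylseq_0: "(\<lambda>_. 0) \<in> cylseq n"
proof -
  have "(\<lambda>_. 0) \<in> Cc_infty (2 * n)" by (rule Cc_inftyI[where R=0]) (auto simp: Ck_const)
  then show ?thesis by (force simp: cylseq_def)
qed

lemma cylseq_partial:
  assumes "F \<in> cylseq n"
  shows "partial_deriv k F \<in> cylseq n"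
proof -
  obtain \<phi> where \<phi>: "\<phi> \<in> Cc_infty (2 * n)" "F = (\<lambda>x. \<phi> (to_blocks n x))"
    using assms by (auto simp: cylseq_def)
  show ?thesis
  proof (cases "k < 2 * n")
    case True
    then have "partial_deriv k F = (\<lambda>x. partial_deriv (block_index n k) \<phi> (to_blocks n x))"
      using partial_deriv_blocks[OF \<phi>(1)] \<phi>(2) by auto
    then show ?thesis
      using Cc_infty_partial[OF \<phi>(1) block_index_less[OF True]] by (auto simp: cylseq_def)
  next
    case False
    then have "partial_deriv k F = (\<lambda>_. 0)" using partial_deriv_blocks_ge \<phi>(2) by auto
    then show ?thesis by (simp add: cylseq_0)
  qed
qed

lemma cylseq_partial_ge: "F \<in> cylseq n \<Longrightarrow> 2 * n \<le> k \<Longrightarrow> partial_deriv k F x = 0"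
  by (auto simp: cylseq_def partial_deriv_blocks_ge)

lemma cylseq_DERIV:
  assumes "F \<in> cylseq n"
  shows "((\<lambda>t. F (x(k := t))) has_real_derivative partial_deriv k F (x(k := t))) (at t)"
proof -
  obtain \<phi> where \<phi>: "\<phi> \<in> Cc_infty (2 * n)" "F = (\<lambda>x. \<phi> (to_blocks n x))"
    using assms by (auto simp: cylseq_def)
  show ?thesis
  proof (cases "k < 2 * n")
    case True
    show ?thesis
      unfolding \<phi>(2) partial_deriv_blocks[OF \<phi>(1) True] to_blocks_upd[OF True]
      by (rule Cc_infty_SucD[OF \<phi>(1) block_index_less[OF True] to_blocks_in_Rn])
  next
    case False
    then show ?thesis
      unfolding \<phi>(2) by (simp add: partial_deriv_blocks_ge to_blocks_upd_ge del: fun_upd_apply)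
  qed
qed

lemma cylseq_partial_commute:
  assumes "F \<in> cylseq n"
  shows "partial_deriv i (partial_deriv k F) x = partial_deriv k (partial_deriv i F) x"
proof -
  obtain \<phi> where \<phi>: "\<phi> \<in> Cc_infty (2 * n)" "F = (\<lambda>x. \<phi> (to_blocks n x))"
    using assms by (auto simp: cylseq_def)
  show ?thesis
  proof (cases "i < 2 * n \<and> k < 2 * n")
    case True
    have 1: "partial_deriv k F = (\<lambda>x. partial_deriv (block_index n k) \<phi> (to_blocks n x))" if "k < 2 * n" for k
      using partial_deriv_blocks[OF \<phi>(1) that] \<phi>(2) by auto
    have "partial_deriv i (partial_deriv k F) x = partial_deriv (block_index n i) (partial_deriv (block_index n k) \<phi>) (to_blocks n x)"
      if "i < 2 * n" "k < 2 * n" for i k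
      unfolding 1[OF that(2)]
      using partial_deriv_blocks[OF Cc_infty_partial[OF \<phi>(1) block_index_less[OF that(2)]] that(1)] .
    moreover have "Ck (2 * n) 2 \<phi>" using \<phi>(1) by (simp add: Cc_infty_def)
    ultimately show ?thesis
      using True by (simp add: partial_deriv_commute block_index_less to_blocks_in_Rn)
  next
    case False
    have "partial_deriv k (partial_deriv i F) x = 0" if "2 * n \<le> k \<or> 2 * n \<le> i" for k i
    proof (cases "2 * n \<le> k")
      case True
      then show ?thesis using cylseq_partial_ge[OF cylseq_partial[OF assms]] by blast
    next
      case False
      then have "partial_deriv i F = (\<lambda>_. 0)" using that cylseq_partial_ge[OF assms] by auto
      then show ?thesis by (simp add: partial_deriv_def)
    qed
    then show ?thesis using False by (metis not_le)
  qed
qed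

text \<open>A single radius serves F and all its first derivatives, so that one cutoff can be
  constant on a neighbourhood of all their supports in the first \<open>2 * n\<close>
  variables.\<close>

lemma cylseq_support:
  assumes "F \<in> cylseq n"
  obtains R where "R > 0" "\<And>x r. F x \<noteq> 0 \<Longrightarrow> r < 2 * n \<Longrightarrow> \<bar>x r\<bar> \<le> R"
    "\<And>x r k. partial_deriv k F x \<noteq> 0 \<Longrightarrow> r < 2 * n \<Longrightarrow> \<bar>x r\<bar> \<le> R"
proof -
  obtain \<phi> where \<phi>: "\<phi> \<in> Cc_infty (2 * n)" "F = (\<lambda>x. \<phi> (to_blocks n x))"
    using assms by (auto simp: cylseq_def)
  obtain R where R: "R > 0" "\<And>x i. x \<in> Rn (2 * n) \<Longrightarrow> \<phi> x \<noteq> 0 \<Longrightarrow> \<bar>x i\<bar> \<le> R"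
    using Cc_infty_support[OF \<phi>(1)] by blast
  show thesis
  proof
    fix x r assume r: "r < 2 * n"
    show "\<bar>x r\<bar> \<le> R" if "F x \<noteq> 0"
      using R(2)[OF to_blocks_in_Rn, of x "block_index n r"] that \<phi>(2) to_blocks_block_index[OF r] by simp
    fix k assume k: "partial_deriv k F x \<noteq> 0"
    then have "k < 2 * n" using cylseq_partial_ge[OF assms] not_le by blast
    then show "\<bar>x r\<bar> \<le> R"
      using partial_deriv_support[of "2 * n" \<phi> R "block_index n k" "to_blocks n x" "block_index n r"] R(2)
        k \<phi>(2) partial_deriv_blocks[OF \<phi>(1), of k x] to_blocks_block_index[OF r]
        block_index_less to_blocks_in_Rn by simp
  qed (rule R)
qed

lemma cylseqI:
  assumes "\<And>k. Ck (2 * n) k \<phi>"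
    and "\<And>y i. i < 2 * n \<Longrightarrow> \<bar>y i\<bar> > R \<Longrightarrow> \<phi> y = 0"
  shows "(\<lambda>x. \<phi> (to_blocks n x)) \<in> cylseq n"
proof -
  have "\<phi> \<in> Cc_infty (2 * n)"
    by (rule Cc_inftyI[where R=R]) (use assms not_le in blast)+
  then show ?thesis by (auto simp: cylseq_def)
qed

text \<open>F and G may have different orders. The sums stop at the order of F because its
  derivatives in later coordinates vanish, and with them every later term on both sides.\<close>

definition kms_seq :: "(nat \<Rightarrow> real) \<Rightarrow> real \<Rightarrow> (nat \<Rightarrow> real) measure \<Rightarrow> bool" where
  "kms_seq l \<beta> P \<longleftrightarrow> (\<forall>n\<ge>1. \<forall>m\<ge>1. \<forall>F\<in>cylseq n. \<forall>G\<in>cylseq m.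
     (\<integral>x. (\<Sum>j<n. partial_deriv (2 * j) F x * partial_deriv (2 * j + 1) G x
                - partial_deriv (2 * j) G x * partial_deriv (2 * j + 1) F x) \<partial>P) =
     \<beta> * (\<integral>x. (\<Sum>j<n. l j * (partial_deriv (2 * j) F x * x (2 * j + 1)
                - partial_deriv (2 * j + 1) F x * x (2 * j))) * G x \<partial>P))"

section \<open>The Gaussian product law satisfies the KMS identity\<close>

definition bounded_cont :: "((nat \<Rightarrow> real) \<Rightarrow> real) \<Rightarrow> bool" where
  "bounded_cont F \<longleftrightarrow> continuous_on UNIV F \<and> (\<exists>B. \<forall>x. \<bar>F x\<bar> \<le> B)"

lemma bounded_cont_cylseq: "F \<in> cylseq n \<Longrightarrow> bounded_cont F"
  by (simp add: bounded_cont_def cylseq_continuous cylseq_bounded)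

lemma bounded_cont_mult:
  assumes "bounded_cont F" "bounded_cont G"
  shows "bounded_cont (\<lambda>x. F x * G x)"
proof -
  obtain B C where "\<And>x. \<bar>F x\<bar> \<le> B" "\<And>x. \<bar>G x\<bar> \<le> C"
    using assms by (auto simp: bounded_cont_def)
  then have "\<bar>F x * G x\<bar> \<le> B * C" for x
    unfolding abs_mult by (intro mult_mono) (auto intro: order_trans[OF abs_ge_zero])
  then show ?thesis using assms by (auto simp: bounded_cont_def intro: continuous_on_mult)
qed

lemma bounded_cont_add:
  assumes "bounded_cont F" "bounded_cont G"
  shows "bounded_cont (\<lambda>x. F x + G x)"
proof -
  obtain B C where "\<And>x. \<bar>F x\<bar> \<le> B" "\<And>x. \<bar>G x\<bar> \<le> C"
    using assms by (auto simp: bounded_cont_def)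
  then have "\<bar>F x + G x\<bar> \<le> B + C" for x
    by (meson abs_triangle_ineq add_mono order_trans)
  then show ?thesis using assms by (auto simp: bounded_cont_def intro: continuous_on_add)
qed

lemma bounded_cont_measurable: "bounded_cont F \<Longrightarrow> F \<in> borel_measurable borel"
  by (simp add: bounded_cont_def borel_measurable_continuous_onI)

lemma bounded_cont_integrable:
  assumes "prob_space P" "sets P = sets borel" "bounded_cont F"
  shows "integrable P F"
proof -
  obtain B where B: "\<And>x. \<bar>F x\<bar> \<le> B" using assms by (auto simp: bounded_cont_def)
  show ?thesis
    by (rule bounded_integrable[where B=B])
      (use assms B bounded_cont_measurable measurable_cong_sets[OF assms(2) refl] in auto)
qed

lemma bounded_cont_coord_integrable:
  assumes "\<And>i. k i > 0" "bounded_cont F"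
  shows "integrable (gauss_seq k) (\<lambda>x. x i * F x)"
proof -
  obtain B where B: "\<And>x. \<bar>F x\<bar> \<le> B" using assms by (auto simp: bounded_cont_def)
  show ?thesis
    by (rule integrable_mult_bounded[where B=B])
      (use assms B bounded_cont_measurable integrable_gauss_seq_coord in auto)
qed

text \<open>Integration by parts combined with the product rule. It is applied with a first
  derivative of a test function in the place of F, which produces the mixed second
  derivatives.\<close>

lemma stein_gauss_seq_mult:
  assumes k: "\<And>i. k i > 0" and F: "F \<in> cylseq n" and G: "G \<in> cylseq m"
  shows "(\<integral>x. partial_deriv i G x * F x \<partial>gauss_seq k) + (\<integral>x. G x * partial_deriv i F x \<partial>gauss_seq k)
    = k i * (\<integral>x. x i * (G x * F x) \<partial>gauss_seq k)"
proof -
  note bc = bounded_cont_cylseq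
  have 1: "bounded_cont (\<lambda>x. G x * F x)" by (intro bounded_cont_mult bc[OF F] bc[OF G])
  have 2: "bounded_cont (\<lambda>x. partial_deriv i G x * F x)"
    by (intro bounded_cont_mult bc[OF F] bc[OF cylseq_partial[OF G]])
  have 3: "bounded_cont (\<lambda>x. G x * partial_deriv i F x)"
    by (intro bounded_cont_mult bc[OF G] bc[OF cylseq_partial[OF F]])
  obtain B where B: "\<And>x. \<bar>G x * F x\<bar> \<le> B" using 1 by (auto simp: bounded_cont_def)
  obtain C where C: "\<And>x. \<bar>partial_deriv i G x * F x + G x * partial_deriv i F x\<bar> \<le> C"
    using bounded_cont_add[OF 2 3] by (auto simp: bounded_cont_def)
  have "(\<integral>x. partial_deriv i G x * F x + G x * partial_deriv i F x \<partial>gauss_seq k)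
    = k i * (\<integral>x. x i * (G x * F x) \<partial>gauss_seq k)"
  proof (rule stein_gauss_seq[OF k, where B="max B C"])
    show "((\<lambda>t. G (x(i := t)) * F (x(i := t))) has_real_derivative
        partial_deriv i G (x(i := t)) * F (x(i := t)) + G (x(i := t)) * partial_deriv i F (x(i := t))) (at t)" for x t
      using DERIV_mult[OF cylseq_DERIV[OF G] cylseq_DERIV[OF F]] by (simp add: mult.commute)
  qed (use 1 bounded_cont_add[OF 2 3] B C in \<open>auto simp: bounded_cont_def max.coboundedI1 max.coboundedI2\<close>)
  moreover have "integrable (gauss_seq k) (\<lambda>x. partial_deriv i G x * F x)" "integrable (gauss_seq k) (\<lambda>x. G x * partial_deriv i F x)"
    by (intro bounded_cont_integrable prob_space_gauss_seq k 2 3; simp)+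
  ultimately show ?thesis by simp
qed

lemma kms_seq_gauss_seq:
  assumes l: "\<And>j. l j > 0" and \<beta>: "\<beta> > 0"
  shows "kms_seq l \<beta> (gauss_seq (\<lambda>i. \<beta> * l (i div 2)))"
  unfolding kms_seq_def
proof (intro allI impI ballI)
  let ?k = "\<lambda>i. \<beta> * l (i div 2)"
  let ?M = "gauss_seq ?k"
  fix n m F G assume F: "F \<in> cylseq n" and G: "G \<in> cylseq m"
  have k: "?k i > 0" for i using l \<beta> by simp
  note bc = bounded_cont_cylseq
  note pF = cylseq_partial[OF F] and pG = cylseq_partial[OF G]
  have int: "integrable ?M H" if "bounded_cont H" for H
    by (rule bounded_cont_integrable) (use that k prob_space_gauss_seq in auto)
  have int1: "integrable ?M (\<lambda>x. partial_deriv i F x * partial_deriv k G x)"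
    "integrable ?M (\<lambda>x. partial_deriv k G x * partial_deriv i F x)" for i k
    by (intro int bounded_cont_mult bc[OF pF] bc[OF pG])+
  have int2: "integrable ?M (\<lambda>x. x i * (G x * partial_deriv k F x))" for i k
    by (intro bounded_cont_coord_integrable k bounded_cont_mult bc[OF pF] bc[OF G])
  have stein: "(\<integral>x. partial_deriv i G x * partial_deriv r F x \<partial>?M) + (\<integral>x. G x * partial_deriv i (partial_deriv r F) x \<partial>?M)
    = ?k i * (\<integral>x. x i * (G x * partial_deriv r F x) \<partial>?M)" for i r
    by (rule stein_gauss_seq_mult[OF _ pF G]) (rule k)
  \<comment> \<open>Integrating by parts in direction \<open>2 * j + 1\<close> against the
    derivative of F in direction \<open>2 * j\<close>, and conversely, gives the same second-order
    term twice with opposite signs. The factors agree because both coordinates of a pair have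
    inverse variance \<beta> \<open>l j\<close>.\<close>
  have main: "(\<integral>x. partial_deriv (2 * j) F x * partial_deriv (2 * j + 1) G x \<partial>?M)
      - (\<integral>x. partial_deriv (2 * j) G x * partial_deriv (2 * j + 1) F x \<partial>?M)
    = \<beta> * l j * (\<integral>x. x (2 * j + 1) * (G x * partial_deriv (2 * j) F x) \<partial>?M)
      - \<beta> * l j * (\<integral>x. x (2 * j) * (G x * partial_deriv (2 * j + 1) F x) \<partial>?M)" for j
    using stein[of "2 * j + 1" "2 * j"] stein[of "2 * j" "2 * j + 1"]
      cylseq_partial_commute[OF F, of "2 * j" "2 * j + 1"]
    by (simp add: mult.commute[of "partial_deriv (2 * j) F _"])
  have "(\<integral>x. (\<Sum>j<n. partial_deriv (2 * j) F x * partial_deriv (2 * j + 1) G x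
                - partial_deriv (2 * j) G x * partial_deriv (2 * j + 1) F x) \<partial>?M) =
     (\<Sum>j<n. (\<integral>x. partial_deriv (2 * j) F x * partial_deriv (2 * j + 1) G x \<partial>?M)
      - (\<integral>x. partial_deriv (2 * j) G x * partial_deriv (2 * j + 1) F x \<partial>?M))"
    by (subst Bochner_Integration.integral_sum) (simp_all only: Bochner_Integration.integral_diff Bochner_Integration.integrable_diff int1)
  also have "\<dots> = (\<Sum>j<n. \<beta> * l j * (\<integral>x. x (2 * j + 1) * (G x * partial_deriv (2 * j) F x) \<partial>?M)
      - \<beta> * l j * (\<integral>x. x (2 * j) * (G x * partial_deriv (2 * j + 1) F x) \<partial>?M))"
    by (rule sum.cong[OF refl main])
  also have "\<dots> = \<beta> * (\<Sum>j<n. l j * (\<integral>x. x (2 * j + 1) * (G x * partial_deriv (2 * j) F x) \<partial>?M)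
      - l j * (\<integral>x. x (2 * j) * (G x * partial_deriv (2 * j + 1) F x) \<partial>?M))"
    by (simp add: sum_distrib_left right_diff_distrib mult.assoc)
  also have "(\<Sum>j<n. l j * (\<integral>x. x (2 * j + 1) * (G x * partial_deriv (2 * j) F x) \<partial>?M)
      - l j * (\<integral>x. x (2 * j) * (G x * partial_deriv (2 * j + 1) F x) \<partial>?M)) =
     (\<integral>x. (\<Sum>j<n. l j * (x (2 * j + 1) * (G x * partial_deriv (2 * j) F x))
      - l j * (x (2 * j) * (G x * partial_deriv (2 * j + 1) F x))) \<partial>?M)"
    by (subst Bochner_Integration.integral_sum) (simp_all only: Bochner_Integration.integral_diff Bochner_Integration.integrable_diff
        integral_mult_right_zero integrable_mult_right int2)
  also have "\<dots> = (\<integral>x. (\<Sum>j<n. l j * (partial_deriv (2 * j) F x * x (2 * j + 1)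
                - partial_deriv (2 * j + 1) F x * x (2 * j))) * G x \<partial>?M)"
    by (simp only: sum_distrib_right) (simp add: algebra_simps)
  finally show "(\<integral>x. (\<Sum>j<n. partial_deriv (2 * j) F x * partial_deriv (2 * j + 1) G x
                - partial_deriv (2 * j) G x * partial_deriv (2 * j + 1) F x) \<partial>?M) =
     \<beta> * (\<integral>x. (\<Sum>j<n. l j * (partial_deriv (2 * j) F x * x (2 * j + 1)
                - partial_deriv (2 * j + 1) F x * x (2 * j))) * G x \<partial>?M)" .
qed

text \<open>Testing the KMS identity against \<open>F = x\<^sub>r\<close>, cut off outside the support of \<open>G\<close>, turns it
  into the integration by parts formula in the conjugate variable.\<close>

lemma kms_seq_stein:
  assumes kms: "kms_seq l \<beta> P" and G: "G \<in> cylseq n" and n: "n \<ge> 1" and i: "i < 2 * n"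
  shows "(\<integral>x. partial_deriv i G x \<partial>P) = \<beta> * l (i div 2) * (\<integral>x. x i * G x \<partial>P)"
proof -
  obtain \<eta> :: "real \<Rightarrow> real" where \<eta>: "\<And>k. diffk k \<eta>" "\<And>x. \<bar>x\<bar> \<le> 1 \<Longrightarrow> \<eta> x = 1"
    "\<And>x. \<bar>x\<bar> \<ge> 2 \<Longrightarrow> \<eta> x = 0" using smooth_plateau by metis
  obtain R where R: "R > 0" "\<And>x r. G x \<noteq> 0 \<Longrightarrow> r < 2 * n \<Longrightarrow> \<bar>x r\<bar> \<le> R"
    "\<And>x r k. partial_deriv k G x \<noteq> 0 \<Longrightarrow> r < 2 * n \<Longrightarrow> \<bar>x r\<bar> \<le> R"
    using cylseq_support[OF G] by metis
  \<comment> \<open>\<open>r\<close> is the coordinate conjugate to i, and \<sigma> compensates the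
    sign with which the derivative of G in direction i enters the bracket: F is to be - x(2j+1) for
    i = 2j, and x(2j) for i = 2j+1.\<close>
  define r where "r = (if even i then i + 1 else i - 1)"
  define \<sigma> :: real where "\<sigma> = (if even i then -1 else 1)"
  have r: "r < 2 * n" "r div 2 = i div 2" "r \<noteq> i" using i by (auto simp: r_def elim!: evenE oddE)
  \<comment> \<open>The cutoff equals 1 up to radius R + 1 rather than R, so F is linear on a
    neighbourhood of the box that contains the supports of G and its derivatives.\<close>
  define \<phi> where "\<phi> y = \<sigma> * (y (block_index n r) * (\<Prod>q<2*n. \<eta> (1 / (R + 1) * y q + 0)))" for y :: "nat \<Rightarrow> real"
  define F where "F x = \<phi> (to_blocks n x)" for x
  have F: "F \<in> cylseq n"
    unfolding F_def
  proof (rule cylseqI[where R="2 * (R + 1)"])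
    show "Ck (2 * n) k \<phi>" for k
      unfolding \<phi>_def
      by (intro Ck_mult Ck_const Ck_prod Ck_coord[OF diffk_ident] Ck_coord[OF diffk_affine] \<eta> block_index_less r) simp
    fix y :: "nat \<Rightarrow> real" and q assume q: "q < 2 * n" "\<bar>y q\<bar> > 2 * (R + 1)"
    then have "\<bar>1 / (R + 1) * y q + 0\<bar> \<ge> 2" using R(1) by (simp add: abs_mult abs_divide field_simps)
    then have "\<eta> (1 / (R + 1) * y q + 0) = 0" by (rule \<eta>(3))
    then show "\<phi> y = 0" unfolding \<phi>_def using q(1) by (auto intro!: prod_zero)
  qed
  have eta1: "\<eta> (1 / (R + 1) * z + 0) = 1" if "\<bar>z\<bar> < R + 1" for z
    using that R(1) by (intro \<eta>(2)) (simp add: abs_mult abs_divide field_simps)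
  have Fval: "F x = \<sigma> * x r" if "\<And>k. k < 2 * n \<Longrightarrow> \<bar>x k\<bar> < R + 1" for x
  proof -
    have "(\<Prod>q<2*n. \<eta> (1 / (R + 1) * to_blocks n x q + 0)) = 1"
      using that pair_index_less by (intro prod.neutral ballI eta1) (auto simp: to_blocks_def)
    then show ?thesis by (simp only: F_def \<phi>_def to_blocks_block_index[OF r(1)] mult_1_right)
  qed
  have dF: "partial_deriv k F x = (if k = r then \<sigma> else 0)" if x: "\<And>k. k < 2 * n \<Longrightarrow> \<bar>x k\<bar> \<le> R" for x k
  proof (cases "k < 2 * n")
    case True
    have "((\<lambda>t. \<sigma> * (x(k := t)) r) has_real_derivative (if k = r then \<sigma> else 0)) (at (x k))"
      by (cases "k = r") (auto intro!: derivative_eq_intros)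
    then have "((\<lambda>t. F (x(k := t))) has_real_derivative (if k = r then \<sigma> else 0)) (at (x k))"
    proof (rule has_field_derivative_transform_within_open[where S="{-(R+1)<..<R+1}"])
      show "x k \<in> {-(R+1)<..<R+1}" using x[OF True] by auto
      show "\<sigma> * (x(k := t)) r = F (x(k := t))" if "t \<in> {-(R+1)<..<R+1}" for t
        by (rule Fval[symmetric]) (use x that in \<open>force simp: less_eq_real_def\<close>)
    qed simp
    then show ?thesis by (rule partial_deriv_eqI)
  next
    case False
    then show ?thesis using cylseq_partial_ge[OF F, of k x] r(1) by auto
  qed
  define j where "j = i div 2"
  have j: "j < n" using i by (auto simp: j_def)
  have ir: "(i = 2 * j + 1 \<and> r = 2 * j \<and> \<sigma> = 1) \<or> (i = 2 * j \<and> r = 2 * j + 1 \<and> \<sigma> = -1)"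
    by (auto simp: j_def r_def \<sigma>_def elim!: evenE oddE)
  have L: "(\<Sum>j<n. partial_deriv (2 * j) F x * partial_deriv (2 * j + 1) G x
      - partial_deriv (2 * j) G x * partial_deriv (2 * j + 1) F x) = partial_deriv i G x" for x
  proof (cases "\<forall>k<2*n. \<bar>x k\<bar> \<le> R")
    case True
    have "partial_deriv (2 * q) F x * partial_deriv (2 * q + 1) G x
      - partial_deriv (2 * q) G x * partial_deriv (2 * q + 1) F x = (if q = j then partial_deriv i G x else 0)" for q
    proof -
      have "2 * q \<noteq> Suc (2 * j)" "Suc (2 * q) \<noteq> 2 * j" by presburger+
      then show ?thesis
        using dF[of x "2 * q"] dF[of x "2 * q + 1"] True ir by auto
    qed
    then show ?thesis using j by simp
  next
    case False
    then have "partial_deriv k G x = 0" for k using R(3)[of k x] by blast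
    then show ?thesis by simp
  qed
  have Rr: "(\<Sum>j<n. l j * (partial_deriv (2 * j) F x * x (2 * j + 1)
                - partial_deriv (2 * j + 1) F x * x (2 * j))) * G x = l j * (x i * G x)" for x
  proof (cases "\<forall>k<2*n. \<bar>x k\<bar> \<le> R")
    case True
    have "l q * (partial_deriv (2 * q) F x * x (2 * q + 1)
                - partial_deriv (2 * q + 1) F x * x (2 * q)) = (if q = j then l j * x i else 0)" for q
    proof -
      have "2 * q \<noteq> Suc (2 * j)" "Suc (2 * q) \<noteq> 2 * j" by presburger+
      then show ?thesis
        using dF[of x "2 * q"] dF[of x "2 * q + 1"] True ir by auto
    qed
    then show ?thesis using j by simp
  next
    case False
    then have "G x = 0" using R(2)[of x] by blast
    then show ?thesis by simp
  qed
  have "(\<integral>x. partial_deriv i G x \<partial>P) = \<beta> * (\<integral>x. l j * (x i * G x) \<partial>P)"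
    using kms n F G unfolding kms_seq_def L[symmetric] Rr[symmetric] by blast
  then show ?thesis by (simp add: j_def)
qed

text \<open>This makes any smooth \<psi> admissible after multiplication by a product of
  one-variable cutoffs at scale a. In block coordinates the factors are merely permuted, and one
  vanishing factor kills the product.\<close>

lemma cutoff_in_cylseq:
  fixes \<eta> :: "real \<Rightarrow> real"
  assumes \<eta>: "\<And>k. diffk k \<eta>" "\<And>x. \<bar>x\<bar> \<ge> 2 \<Longrightarrow> \<eta> x = 0" and a: "a > 0"
    and \<psi>: "\<And>k. Ck (2 * n) k \<psi>"
  shows "(\<lambda>x. \<psi> (to_blocks n x) * (\<Prod>r<2*n. \<eta> (x r / a))) \<in> cylseq n"
proof -
  have "(\<lambda>x. (\<lambda>y. \<psi> y * (\<Prod>r<2*n. \<eta> (1 / a * y (block_index n r) + 0))) (to_blocks n x)) \<in> cylseq n"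
  proof (rule cylseqI[where R="2 * a"])
    show "Ck (2 * n) k (\<lambda>y. \<psi> y * (\<Prod>r<2*n. \<eta> (1 / a * y (block_index n r) + 0)))" for k
      by (intro Ck_mult \<psi> Ck_prod Ck_coord[OF diffk_affine] \<eta> block_index_less) simp
    fix y :: "nat \<Rightarrow> real" and q assume q: "q < 2 * n" "\<bar>y q\<bar> > 2 * a"
    then have "\<bar>1 / a * y (block_index n (pair_index n q)) + 0\<bar> \<ge> 2"
      using a by (simp add: abs_divide field_simps)
    then have "\<eta> (1 / a * y (block_index n (pair_index n q)) + 0) = 0" by (rule \<eta>)
    then show "\<psi> y * (\<Prod>r<2*n. \<eta> (1 / a * y (block_index n r) + 0)) = 0"
      using pair_index_less[OF q(1)] by (auto intro!: prod_zero)
  qed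
  moreover have "(\<Prod>r<2*n. \<eta> (1 / a * to_blocks n x (block_index n r) + 0)) = (\<Prod>r<2*n. \<eta> (x r / a))" for x
    by (intro prod.cong) (auto simp: to_blocks_block_index)
  ultimately show ?thesis by simp
qed

text \<open>The order is forced: removing the cutoff from the identity for cosines needs
  \<open>x i\<close> integrable, so the second moments come first, from a bound that is uniform in
  the scale.\<close>

theorem kms_seq_imp_gauss:
  assumes P: "prob_space P" "sets P = sets borel"
    and l: "\<And>j. l j > 0" and \<beta>: "\<beta> > 0" and kms: "kms_seq l \<beta> P"
  shows "P = gauss_seq (\<lambda>i. \<beta> * l (i div 2))"
proof -
  note [measurable_cong] = P(2)
  interpret P: prob_space P by fact
  obtain \<eta> :: "real \<Rightarrow> real" where \<eta>: "\<And>k. diffk k \<eta>" "\<And>x. 0 \<le> \<eta> x" "\<And>x. \<eta> x \<le> 1"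
    "\<And>x. \<bar>x\<bar> \<le> 1 \<Longrightarrow> \<eta> x = 1" "\<And>x. \<bar>x\<bar> \<ge> 2 \<Longrightarrow> \<eta> x = 0" using smooth_plateau by metis
  obtain \<eta>' where \<eta>': "\<And>x. (\<eta> has_real_derivative \<eta>' x) (at x)" "continuous_on UNIV \<eta>'"
    using \<eta>(1)[of 1] by auto
  have \<eta>'0: "\<eta>' x = 0" if "\<bar>x\<bar> > 2" for x
  proof -
    have "((\<lambda>_. 0) has_real_derivative 0) (at x)" by simp
    then have "(\<eta> has_real_derivative 0) (at x)"
    proof (rule has_field_derivative_transform_within_open[where S="{x. \<bar>x\<bar> > 2}"])
      show "open {x::real. 2 < \<bar>x\<bar>}" by (intro open_Collect_less continuous_intros)
    qed (use \<eta>(5) that in auto)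
    then show ?thesis using \<eta>'(1) DERIV_unique by blast
  qed
  obtain C where C: "\<And>x. \<bar>\<eta>' x\<bar> \<le> C" "C \<ge> 0"
  proof -
    have "compact (\<eta>' ` {-2..2})"
      by (intro compact_continuous_image continuous_on_subset[OF \<eta>'(2)]) auto
    then have "\<exists>C. \<forall>x\<in>{-2..2}. \<bar>\<eta>' x\<bar> \<le> C"
      by (auto dest!: compact_imp_bounded simp: bounded_iff)
    then obtain C where C: "\<And>x. x \<in> {-2..2} \<Longrightarrow> \<bar>\<eta>' x\<bar> \<le> C"
      by blast
    have C0: "0 \<le> C" using C[of 0] by auto
    have "\<bar>\<eta>' x\<bar> \<le> C" for x
    proof (cases "\<bar>x\<bar> > 2")
      case False
      then have "x \<in> {-2..2}" by (auto simp: abs_le_iff)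
      then show ?thesis by (rule C)
    qed (simp add: \<eta>'0 C0)
    then show thesis using that C0 by blast
  qed
  \<comment> \<open>\<eta>' vanishes outside [-2, 2]. The bound is invariant under scaling: used at
    \<open>x i / a\<close>, it does not depend on a.\<close>
  have \<eta>'x: "\<bar>x * \<eta>' x\<bar> \<le> 2 * C" for x
    using \<eta>'0[of x] C mult_mono[of "\<bar>x\<bar>" 2 "\<bar>\<eta>' x\<bar>" C] by (cases "\<bar>x\<bar> > 2") (auto simp: abs_mult)
  have [measurable]: "\<eta> \<in> borel_measurable borel" "\<eta>' \<in> borel_measurable borel"
    using diffk_continuous[OF \<eta>(1)] \<eta>'(2) by (auto intro: borel_measurable_continuous_onI)
  let ?k = "\<lambda>i. \<beta> * l (i div 2)"
  have k: "?k i > 0" for i using l \<beta> by simp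
  \<comment> \<open>T is the full cutoff at scale a; Q lacks the factor in coordinate i, and so
    remains as a constant when T is differentiated in that direction.\<close>
  define T where "T n a x = (\<Prod>r<2*n. \<eta> (x r / a))" for n :: nat and a :: real and x :: "nat \<Rightarrow> real"
  define Q where "Q n i a x = (\<Prod>r\<in>{..<2*n}-{i}. \<eta> (x r / a))" for n i :: nat and a :: real and x :: "nat \<Rightarrow> real"
  have T01: "0 \<le> T n a x" "T n a x \<le> 1" and Q01: "0 \<le> Q n i a x" "Q n i a x \<le> 1" for n i a x
    unfolding T_def Q_def using \<eta> by (auto intro!: prod_nonneg prod_le_1)
  have [measurable]: "T n a \<in> borel_measurable borel" "Q n i a \<in> borel_measurable borel" for n i a
    unfolding T_def Q_def by measurable
  have TQ: "T n a (x(i := t)) = \<eta> (t / a) * Q n i a x" if "i < 2 * n" for n i a x t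
    unfolding T_def Q_def using that by (subst prod.remove[of _ i]) (auto intro!: prod.cong)
  have T_lim: "\<forall>\<^sub>F N in sequentially. T n (real (Suc N)) x = 1" for n x
  proof -
    obtain B where B: "\<And>r. r < 2 * n \<Longrightarrow> \<bar>x r\<bar> \<le> real B"
    proof -
      obtain B where "(\<Sum>r<2*n. \<bar>x r\<bar>) \<le> real B" using real_arch_simple by blast
      moreover have "\<bar>x r\<bar> \<le> (\<Sum>r<2*n. \<bar>x r\<bar>)" if "r < 2 * n" for r
        using that by (intro member_le_sum) auto
      ultimately show thesis using that order_trans by blast
    qed
    have "T n (real (Suc N)) x = 1" if "N \<ge> B" for N
      unfolding T_def
    proof (intro prod.neutral ballI \<eta>(4))
      fix r assume "r \<in> {..<2*n}"
      then have "\<bar>x r\<bar> \<le> real (Suc N)" using B[of r] that by force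
      then show "\<bar>x r / real (Suc N)\<bar> \<le> 1" by (simp add: abs_divide)
    qed
    then show ?thesis by (auto simp: eventually_sequentially)
  qed
  have T_tendsto: "(\<lambda>N. T n (real (Suc N)) x) \<longlonglongrightarrow> 1" for n x
    using T_lim by (rule tendsto_eventually)
  have DT: "((\<lambda>t. \<psi> (x(i := t)) * T n a (x(i := t))) has_real_derivative
      d * T n a x + \<psi> x * (\<eta>' (x i / a) / a * Q n i a x)) (at (x i))"
    if d: "((\<lambda>t. \<psi> (x(i := t))) has_real_derivative d) (at (x i))" and "i < 2 * n" for \<psi> d x i n a
  proof -
    have T1: "T n a x = \<eta> (x i / a) * Q n i a x" using TQ[OF that(2), of a x "x i"] by simp
    have e: "((\<lambda>t. \<eta> (t / a) * Q n i a x) has_real_derivative \<eta>' (x i / a) * (1 / a) * Q n i a x) (at (x i))"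
      by (intro DERIV_cmult_right DERIV_chain2[OF \<eta>'(1)] DERIV_cdivide DERIV_ident)
    show ?thesis
      unfolding TQ[OF that(2)] using DERIV_mult[OF d e] T1 by (simp add: field_simps)
  qed

  have moment: "integrable P (\<lambda>x. (x i)\<^sup>2)" if i: "i < 2 * n" for i n
  proof -
    have n: "n \<ge> 1" using i by simp
    \<comment> \<open>The derivative of \<open>x i * T n a x\<close> in direction i is at most 1
      from the coordinate plus 2 C from the cutoff; division by the factor of the KMS identity
      bounds the truncated second moment.\<close>
    define K where "K = (1 + 2 * C) / ?k i"
    have bound: "(\<integral>x. (x i)\<^sup>2 * T n a x \<partial>P) \<le> K" and int: "integrable P (\<lambda>x. (x i)\<^sup>2 * T n a x)" if a: "a > 0" for a
    proof -
      define G where "G x = x i * T n a x" for x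
      have G: "G \<in> cylseq n"
        using cutoff_in_cylseq[OF \<eta>(1,5) a Ck_coord[OF diffk_ident block_index_less[OF i]]]
        by (simp add: to_blocks_block_index[OF i] G_def[abs_def] T_def)
      have pd: "partial_deriv i G x = T n a x + (x i / a) * \<eta>' (x i / a) * Q n i a x" for x
        using DT[of "\<lambda>x. x i" x i 1 n a] i unfolding G_def by (intro partial_deriv_eqI) (simp add: mult.assoc)
      have "\<bar>partial_deriv i G x\<bar> \<le> 1 + 2 * C" for x
      proof -
        have "\<bar>(x i / a) * \<eta>' (x i / a) * Q n i a x\<bar> \<le> (2 * C) * 1"
          unfolding abs_mult[of "(x i / a) * \<eta>' (x i / a)"] using \<eta>'x[of "x i / a"] Q01[of n i a x] C(2)
          by (intro mult_mono) auto
        then show ?thesis unfolding pd using T01[of n a x] by linarith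
      qed
      then have "partial_deriv i G x \<le> 1 + 2 * C" for x by (meson abs_le_D1)
      then have "(\<integral>x. partial_deriv i G x \<partial>P) \<le> (\<integral>x. 1 + 2 * C \<partial>P)"
        using bounded_cont_integrable[OF P bounded_cont_cylseq[OF cylseq_partial[OF G]]]
        by (intro integral_mono) auto
      then have "?k i * (\<integral>x. x i * G x \<partial>P) \<le> 1 + 2 * C"
        using kms_seq_stein[OF kms G n i] by (simp add: P.prob_space)
      moreover have xG: "(\<lambda>x. x i * G x) = (\<lambda>x. (x i)\<^sup>2 * T n a x)"
        by (auto simp: G_def power2_eq_square)
      ultimately show "(\<integral>x. (x i)\<^sup>2 * T n a x \<partial>P) \<le> K"
        using k[of i] by (simp add: K_def field_simps)
      have "Ck (2 * n) k (\<lambda>y. y (block_index n i) * y (block_index n i))" for k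
        by (intro Ck_mult Ck_coord[OF diffk_ident] block_index_less[OF i])
      from cutoff_in_cylseq[OF \<eta>(1,5) a this]
      have "(\<lambda>x. (x i)\<^sup>2 * T n a x) \<in> cylseq n"
        by (simp add: to_blocks_block_index[OF i] T_def power2_eq_square)
      then show "integrable P (\<lambda>x. (x i)\<^sup>2 * T n a x)"
        by (intro bounded_cont_integrable P bounded_cont_cylseq)
    qed
    \<comment> \<open>Fatou's lemma along the scales a = N + 1 removes the truncation, without any
      integrability known beforehand.\<close>
    have "(\<integral>\<^sup>+x. ennreal ((x i)\<^sup>2) \<partial>P) = (\<integral>\<^sup>+x. liminf (\<lambda>N. ennreal ((x i)\<^sup>2 * T n (real (Suc N)) x)) \<partial>P)"
    proof (intro nn_integral_cong)
      fix x
      have "(\<lambda>N. ennreal ((x i)\<^sup>2 * T n (real (Suc N)) x)) \<longlonglongrightarrow> ennreal ((x i)\<^sup>2 * 1)"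
        by (intro tendsto_ennrealI tendsto_mult tendsto_const T_tendsto)
      then show "ennreal ((x i)\<^sup>2) = liminf (\<lambda>N. ennreal ((x i)\<^sup>2 * T n (real (Suc N)) x))"
        by (simp only: mult_1_right lim_imp_Liminf[OF trivial_limit_sequentially])
    qed
    also have "\<dots> \<le> liminf (\<lambda>N. (\<integral>\<^sup>+x. ennreal ((x i)\<^sup>2 * T n (real (Suc N)) x) \<partial>P))"
      by (rule nn_integral_liminf) measurable
    also have "\<dots> \<le> ennreal K"
    proof (rule Liminf_le)
      have "(\<integral>\<^sup>+x. ennreal ((x i)\<^sup>2 * T n (real (Suc N)) x) \<partial>P) \<le> ennreal K" for N
        using bound[of "real (Suc N)"] int[of "real (Suc N)"] T01
        by (subst nn_integral_eq_integral) (auto intro: ennreal_leI)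
      then show "\<forall>\<^sub>F N in sequentially. (\<integral>\<^sup>+x. ennreal ((x i)\<^sup>2 * T n (real (Suc N)) x) \<partial>P) \<le> ennreal K"
        by simp
    qed simp
    finally have "(\<integral>\<^sup>+x. ennreal ((x i)\<^sup>2) \<partial>P) < \<infinity>"
      by (simp add: le_less_trans)
    then show ?thesis by (intro integrableI_nonneg) auto
  qed
  have coord_int: "integrable P (\<lambda>x. x i)" if "i < 2 * n" for i n
    by (rule integrable_of_square[OF P(1)]) (use moment[OF that] in measurable)

  have stein: "- w i * (\<integral>x. sin ((\<Sum>j<2*n. w j * x j) + b) \<partial>P) = ?k i * (\<integral>x. x i * cos ((\<Sum>j<2*n. w j * x j) + b) \<partial>P)"
    if i: "i < 2 * n" for n w b i
  proof -
    have n: "n \<ge> 1" using i by simp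
    let ?\<theta> = "\<lambda>x::nat \<Rightarrow> real. (\<Sum>j<2*n. w j * x j) + b"
    have [measurable]: "?\<theta> \<in> borel_measurable borel" by measurable
    define G where "G a x = cos (?\<theta> x) * T n a x" for a x
    have G: "G a \<in> cylseq n" if "a > 0" for a
    proof -
      have e: "(\<Sum>j<2*n. w (pair_index n j) * to_blocks n x j) = (\<Sum>j<2*n. w j * x j)" for x
        by (rule sum.reindex_bij_witness[of _ "block_index n" "pair_index n"])
          (auto simp: pair_index_less block_index_less to_blocks_def)
      show ?thesis
        using cutoff_in_cylseq[OF \<eta>(1,5) that Ck_cos_linear[of "2 * n" _ "\<lambda>j. w (pair_index n j)" b]]
        by (simp add: e G_def[abs_def] T_def)
    qed
    have pd: "partial_deriv i (G a) x = - w i * sin (?\<theta> x) * T n a x + cos (?\<theta> x) * (\<eta>' (x i / a) / a * Q n i a x)" for a x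
      unfolding G_def
    proof (intro partial_deriv_eqI DT i)
      have "?\<theta> (x(i := t)) = w i * t + (\<Sum>j\<in>{..<2*n}-{i}. w j * x j) + b" for t
        using i by (subst sum.remove[of _ i]) auto
      moreover have "?\<theta> x = w i * x i + (\<Sum>j\<in>{..<2*n}-{i}. w j * x j) + b"
        using i by (subst sum.remove[of _ i]) auto
      ultimately show "((\<lambda>t. cos (?\<theta> (x(i := t)))) has_real_derivative - w i * sin (?\<theta> x)) (at (x i))"
        by (auto intro!: derivative_eq_intros simp del: fun_upd_apply)
    qed
    \<comment> \<open>The derivative of the cutoff is at most C / a, which tends to 0 and, since a
      \<ge> 1, is dominated by C.\<close>
    have 1: "(\<lambda>N. (\<integral>x. partial_deriv i (G (real (Suc N))) x \<partial>P)) \<longlonglongrightarrow> (\<integral>x. - w i * sin (?\<theta> x) \<partial>P)"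
    proof (rule integral_dominated_convergence[where w="\<lambda>_. \<bar>w i\<bar> + C"])
      show "AE x in P. (\<lambda>N. partial_deriv i (G (real (Suc N))) x) \<longlonglongrightarrow> - w i * sin (?\<theta> x)"
      proof (rule AE_I2)
        fix x
        have "(\<lambda>N. \<eta>' (x i / real (Suc N)) / real (Suc N) * Q n i (real (Suc N)) x) \<longlonglongrightarrow> 0"
        proof (rule Lim_null_comparison)
          show "\<forall>\<^sub>F N in sequentially. norm (\<eta>' (x i / real (Suc N)) / real (Suc N) * Q n i (real (Suc N)) x) \<le> C * inverse (real (Suc N))"
          proof (rule always_eventually, rule allI)
            fix N
            have "\<bar>\<eta>' (x i / real (Suc N)) / real (Suc N) * Q n i (real (Suc N)) x\<bar> \<le> (C / real (Suc N)) * 1"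
              unfolding abs_mult abs_divide using C Q01[of n i "real (Suc N)" x]
              by (intro mult_mono divide_mono) auto
            then show "norm (\<eta>' (x i / real (Suc N)) / real (Suc N) * Q n i (real (Suc N)) x) \<le> C * inverse (real (Suc N))"
              by (simp add: divide_inverse)
          qed
          show "(\<lambda>N. C * inverse (real (Suc N))) \<longlonglongrightarrow> 0"
            using tendsto_mult_right_zero[OF LIMSEQ_inverse_real_of_nat] .
        qed
        then have "(\<lambda>N. - w i * sin (?\<theta> x) * T n (real (Suc N)) x + cos (?\<theta> x) * (\<eta>' (x i / real (Suc N)) / real (Suc N) * Q n i (real (Suc N)) x))
          \<longlonglongrightarrow> - w i * sin (?\<theta> x) * 1 + cos (?\<theta> x) * 0"
          by (intro tendsto_intros T_tendsto)
        then show "(\<lambda>N. partial_deriv i (G (real (Suc N))) x) \<longlonglongrightarrow> - w i * sin (?\<theta> x)"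
          by (simp only: pd mult_1_right mult_zero_right add_0_right)
      qed
      show "AE x in P. norm (partial_deriv i (G (real (Suc N))) x) \<le> \<bar>w i\<bar> + C" for N
      proof (rule AE_I2)
        fix x
        have "\<bar>- w i * sin (?\<theta> x) * T n (real (Suc N)) x\<bar> \<le> (\<bar>w i\<bar> * 1) * 1"
          unfolding abs_mult abs_minus using T01[of n "real (Suc N)" x] by (intro mult_mono) auto
        moreover have "\<bar>cos (?\<theta> x) * (\<eta>' (x i / real (Suc N)) / real (Suc N) * Q n i (real (Suc N)) x)\<bar> \<le> 1 * (C / 1 * 1)"
          unfolding abs_mult abs_divide using C Q01[of n i "real (Suc N)" x]
          by (intro mult_mono divide_mono) auto
        ultimately show "norm (partial_deriv i (G (real (Suc N))) x) \<le> \<bar>w i\<bar> + C"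
          unfolding pd real_norm_def by linarith
      qed
      show "(\<lambda>x. partial_deriv i (G (real (Suc N))) x) \<in> borel_measurable P" for N
        unfolding pd by measurable
    qed (auto)
    have 2: "(\<lambda>N. (\<integral>x. x i * G (real (Suc N)) x \<partial>P)) \<longlonglongrightarrow> (\<integral>x. x i * cos (?\<theta> x) \<partial>P)"
    \<comment> \<open>The dominating function is integrable by the moment bound.\<close>
    proof (rule integral_dominated_convergence[where w="\<lambda>x. \<bar>x i\<bar>"])
      show "AE x in P. (\<lambda>N. x i * G (real (Suc N)) x) \<longlonglongrightarrow> x i * cos (?\<theta> x)"
      proof (rule AE_I2)
        fix x
        have "(\<lambda>N. x i * (cos (?\<theta> x) * T n (real (Suc N)) x)) \<longlonglongrightarrow> x i * (cos (?\<theta> x) * 1)"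
          by (intro tendsto_intros T_tendsto)
        then show "(\<lambda>N. x i * G (real (Suc N)) x) \<longlonglongrightarrow> x i * cos (?\<theta> x)"
          by (simp only: G_def mult_1_right)
      qed
      show "AE x in P. norm (x i * G (real (Suc N)) x) \<le> \<bar>x i\<bar>" for N
      proof (rule AE_I2)
        fix x
        have "\<bar>x i * (cos (?\<theta> x) * T n (real (Suc N)) x)\<bar> \<le> \<bar>x i\<bar> * (1 * 1)"
          unfolding abs_mult using T01[of n "real (Suc N)" x] by (intro mult_mono) auto
        then show "norm (x i * G (real (Suc N)) x) \<le> \<bar>x i\<bar>" by (simp add: G_def)
      qed
      show "(\<lambda>x. x i * G (real (Suc N)) x) \<in> borel_measurable P" for N
        unfolding G_def by measurable
      show "integrable P (\<lambda>x. \<bar>x i\<bar>)" using coord_int[OF i] by simp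
    qed measurable
    have "(\<integral>x. partial_deriv i (G (real (Suc N))) x \<partial>P) = ?k i * (\<integral>x. x i * G (real (Suc N)) x \<partial>P)" for N
      by (rule kms_seq_stein[OF kms G n i]) simp
    then have "(\<lambda>N. ?k i * (\<integral>x. x i * G (real (Suc N)) x \<partial>P)) \<longlonglongrightarrow> (\<integral>x. - w i * sin (?\<theta> x) \<partial>P)"
      using 1 by simp
    moreover have "(\<lambda>N. ?k i * (\<integral>x. x i * G (real (Suc N)) x \<partial>P)) \<longlonglongrightarrow> ?k i * (\<integral>x. x i * cos (?\<theta> x) \<partial>P)"
      by (intro tendsto_mult tendsto_const 2)
    ultimately have "(\<integral>x. - w i * sin (?\<theta> x) \<partial>P) = ?k i * (\<integral>x. x i * cos (?\<theta> x) \<partial>P)"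
      by (rule LIMSEQ_unique)
    then show ?thesis by simp
  qed
  have char: "(\<integral>x. cos ((\<Sum>j<2*n. w j * x j) + b) \<partial>P) = cos b * exp (- (\<Sum>j<2*n. (w j)\<^sup>2 / ?k j) / 2)" for n w b
    by (rule char_from_stein[OF P]) (use moment stein k in auto)
  show ?thesis
  proof (rule prob_eqI_char[OF P(1) prob_space_gauss_seq[OF k] P(2) sets_gauss_seq])
    fix N :: nat and t :: "nat \<Rightarrow> real" and b
    \<comment> \<open>The formula \<open>char\<close> covers even numbers of coordinates; padding
      with zero frequencies reaches every N.\<close>
    define t' where "t' i = (if i < N then t i else 0)" for i
    have e: "(\<Sum>i<N. t i * x i) = (\<Sum>i<2*N. t' i * x i)" for x
      by (rule sum.mono_neutral_cong_left) (auto simp: t'_def)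
    show "(\<integral>x. cos ((\<Sum>i<N. t i * x i) + b) \<partial>P) = (\<integral>x. cos ((\<Sum>i<N. t i * x i) + b) \<partial>gauss_seq ?k)"
      unfolding e char char_gauss_seq[OF k] ..
  qed
qed

section \<open>Gaussian measures on a Hilbert space\<close>

text \<open>By Pythagoras the squared norm of a block of the vector series is the corresponding
  block of the scalar series, so the Cauchy criterion carries over.\<close>

lemma summable_orthogonal:
  fixes a :: "nat \<Rightarrow> 'k::{real_inner, complete_space}"
  assumes orth: "\<And>i j. i \<noteq> j \<Longrightarrow> inner (a i) (a j) = 0"
    and sq: "summable (\<lambda>i. (norm (a i))\<^sup>2)"
  shows "summable a"
proof -
  have "Cauchy (\<lambda>n. sum a {..<n})"
  proof (rule CauchyI')
    fix e :: real assume e: "e > 0"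
    then obtain N where N: "\<And>m n. m \<ge> N \<Longrightarrow> norm (\<Sum>i=m..<n. (norm (a i))\<^sup>2) < e\<^sup>2"
      using sq unfolding summable_Cauchy by (meson zero_less_power)
    have "norm (sum a {..<m} - sum a {..<n}) < e" if "m \<ge> N" "n > m" for m n
    proof -
      have "sum a {..<n} - sum a {..<m} = sum a {m..<n}"
        using that(2) by (simp add: lessThan_atLeast0 sum_diff_nat_ivl)
      then have "norm (sum a {..<m} - sum a {..<n}) = norm (sum a {m..<n})"
        by (metis norm_minus_commute)
      moreover have "(norm (sum a {m..<n}))\<^sup>2 = (\<Sum>i=m..<n. (norm (a i))\<^sup>2)"
        by (rule norm_sum_Pythagorean) (auto simp: pairwise_def orthogonal_def orth)
      ultimately have "(norm (sum a {..<m} - sum a {..<n}))\<^sup>2 < e\<^sup>2" using N[OF that(1), of n] by simp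
      then show ?thesis by (rule power_less_imp_less_base) (use e in simp)
    qed
    then show "\<exists>M. \<forall>m\<ge>M. \<forall>n>m. dist (sum a {..<m}) (sum a {..<n}) < e"
      unfolding dist_norm by blast
  qed
  then show ?thesis by (simp add: summable_iff_convergent Cauchy_convergent)
qed

text \<open>Convergent partial sums are bounded, and by Pythagoras their squared norms are the
  partial sums of the scalar series.\<close>

lemma summable_norm_orthogonal:
  fixes a :: "nat \<Rightarrow> 'k::real_inner"
  assumes orth: "\<And>i j. i \<noteq> j \<Longrightarrow> inner (a i) (a j) = 0" and "summable a"
  shows "summable (\<lambda>i. (norm (a i))\<^sup>2)"
proof -
  have "convergent (\<lambda>n. sum a {..<n})" using assms(2) by (simp add: summable_iff_convergent)
  then have "Bseq (\<lambda>n. sum a {..<n})" by (rule convergent_imp_Bseq)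
  then obtain K where K: "\<And>n. norm (sum a {..<n}) \<le> K" by (auto simp: Bseq_def)
  have "(\<Sum>i<n. (norm (a i))\<^sup>2) \<le> K\<^sup>2" for n
  proof -
    have "(norm (sum a {..<n}))\<^sup>2 = (\<Sum>i<n. (norm (a i))\<^sup>2)"
      by (rule norm_sum_Pythagorean) (auto simp: pairwise_def orthogonal_def orth)
    then show ?thesis using power_mono[OF K[of n] norm_ge_zero, of 2] by simp
  qed
  then show ?thesis by (intro summableI_nonneg_bounded) auto
qed

text \<open>The vectors are not normalised: the images in \<open>'k\<close> of an orthonormal basis
  of \<open>'h\<close> have varying norms, and without rescaling them the coordinates in both spaces
  are the same.\<close>

locale orthogonal_basis =
  fixes v :: "nat \<Rightarrow> 'k::{real_inner, complete_space}"
  assumes orth: "i \<noteq> j \<Longrightarrow> inner (v i) (v j) = 0"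
    and nonzero: "v i \<noteq> 0"
    and total: "closure (span (range v)) = UNIV"
begin

definition coef :: "'k \<Rightarrow> nat \<Rightarrow> real" where
  "coef u i = inner (v i) u / (norm (v i))\<^sup>2"

lemma bounded_linear_coef: "bounded_linear (\<lambda>u. coef u i)"
  unfolding coef_def by (rule bounded_linear_compose[OF bounded_linear_divide bounded_linear_inner_right])

sublocale coef: bounded_linear "\<lambda>u. coef u i" for i
  by (rule bounded_linear_coef)

lemma coef_v: "coef (v j) i = (if i = j then 1 else 0)"
  using nonzero[of j] orth[of i j] by (auto simp: coef_def power2_norm_eq_inner)

lemma continuous_on_coef: "continuous_on S coef"
  by (rule continuous_on_coordinatewise_then_product)
    (simp add: linear_continuous_on bounded_linear_coef)

lemma coef_measurable [measurable]: "coef \<in> borel_measurable borel"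
  by (rule borel_measurable_continuous_onI[OF continuous_on_coef])

text \<open>The n-th partial sum is the orthogonal projection of u onto the span of the first n
  vectors, hence its best approximation there; every finite combination close to u lies in one of
  these spans.\<close>

lemma coef_sums: "(\<lambda>i. coef u i *\<^sub>R v i) sums u"
proof -
  define S where "S n = (\<Sum>i<n. coef u i *\<^sub>R v i)" for n
  have perp: "inner y (u - S n) = 0" if "y \<in> span (v ` {..<n})" for n y
    using that
  proof (induction rule: span_induct_alt)
    case (step r x y)
    then obtain j where j: "j < n" "x = v j" by auto
    have "inner (v j) (S n) = (\<Sum>i<n. if i = j then coef u i * inner (v j) (v j) else 0)"
      unfolding S_def inner_sum_right by (intro sum.cong) (auto simp: orth)
    also have "\<dots> = inner (v j) u"
      using j(1) nonzero[of j] by (simp add: coef_def power2_norm_eq_inner)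
    finally show ?case using step j by (simp add: inner_add_left inner_diff_right)
  qed simp
  have best: "norm (u - S n) \<le> norm (u - y)" if y: "y \<in> span (v ` {..<n})" for n y
  proof -
    have "S n \<in> span (v ` {..<n})"
      unfolding S_def by (intro span_sum span_scale span_base) auto
    then have "orthogonal (u - S n) (S n - y)"
      using perp[of "S n - y" n] y by (simp add: span_diff orthogonal_def inner_commute)
    then have "(norm (u - y))\<^sup>2 = (norm (u - S n))\<^sup>2 + (norm (S n - y))\<^sup>2"
      using norm_add_Pythagorean[of "u - S n" "S n - y"] by simp
    then have "(norm (u - S n))\<^sup>2 \<le> (norm (u - y))\<^sup>2" by simp
    then show ?thesis by (rule power2_le_imp_le) simp
  qed
  have fin: "\<exists>N. \<forall>n\<ge>N. y \<in> span (v ` {..<n})" if "y \<in> span (range v)" for y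
    using that
  proof (induction rule: span_induct_alt)
    case base
    then show ?case by (auto simp: span_zero)
  next
    case (step r x y)
    then obtain j N where j: "x = v j" and N: "\<And>n. n \<ge> N \<Longrightarrow> y \<in> span (v ` {..<n})" by auto
    have "r *\<^sub>R x + y \<in> span (v ` {..<n})" if "n \<ge> max N (Suc j)" for n
      using that j by (intro span_add span_scale N span_base) auto
    then show ?case by blast
  qed
  have "S \<longlonglongrightarrow> u"
  proof (rule LIMSEQ_I)
    fix r :: real assume "r > 0"
    moreover have "u \<in> closure (span (range v))" using total by simp
    ultimately obtain y where y: "y \<in> span (range v)" "dist y u < r"
      by (auto simp: closure_approachable)
    then obtain N where "\<And>n. n \<ge> N \<Longrightarrow> y \<in> span (v ` {..<n})" using fin by blast
    then have "norm (S n - u) < r" if "n \<ge> N" for n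
      using best[of y n] y(2) that by (simp add: dist_norm norm_minus_commute)
    then show "\<exists>N. \<forall>n\<ge>N. norm (S n - u) < r" by blast
  qed
  then show ?thesis by (simp add: sums_def S_def[abs_def])
qed

definition square_summable :: "(nat \<Rightarrow> real) set" where
  "square_summable = {x. summable (\<lambda>i. (x i * norm (v i))\<^sup>2)}"

text \<open>The default 0 makes this a total Borel function, inverse to \<open>coef\<close> on the
  square-summable sequences.\<close>

definition series :: "(nat \<Rightarrow> real) \<Rightarrow> 'k" where
  "series x = (if x \<in> square_summable then \<Sum>i. x i *\<^sub>R v i else 0)"

lemma series_sums:
  assumes "x \<in> square_summable"
  shows "(\<lambda>i. x i *\<^sub>R v i) sums series x"
proof -
  have "summable (\<lambda>i. x i *\<^sub>R v i)"
  proof (rule summable_orthogonal)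
    show "inner (x i *\<^sub>R v i) (x j *\<^sub>R v j) = 0" if "i \<noteq> j" for i j
      using orth[OF that] by simp
    show "summable (\<lambda>i. (norm (x i *\<^sub>R v i))\<^sup>2)"
      using assms by (simp add: square_summable_def power_mult_distrib)
  qed
  then show ?thesis using assms by (simp add: series_def summable_sums)
qed

lemma coef_series:
  assumes "x \<in> square_summable"
  shows "coef (series x) = x"
proof
  fix j
  have "(\<lambda>i. coef (x i *\<^sub>R v i) j) sums coef (series x) j"
    using series_sums[OF assms] by (rule coef.sums)
  moreover have "coef (x i *\<^sub>R v i) j = (if i = j then x i else 0)" for i
    by (simp add: coef.scaleR coef_v)
  ultimately have "(\<lambda>i. if i = j then x i else 0) sums coef (series x) j" by simp
  then show "coef (series x) j = x j"
    using sums_single[of j x] sums_unique2 by blast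
qed

lemma coef_square_summable: "coef u \<in> square_summable"
proof -
  have "summable (\<lambda>i. (norm (coef u i *\<^sub>R v i))\<^sup>2)"
    by (rule summable_norm_orthogonal) (use coef_sums in \<open>auto simp: orth summable_def\<close>)
  then show ?thesis by (simp add: square_summable_def power_mult_distrib)
qed

lemma series_coef: "series (coef u) = u"
  by (rule sums_unique2[OF series_sums[OF coef_square_summable] coef_sums])

text \<open>A series of nonnegative terms converges iff its partial sums have a common natural
  bound, which is a condition with countable quantifiers only.\<close>

lemma square_summable_sets [measurable]: "square_summable \<in> sets borel"
proof -
  have "square_summable = {x \<in> space borel. \<exists>B::nat. \<forall>n. (\<Sum>i<n. (x i * norm (v i))\<^sup>2) \<le> real B}"
  proof (intro set_eqI iffI)
    fix x assume "x \<in> square_summable"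
    then have s: "summable (\<lambda>i. (x i * norm (v i))\<^sup>2)" by (simp add: square_summable_def)
    obtain B where "(\<Sum>i. (x i * norm (v i))\<^sup>2) \<le> real B" using real_arch_simple by blast
    then have "(\<Sum>i<n. (x i * norm (v i))\<^sup>2) \<le> real B" for n
      using sum_le_suminf[OF s, of "{..<n}"] by simp
    then show "x \<in> {x \<in> space borel. \<exists>B::nat. \<forall>n. (\<Sum>i<n. (x i * norm (v i))\<^sup>2) \<le> real B}" by auto
  next
    fix x assume "x \<in> {x \<in> space borel. \<exists>B::nat. \<forall>n. (\<Sum>i<n. (x i * norm (v i))\<^sup>2) \<le> real B}"
    then show "x \<in> square_summable"
      by (auto simp: square_summable_def intro!: summableI_nonneg_bounded)
  qed
  also have "\<dots> \<in> sets borel" by measurable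
  finally show ?thesis .
qed

text \<open>The space is not assumed to be second countable, so measurability of partial sums is not
  available from measurability of addition.\<close>

lemma series_measurable [measurable]: "series \<in> borel_measurable borel"
proof (rule borel_measurable_LIMSEQ_metric)
  fix n
  have "continuous_on UNIV (\<lambda>x. \<Sum>i<n. x i *\<^sub>R v i)" by (intro continuous_intros)
  then have "(\<lambda>x. \<Sum>i<n. x i *\<^sub>R v i) \<in> borel_measurable borel"
    by (rule borel_measurable_continuous_onI)
  then show "(\<lambda>x. if x \<in> square_summable then \<Sum>i<n. x i *\<^sub>R v i else 0) \<in> borel_measurable borel"
    by (intro measurable_If_set) auto
next
  fix x
  show "(\<lambda>n. if x \<in> square_summable then \<Sum>i<n. x i *\<^sub>R v i else 0) \<longlonglongrightarrow> series x"
    using series_sums[of x] by (auto simp: sums_def series_def)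
qed

lemma distr_series_coef:
  assumes "sets \<mu> = sets borel"
  shows "distr (distr \<mu> borel coef) borel series = \<mu>"
proof -
  note [measurable_cong] = assms
  have "distr (distr \<mu> borel coef) borel series = distr \<mu> borel (series \<circ> coef)"
    by (rule distr_distr) measurable
  also have "\<dots> = distr \<mu> borel (\<lambda>u. u)" by (simp add: comp_def series_coef)
  also have "\<dots> = \<mu>" using assms by (simp add: distr_id2)
  finally show ?thesis .
qed

lemma prob_space_distr_coef:
  assumes "borel_prob \<mu>"
  shows "prob_space (distr \<mu> borel coef)"
proof -
  have [measurable_cong]: "sets \<mu> = sets borel" using assms by (simp add: borel_prob_def)
  interpret prob_space \<mu> using assms by (simp add: borel_prob_def)
  show ?thesis by (rule prob_space_distr) measurable
qed

end

section \<open>The Gaussian measure as the law of a random series\<close>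

locale gaussian_on_basis = orthogonal_basis +
  fixes k :: "nat \<Rightarrow> real"
  assumes k: "k i > 0" and trace: "summable (\<lambda>i. (norm (v i))\<^sup>2 / k i)"
begin

definition gauss :: "'a measure" where
  "gauss = distr (gauss_seq k) borel series"

lemma borel_prob_gauss: "borel_prob gauss"
proof -
  interpret prob_space "gauss_seq k" by (rule prob_space_gauss_seq[OF k])
  show ?thesis by (simp add: borel_prob_def gauss_def prob_space_distr)
qed

text \<open>The expectation of the sum of squares is the series in \<open>trace\<close>; being
  finite, it makes the sum finite almost surely.\<close>

lemma AE_square_summable: "AE x in gauss_seq k. x \<in> square_summable"
proof -
  have "(\<integral>\<^sup>+x. (\<Sum>i. ennreal ((x i * norm (v i))\<^sup>2)) \<partial>gauss_seq k) = (\<Sum>i. \<integral>\<^sup>+x. ennreal ((x i * norm (v i))\<^sup>2) \<partial>gauss_seq k)"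
    by (rule nn_integral_suminf) measurable
  also have "\<dots> = (\<Sum>i. ennreal ((norm (v i))\<^sup>2 / k i))"
  proof (rule suminf_cong)
    fix i
    have "(\<integral>\<^sup>+x. ennreal ((x i * norm (v i))\<^sup>2) \<partial>gauss_seq k) = ennreal (\<integral>x. (x i * norm (v i))\<^sup>2 \<partial>gauss_seq k)"
      using gauss_seq_second_moment(1)[of k i, OF k] by (intro nn_integral_eq_integral) (auto simp: power_mult_distrib)
    then show "(\<integral>\<^sup>+x. ennreal ((x i * norm (v i))\<^sup>2) \<partial>gauss_seq k) = ennreal ((norm (v i))\<^sup>2 / k i)"
      using gauss_seq_second_moment[of k i, OF k] by (simp add: power_mult_distrib)
  qed
  also have "\<dots> = ennreal (\<Sum>i. (norm (v i))\<^sup>2 / k i)"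
    using k by (intro suminf_ennreal2 trace) (simp add: less_imp_le)
  finally have "(\<integral>\<^sup>+x. (\<Sum>i. ennreal ((x i * norm (v i))\<^sup>2)) \<partial>gauss_seq k) \<noteq> \<infinity>" by simp
  then have "AE x in gauss_seq k. (\<Sum>i. ennreal ((x i * norm (v i))\<^sup>2)) \<noteq> \<infinity>"
    by (intro nn_integral_noteq_infinite) measurable
  then show ?thesis
    by eventually_elim (auto simp: square_summable_def intro: summable_suminf_not_top)
qed

text \<open>\<open>coef\<close> inverts \<open>series\<close> on \<open>square_summable\<close>, a
  set of full measure.\<close>

lemma distr_gauss_coef: "distr gauss borel coef = gauss_seq k"
proof -
  have "distr gauss borel coef = distr (gauss_seq k) borel (coef \<circ> series)"
    unfolding gauss_def by (rule distr_distr) measurable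
  also have "\<dots> = distr (gauss_seq k) borel (\<lambda>x. x)"
    using AE_square_summable by (intro distr_cong_AE) (auto simp: coef_series)
  also have "\<dots> = gauss_seq k" by (simp add: distr_id2)
  finally show ?thesis .
qed

lemma eq_gauss_iff:
  assumes "sets \<mu> = sets borel"
  shows "\<mu> = gauss \<longleftrightarrow> distr \<mu> borel coef = gauss_seq k"
  using distr_series_coef[OF assms] distr_gauss_coef gauss_def by metis

text \<open>By continuity f of the random series is the limit of finite linear forms in the
  coordinates, whose characteristic functions are known; cosines are bounded, so the limit passes
  under the integral. The bound on f and \<open>trace\<close> make the variance finite.\<close>

lemma char_gauss:
  fixes f :: "'a \<Rightarrow> real"
  assumes f: "bounded_linear f"
  shows "(\<integral>u. cos (t * f u + b) \<partial>gauss) = cos b * exp (- (t\<^sup>2 * (\<Sum>i. (f (v i))\<^sup>2 / k i)) / 2)"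
    and "summable (\<lambda>i. (f (v i))\<^sup>2 / k i)"
proof -
  interpret f: bounded_linear f by fact
  interpret G: prob_space "gauss_seq k" by (rule prob_space_gauss_seq[OF k])
  have [measurable]: "f \<in> borel_measurable borel"
    by (intro borel_measurable_continuous_onI linear_continuous_on f)
  obtain K where K: "\<And>u. \<bar>f u\<bar> \<le> norm u * K" using f.bounded by auto
  show s: "summable (\<lambda>i. (f (v i))\<^sup>2 / k i)"
  proof (rule summable_comparison_test')
    show "summable (\<lambda>i. K\<^sup>2 * ((norm (v i))\<^sup>2 / k i))" by (intro summable_mult trace)
    fix i
    have "\<bar>f (v i)\<bar>\<^sup>2 \<le> (norm (v i) * K)\<^sup>2" by (intro power_mono K) simp
    then show "norm ((f (v i))\<^sup>2 / k i) \<le> K\<^sup>2 * ((norm (v i))\<^sup>2 / k i)"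
      using k[of i] by (simp add: power_mult_distrib divide_right_mono mult.commute)
  qed
  have "(\<lambda>n. (\<integral>x. cos ((\<Sum>i<n. (t * f (v i)) * x i) + b) \<partial>gauss_seq k)) \<longlonglongrightarrow> (\<integral>x. cos (t * f (series x) + b) \<partial>gauss_seq k)"
  proof (rule integral_dominated_convergence[where w="\<lambda>_. 1"])
    show "AE x in gauss_seq k. (\<lambda>n. cos ((\<Sum>i<n. (t * f (v i)) * x i) + b)) \<longlonglongrightarrow> cos (t * f (series x) + b)"
      using AE_square_summable
    proof eventually_elim
      fix x assume "x \<in> square_summable"
      then have "(\<lambda>i. f (x i *\<^sub>R v i)) sums f (series x)"
        using series_sums f.sums by blast
      then have "(\<lambda>n. \<Sum>i<n. x i * f (v i)) \<longlonglongrightarrow> f (series x)"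
        by (simp add: sums_def f.scaleR)
      then have "(\<lambda>n. cos (t * (\<Sum>i<n. x i * f (v i)) + b)) \<longlonglongrightarrow> cos (t * f (series x) + b)"
        by (intro tendsto_intros)
      then show "(\<lambda>n. cos ((\<Sum>i<n. (t * f (v i)) * x i) + b)) \<longlonglongrightarrow> cos (t * f (series x) + b)"
        by (simp add: sum_distrib_left mult_ac)
    qed
  qed auto
  moreover have "(\<lambda>n. (\<integral>x. cos ((\<Sum>i<n. (t * f (v i)) * x i) + b) \<partial>gauss_seq k))
      \<longlonglongrightarrow> cos b * exp (- (t\<^sup>2 * (\<Sum>i. (f (v i))\<^sup>2 / k i)) / 2)"
  proof -
    have "(\<lambda>n. cos b * exp (- (t\<^sup>2 * (\<Sum>i<n. (f (v i))\<^sup>2 / k i)) / 2))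
      \<longlonglongrightarrow> cos b * exp (- (t\<^sup>2 * (\<Sum>i. (f (v i))\<^sup>2 / k i)) / 2)"
      by (intro tendsto_intros summable_LIMSEQ s) simp
    then show ?thesis
      unfolding char_gauss_seq[OF k] by (simp add: power_mult_distrib sum_distrib_left)
  qed
  ultimately have "(\<integral>x. cos (t * f (series x) + b) \<partial>gauss_seq k) = cos b * exp (- (t\<^sup>2 * (\<Sum>i. (f (v i))\<^sup>2 / k i)) / 2)"
    by (rule LIMSEQ_unique)
  then show "(\<integral>u. cos (t * f u + b) \<partial>gauss) = cos b * exp (- (t\<^sup>2 * (\<Sum>i. (f (v i))\<^sup>2 / k i)) / 2)"
    unfolding gauss_def by (subst integral_distr) auto
qed

lemma iexp_gauss:
  fixes f :: "'a \<Rightarrow> real"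
  assumes f: "bounded_linear f"
  shows "(LINT u|gauss. iexp (t * f u)) = complex_of_real (exp (- (t\<^sup>2 * (\<Sum>i. (f (v i))\<^sup>2 / k i)) / 2))"
proof -
  have [measurable_cong]: "sets gauss = sets borel" and P: "prob_space gauss"
    using borel_prob_gauss by (simp_all add: borel_prob_def)
  have [measurable]: "f \<in> borel_measurable borel"
    by (intro borel_measurable_continuous_onI linear_continuous_on f)
  show ?thesis
    using char_gauss(1)[OF f, of t 0] char_gauss(1)[OF f, of t "- pi / 2"]
    by (subst integral_iexp[OF P]) simp_all
qed

text \<open>A normal law is the law of one coordinate of a Gaussian sequence, so the formula is the
  case N = 1 of \<open>char_gauss_seq\<close>.\<close>

lemma char_normal:
  assumes "V > 0"
  shows "char (density lborel (normal_density 0 (sqrt V))) t = complex_of_real (exp (- (t\<^sup>2 * V) / 2))"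
proof -
  let ?k = "\<lambda>_::nat. 1 / V"
  have k: "?k i > 0" for i using assms by simp
  have e: "density lborel (normal_density 0 (sqrt V)) = distr (gauss_seq ?k) borel (\<lambda>x. x 0)"
    using assms by (subst distr_gauss_seq_coord[OF k]) (simp add: real_sqrt_divide)
  have "(\<integral>x. cos (t * x 0 + b) \<partial>gauss_seq ?k) = cos b * exp (- (t\<^sup>2 * V) / 2)" for b
    using char_gauss_seq[where k="?k" and N=1 and w="\<lambda>_. t" and b=b, OF k] by simp
  from this[of 0] this[of "- pi / 2"]
  have "(LINT x|gauss_seq ?k. iexp (t * x 0)) = complex_of_real (exp (- (t\<^sup>2 * V) / 2))"
    by (subst integral_iexp[OF prob_space_gauss_seq[OF k]]) simp_all
  then show ?thesis unfolding e char_def by (subst integral_distr) simp_all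
qed

text \<open>The characteristic function of f depends on its variance V alone, and Levy's theorem
  identifies the law: Dirac for V = 0, normal with standard deviation \<open>sqrt V\<close>
  otherwise.\<close>

lemma centered_gaussian_gauss: "centered_gaussian gauss"
  unfolding centered_gaussian_def
proof (intro conjI allI impI borel_prob_gauss)
  fix f :: "'a \<Rightarrow> real" assume f: "bounded_linear f"
  have [measurable_cong]: "sets gauss = sets borel" and P: "prob_space gauss"
    using borel_prob_gauss by (simp_all add: borel_prob_def)
  have [measurable]: "f \<in> borel_measurable borel"
    by (intro borel_measurable_continuous_onI linear_continuous_on f)
  define V where "V = (\<Sum>i. (f (v i))\<^sup>2 / k i)"
  have V: "V \<ge> 0" unfolding V_def
    using char_gauss(2)[OF f] k by (intro suminf_nonneg) (auto simp: less_imp_le)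
  have rd: "real_distribution (distr gauss borel f)"
    using prob_space.prob_space_distr[OF P, of f borel] by (simp add: real_distribution_def real_distribution_axioms_def)
  have ch: "char (distr gauss borel f) = (\<lambda>t. complex_of_real (exp (- (t\<^sup>2 * V) / 2)))"
    using iexp_gauss[OF f] by (auto simp: char_def integral_distr V_def)
  show "distr gauss borel f = return borel 0 \<or>
     (\<exists>\<sigma>>0. distr gauss borel f = density lborel (\<lambda>x. ennreal (normal_density 0 \<sigma> x)))"
  proof (cases "V = 0")
    case True
    have "distr gauss borel f = return borel 0"
    proof (rule Levy_uniqueness[OF rd])
      show "real_distribution (return borel (0::real))"
        by (simp add: real_distribution_def real_distribution_axioms_def prob_space_return)
      show "char (distr gauss borel f) = char (return borel 0)"
        unfolding ch by (auto simp: char_def True integral_return)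
    qed
    then show ?thesis ..
  next
    case False
    then have V: "V > 0" using V by simp
    have "distr gauss borel f = density lborel (normal_density 0 (sqrt V))"
    proof (rule Levy_uniqueness[OF rd])
      show "real_distribution (density lborel (normal_density 0 (sqrt V)))"
        using V prob_space_normal_density by (simp add: real_distribution_def real_distribution_axioms_def)
    qed (simp add: ch fun_eq_iff char_normal[OF V])
    then show ?thesis using V by (intro disjI2 exI[of _ "sqrt V"]) simp
  qed
qed

text \<open>Multiplying by the unit number of angle b and taking real parts yields the cosine
  integrals with phase b that \<open>prob_eqI_char\<close> compares.\<close>

lemma eq_gaussI:
  assumes \<mu>: "borel_prob \<mu>"
    and eq: "\<And>N w. (LINT u|\<mu>. iexp (\<Sum>i<N. w i * coef u i)) = (LINT u|gauss. iexp (\<Sum>i<N. w i * coef u i))"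
  shows "\<mu> = gauss"
proof -
  have c: "(\<integral>x. cos ((\<Sum>i<N. w i * x i) + b) \<partial>distr \<nu> borel coef) =
      Re (iexp b * (LINT u|\<nu>. iexp (\<Sum>i<N. w i * coef u i)))" if "borel_prob \<nu>" for \<nu> N w b
  proof -
    have [measurable_cong]: "sets \<nu> = sets borel" and P: "prob_space \<nu>"
      using that by (simp_all add: borel_prob_def)
    have [measurable]: "(\<lambda>u. coef u i) \<in> borel_measurable borel" for i
      using measurable_compose[OF coef_measurable measurable_coord] .
    let ?\<theta> = "\<lambda>u. \<Sum>i<N. w i * coef u i"
    have cs: "cos (y + b) = Re (iexp b * iexp y)" for y :: real
      by (simp add: cis_conv_exp[symmetric] cos_add mult.commute)
    have i: "integrable \<nu> (\<lambda>u. iexp (?\<theta> u))"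
      by (rule bounded_integrable[where B=1, OF P]) simp_all
    have "(\<integral>x. cos ((\<Sum>i<N. w i * x i) + b) \<partial>distr \<nu> borel coef) = (\<integral>u. cos (?\<theta> u + b) \<partial>\<nu>)"
      by (subst integral_distr) auto
    also have "\<dots> = (\<integral>u. Re (iexp b * iexp (?\<theta> u)) \<partial>\<nu>)"
      by (simp only: cs)
    also have "\<dots> = Re (iexp b * (LINT u|\<nu>. iexp (?\<theta> u)))"
      using i by (subst integral_Re) simp_all
    finally show ?thesis .
  qed
  have "distr \<mu> borel coef = distr gauss borel coef"
  proof (rule prob_eqI_char)
    show "(\<integral>x. cos ((\<Sum>i<N. w i * x i) + b) \<partial>distr \<mu> borel coef) =
        (\<integral>x. cos ((\<Sum>i<N. w i * x i) + b) \<partial>distr gauss borel coef)" for N w b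
      unfolding c[OF \<mu>] c[OF borel_prob_gauss] eq ..
  qed (simp_all add: prob_space_distr_coef \<mu> borel_prob_gauss)
  then show ?thesis
    using eq_gauss_iff[of \<mu>] distr_gauss_coef \<mu> by (simp add: borel_prob_def)
qed

end

section \<open>Complex inner products in real terms\<close>

lemma scaleC_one [simp]: "1 *\<^sub>C x = (x :: 'h::complex_hilbert)"
  using scaleC_of_real[of 1 x] by simp

lemma cinner_scaleC_left: "cinner (z *\<^sub>C x) y = cnj z * cinner x (y :: 'h::complex_hilbert)"
  by (metis cinner_scaleC_right cinner_commute complex_cnj_mult)

lemma cinner_scaleR_left: "cinner (r *\<^sub>R x) y = complex_of_real r * cinner x (y :: 'h::complex_hilbert)"
  by (simp add: scaleC_of_real[symmetric] cinner_scaleC_left)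

lemma cinner_scaleR_right: "cinner x (r *\<^sub>R y) = complex_of_real r * cinner x (y :: 'h::complex_hilbert)"
  by (simp add: scaleC_of_real[symmetric] cinner_scaleC_right)

text \<open>Antilinearity on the left turns the factor i into - i, whose real part extracts the
  imaginary part. Complex inner products thus reduce to two real ones.\<close>

lemma Im_cinner: "Im (cinner x y) = inner (\<i> *\<^sub>C x) (y :: 'h::complex_hilbert)"
  by (simp add: Re_cinner[symmetric] cinner_scaleC_left)

lemma cinner_conv_inner:
  "cinner x y = complex_of_real (inner x y) + \<i> * complex_of_real (inner (\<i> *\<^sub>C x) (y :: 'h::complex_hilbert))"
  by (rule complex_eqI) (simp_all add: Re_cinner Im_cinner)

lemma cinner_self: "cinner x x = complex_of_real ((norm (x :: 'h::complex_hilbert))\<^sup>2)"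
proof (rule complex_eqI)
  have "Im (cinner x x) = Im (cnj (cinner x x))" by (rule arg_cong[OF cinner_commute])
  then show "Im (cinner x x) = Im (complex_of_real ((norm x)\<^sup>2))" by simp
qed (simp add: Re_cinner power2_norm_eq_inner)

lemma norm_scaleC: "norm (z *\<^sub>C x) = cmod z * norm (x :: 'h::complex_hilbert)"
proof -
  have "complex_of_real ((norm (z *\<^sub>C x))\<^sup>2) = (z * cnj z) * cinner x x"
    unfolding cinner_self[symmetric] by (simp add: cinner_scaleC_left cinner_scaleC_right mult_ac)
  also have "\<dots> = complex_of_real ((cmod z * norm x)\<^sup>2)"
    by (simp only: complex_norm_square cinner_self power_mult_distrib of_real_mult)
  finally have "(norm (z *\<^sub>C x))\<^sup>2 = (cmod z * norm x)\<^sup>2" by (simp only: of_real_eq_iff)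
  then show ?thesis by (simp add: power2_eq_iff_nonneg)
qed

lemma bounded_linear_cinner_right: "bounded_linear (cinner (x :: 'h::complex_hilbert))"
proof -
  have "bounded_linear (\<lambda>y. complex_of_real (inner x y) + \<i> * complex_of_real (inner (\<i> *\<^sub>C x) y))"
    by (intro bounded_linear_add bounded_linear_compose[OF bounded_linear_of_real bounded_linear_inner_right]
        bounded_linear_compose[OF bounded_linear_mult_right])
  then show ?thesis by (simp add: cinner_conv_inner[abs_def])
qed

text \<open>Every \<open>f j\<close> occurs twice, as each eigenvalue does among the real
  coordinates.\<close>

lemma summable_div2:
  fixes f :: "nat \<Rightarrow> real"
  assumes "summable f" "\<And>j. f j \<ge> 0"
  shows "summable (\<lambda>i. f (i div 2))"
proof (rule summableI_nonneg_bounded)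
  have d: "(\<Sum>i<2*n. f (i div 2)) = 2 * (\<Sum>j<n. f j)" for n
    by (induction n) (simp_all add: algebra_simps)
  show "(\<Sum>i<n. f (i div 2)) \<le> 2 * (\<Sum>j. f j)" for n
  proof -
    have "(\<Sum>i<n. f (i div 2)) \<le> (\<Sum>i<2*n. f (i div 2))"
      using assms(2) by (intro sum_mono2) auto
    also have "\<dots> \<le> 2 * (\<Sum>j. f j)"
      unfolding d using assms by (intro mult_left_mono sum_le_suminf) auto
    finally show ?thesis .
  qed
qed (use assms in auto)

text \<open>Two continuous extensions agree on a closed set that contains a dense one. This
  evaluates the definite description.\<close>

lemma cont_ext_eqI:
  fixes \<iota> :: "'h \<Rightarrow> 'k::topological_space" and f :: "'k \<Rightarrow> real"
  assumes dense: "closure (\<iota> ` S) = UNIV" and f: "continuous_on UNIV f" "\<And>x. x \<in> S \<Longrightarrow> f (\<iota> x) = h x"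
  shows "cont_ext \<iota> S h = f"
  unfolding cont_ext_def
proof (rule the_equality)
  fix g assume g: "continuous_on UNIV g \<and> (\<forall>x\<in>S. g (\<iota> x) = h x)"
  have "closed {u. g u = f u}" using g f by (intro closed_Collect_eq) auto
  moreover have "\<iota> ` S \<subseteq> {u. g u = f u}" using g f(2) by auto
  ultimately have "closure (\<iota> ` S) \<subseteq> {u. g u = f u}" by (rule closure_minimal[rotated])
  then show "g = f" using dense by auto
qed (use f in auto)

section \<open>The Sobolev setting\<close>

locale sobolev_setting =
  fixes D :: "'h::complex_hilbert set" and A :: "'h \<Rightarrow> 'h"
    and e :: "nat \<Rightarrow> 'h" and l :: "nat \<Rightarrow> real" and c s \<beta> :: real
    and \<iota> :: "'h \<Rightarrow> 'k::complex_hilbert"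
  assumes self_adj: "self_adjoint D A"
    and c_pos: "c > 0" and lower: "\<forall>x\<in>D. Re (cinner x (A x)) \<ge> c * (norm x)\<^sup>2"
    and onb: "orthonormal_basis e" and eig: "\<forall>j. e j \<in> D \<and> A (e j) = l j *\<^sub>R e j"
    and s_nonneg: "s \<ge> 0" and l_summable: "summable (\<lambda>j. l j powr (- (1 + s)))"
    and completion: "is_completion (neg_sobolev_ip e l s) \<iota>"
    and \<beta>_pos: "\<beta> > 0"
begin

lemma cinner_e: "cinner (e i) (e j) = (if i = j then 1 else 0)"
  using onb by (simp add: orthonormal_basis_def)

lemma e_sums: "(\<lambda>j. cinner (e j) x *\<^sub>C e j) sums x"
  using onb by (simp add: orthonormal_basis_def)

lemma norm_e: "norm (e j) = 1"
proof -
  have "complex_of_real ((norm (e j))\<^sup>2) = complex_of_real 1"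
    unfolding cinner_self[symmetric] by (simp add: cinner_e)
  then have "(norm (e j))\<^sup>2 = 1" by (simp only: of_real_eq_iff)
  then show ?thesis by (simp add: power2_eq_1_iff) (metis norm_ge_zero not_one_le_zero neg_0_le_iff_le)
qed

lemma l_ge: "c \<le> l j"
  using lower[rule_format, of "e j"] eig by (simp add: cinner_scaleR_right cinner_e norm_e)

lemma l_pos: "l j > 0"
  using l_ge[of j] c_pos by linarith

text \<open>A uniform way to write the real orthonormal basis that alternates between
  \<open>e j\<close> and its multiple by the imaginary unit; index i then belongs to the eigenvalue
  \<open>l (i div 2)\<close>.\<close>

definition phase :: "nat \<Rightarrow> complex" where "phase i = (if even i then 1 else \<i>)"

definition g :: "nat \<Rightarrow> 'h" where "g i = phase i *\<^sub>C e (i div 2)"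

definition v :: "nat \<Rightarrow> 'k" where "v i = \<iota> (g i)"

lemma g_even: "g (2 * j) = e j" and g_odd: "g (Suc (2 * j)) = \<i> *\<^sub>C e j"
  by (simp_all add: g_def phase_def)

lemma inner_g: "inner (g i) (g j) = (if i = j then 1 else 0)"
proof -
  have "cinner (g i) (g j) = cnj (phase i) * phase j * (if i div 2 = j div 2 then 1 else 0)"
    by (simp add: g_def cinner_scaleC_left cinner_scaleC_right cinner_e)
  moreover have "i = j" if "i div 2 = j div 2" "even i = even j"
    using that by (metis div_mult_mod_eq even_iff_mod_2_eq_zero odd_iff_mod_2_eq_one)
  ultimately show ?thesis
    unfolding Re_cinner[symmetric] by (auto simp: phase_def)
qed

lemma norm_g: "norm (g i) = 1"
  using inner_g[of i i] by (simp add: norm_eq_sqrt_inner)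

lemma inner_g_conv: "inner (g i) x = Re (cnj (phase i) * cinner (e (i div 2)) x)"
  by (simp add: Re_cinner[symmetric] g_def cinner_scaleC_left)

lemma scaleC_e_in_span: "z *\<^sub>C e j \<in> span (range g)"
proof -
  have "z = complex_of_real (Re z) + complex_of_real (Im z) * \<i>"
    by (simp add: complex_eq_iff)
  then have "z *\<^sub>C e j = complex_of_real (Re z) *\<^sub>C e j + complex_of_real (Im z) *\<^sub>C \<i> *\<^sub>C e j"
    by (metis scaleC_add_left scaleC_scaleC)
  then have "z *\<^sub>C e j = Re z *\<^sub>R g (2 * j) + Im z *\<^sub>R g (Suc (2 * j))"
    by (simp add: scaleC_of_real g_even g_odd)
  then show ?thesis by (simp add: span_add span_scale span_base)
qed

sublocale H: orthogonal_basis g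
proof
  show "inner (g i) (g j) = 0" if "i \<noteq> j" for i j using that by (simp add: inner_g)
  show "g i \<noteq> 0" for i using norm_g[of i] by auto
  have "x \<in> closure (span (range g))" for x
    unfolding closure_sequential
  proof (intro exI conjI allI)
    show "(\<Sum>j<n. cinner (e j) x *\<^sub>C e j) \<in> span (range g)" for n
      by (intro span_sum scaleC_e_in_span)
    show "(\<lambda>n. \<Sum>j<n. cinner (e j) x *\<^sub>C e j) \<longlonglongrightarrow> x"
      using e_sums by (simp add: sums_def)
  qed
  then show "closure (span (range g)) = UNIV" by blast
qed

lemma g_sums: "(\<lambda>i. inner (g i) x *\<^sub>R g i) sums x"
  using H.coef_sums[of x] by (simp add: H.coef_def norm_g)

lemma inner_scaleC_e: "i \<noteq> j \<Longrightarrow> inner (z *\<^sub>C e i) (w *\<^sub>C e j) = 0"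
  unfolding Re_cinner[symmetric] by (simp add: cinner_scaleC_left cinner_scaleC_right cinner_e)

lemma inner_orth: "i \<noteq> j \<Longrightarrow> inner (a *\<^sub>R (z *\<^sub>C e i)) (b *\<^sub>R (w *\<^sub>C e j)) = 0"
  by (simp add: inner_scaleC_e)

lemma norm_term: "(norm (a *\<^sub>R (z *\<^sub>C e i)))\<^sup>2 = (a * cmod z)\<^sup>2"
  by (simp add: norm_scaleC norm_e power_mult_distrib)

lemma summable_cinner_e: "summable (\<lambda>j. (cmod (cinner (e j) x))\<^sup>2)"
proof -
  have "summable (\<lambda>j. (norm (cinner (e j) x *\<^sub>C e j))\<^sup>2)"
    by (rule summable_norm_orthogonal[OF inner_scaleC_e sums_summable[OF e_sums]])
  then show ?thesis by (simp add: norm_scaleC norm_e)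
qed

lemma powr_le: "l j powr (- s / 2) \<le> c powr (- s / 2)"
  using l_ge c_pos s_nonneg by (intro powr_mono2') auto

text \<open>The eigenvalues are bounded below by c, so the multipliers are at most
  \<open>c powr (- s / 2)\<close> and the orthogonal series converges for every x.\<close>

lemma opow_sums: "(\<lambda>j. l j powr (- s / 2) *\<^sub>R (cinner (e j) x *\<^sub>C e j)) sums opow e l (- s / 2) x"
proof -
  have "summable (\<lambda>j. l j powr (- s / 2) *\<^sub>R (cinner (e j) x *\<^sub>C e j))"
  proof (rule summable_orthogonal)
    show "summable (\<lambda>j. (norm (l j powr (- s / 2) *\<^sub>R (cinner (e j) x *\<^sub>C e j)))\<^sup>2)"
      unfolding norm_term
    proof (rule summable_comparison_test')
      show "summable (\<lambda>j. (c powr (- s / 2))\<^sup>2 * (cmod (cinner (e j) x))\<^sup>2)"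
        by (intro summable_mult summable_cinner_e)
      fix j
      have "(l j powr (- s / 2))\<^sup>2 * (cmod (cinner (e j) x))\<^sup>2 \<le> (c powr (- s / 2))\<^sup>2 * (cmod (cinner (e j) x))\<^sup>2"
        by (intro mult_right_mono power_mono powr_le) auto
      then show "norm ((l j powr (- s / 2) * cmod (cinner (e j) x))\<^sup>2) \<le> (c powr (- s / 2))\<^sup>2 * (cmod (cinner (e j) x))\<^sup>2"
        by (simp add: power_mult_distrib)
    qed
  qed (rule inner_orth)
  then show ?thesis by (simp add: opow_def summable_sums)
qed

lemma cinner_opow: "cinner (e i) (opow e l (- s / 2) x) = complex_of_real (l i powr (- s / 2)) * cinner (e i) x"
proof -
  have "(\<lambda>j. cinner (e i) (l j powr (- s / 2) *\<^sub>R (cinner (e j) x *\<^sub>C e j))) sums cinner (e i) (opow e l (- s / 2) x)"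
    by (rule bounded_linear.sums[OF bounded_linear_cinner_right opow_sums])
  moreover have "cinner (e i) (l j powr (- s / 2) *\<^sub>R (cinner (e j) x *\<^sub>C e j)) =
      (if j = i then complex_of_real (l j powr (- s / 2)) * cinner (e j) x else 0)" for j
    by (simp add: cinner_scaleR_right cinner_scaleC_right cinner_e)
  ultimately have "(\<lambda>j. if j = i then complex_of_real (l j powr (- s / 2)) * cinner (e j) x else 0) sums cinner (e i) (opow e l (- s / 2) x)"
    by simp
  from sums_unique2[OF this sums_single] show ?thesis .
qed

lemma opow_scaleC_e: "opow e l (- s / 2) (z *\<^sub>C e i) = l i powr (- s / 2) *\<^sub>R (z *\<^sub>C e i)"
proof -
  have "l j powr (- s / 2) *\<^sub>R (cinner (e j) (z *\<^sub>C e i) *\<^sub>C e j) =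
    (if j = i then l j powr (- s / 2) *\<^sub>R (z *\<^sub>C e j) else 0)" for j
    using scaleC_of_real[of 0 "e j"] by (simp add: cinner_scaleC_right cinner_e)
  then have "(\<lambda>j. if j = i then l j powr (- s / 2) *\<^sub>R (z *\<^sub>C e j) else 0) sums opow e l (- s / 2) (z *\<^sub>C e i)"
    using opow_sums[of "z *\<^sub>C e i"] by simp
  from sums_unique2[OF this sums_single] show ?thesis .
qed

lemma cinner_\<iota>: "cinner (\<iota> x) (\<iota> y) = cinner (opow e l (- s / 2) x) (opow e l (- s / 2) y)"
  using completion by (simp add: is_completion_def neg_sobolev_ip_def)

text \<open>The diagonal operator \<open>opow e l (- s / 2)\<close> acts on both arguments, and each
  contributes \<open>l (i div 2) powr (- s / 2)\<close>.\<close>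

lemma inner_v_\<iota>: "inner (v i) (\<iota> x) = l (i div 2) powr (- s) * inner (g i) x"
proof -
  have "l (i div 2) powr (- s / 2) * l (i div 2) powr (- s / 2) = l (i div 2) powr (- s)"
    by (simp add: powr_add[symmetric])
  then have "complex_of_real (l (i div 2) powr (- s / 2)) * complex_of_real (l (i div 2) powr (- s / 2)) = complex_of_real (l (i div 2) powr (- s))"
    by (metis of_real_mult)
  moreover have "cinner (v i) (\<iota> x) =
     complex_of_real (l (i div 2) powr (- s / 2)) * complex_of_real (l (i div 2) powr (- s / 2)) * cinner (g i) x"
    unfolding v_def cinner_\<iota> unfolding g_def opow_scaleC_e
    by (simp only: cinner_scaleR_left cinner_scaleC_left cinner_opow mult_ac)
  ultimately have "cinner (v i) (\<iota> x) = complex_of_real (l (i div 2) powr (- s)) * cinner (g i) x" by simp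
  then show ?thesis unfolding Re_cinner[symmetric] by simp
qed

text \<open>Pythagoras compares the partial sums on both sides, and the bound passes to the limit.
  It makes \<iota> continuous, so that sets dense in \<open>'h\<close> have dense images.\<close>

lemma norm_\<iota>: "norm (\<iota> x) \<le> norm x * c powr (- s / 2)"
proof -
  let ?o = "\<lambda>n. \<Sum>j<n. l j powr (- s / 2) *\<^sub>R (cinner (e j) x *\<^sub>C e j)"
  let ?x = "\<lambda>n. \<Sum>j<n. cinner (e j) x *\<^sub>C e j"
  have "(norm (?o n))\<^sup>2 \<le> (norm (?x n) * c powr (- s / 2))\<^sup>2" for n
  proof -
    have "(norm (?o n))\<^sup>2 = (\<Sum>j<n. (norm (l j powr (- s / 2) *\<^sub>R (cinner (e j) x *\<^sub>C e j)))\<^sup>2)"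
      by (rule norm_sum_Pythagorean) (simp_all add: pairwise_def orthogonal_def inner_orth del: inner_scaleR_left inner_scaleR_right)
    also have "\<dots> = (\<Sum>j<n. (l j powr (- s / 2) * cmod (cinner (e j) x))\<^sup>2)"
      by (simp only: norm_term)
    also have "\<dots> \<le> (\<Sum>j<n. (cmod (cinner (e j) x))\<^sup>2 * (c powr (- s / 2))\<^sup>2)"
      unfolding power_mult_distrib mult.commute[of "(l _ powr _)\<^sup>2"]
      by (intro sum_mono mult_left_mono power_mono powr_le) auto
    also have "\<dots> = (norm (?x n))\<^sup>2 * (c powr (- s / 2))\<^sup>2"
    proof -
      have "(norm (?x n))\<^sup>2 = (\<Sum>j<n. (norm (cinner (e j) x *\<^sub>C e j))\<^sup>2)"
        by (rule norm_sum_Pythagorean) (simp_all add: pairwise_def orthogonal_def inner_scaleC_e)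
      then show ?thesis by (simp add: sum_distrib_right norm_scaleC norm_e)
    qed
    finally show ?thesis by (simp add: power_mult_distrib)
  qed
  then have "norm (?o n) \<le> norm (?x n) * c powr (- s / 2)" for n
    by (rule power2_le_imp_le) simp
  moreover have "(\<lambda>n. norm (?o n)) \<longlonglongrightarrow> norm (opow e l (- s / 2) x)"
    using opow_sums[of x] by (intro tendsto_norm) (simp add: sums_def)
  moreover have "(\<lambda>n. norm (?x n) * c powr (- s / 2)) \<longlonglongrightarrow> norm x * c powr (- s / 2)"
    using e_sums[of x] by (intro tendsto_intros) (simp add: sums_def)
  ultimately have "norm (opow e l (- s / 2) x) \<le> norm x * c powr (- s / 2)"
    by (intro LIMSEQ_le[of _ "norm (opow e l (- s / 2) x)"]) auto
  moreover have "norm (\<iota> x) = norm (opow e l (- s / 2) x)"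
    using cinner_\<iota>[of x x] by (simp add: norm_eq_sqrt_inner Re_cinner[symmetric])
  ultimately show ?thesis by simp
qed

lemma bounded_linear_\<iota>: "bounded_linear \<iota>"
proof (rule bounded_linear_intro[OF _ _ norm_\<iota>])
  show "\<iota> (x + y) = \<iota> x + \<iota> y" for x y using completion by (simp add: is_completion_def)
  show "\<iota> (r *\<^sub>R x) = r *\<^sub>R \<iota> x" for r x
    using completion by (simp add: is_completion_def scaleC_of_real[symmetric])
qed

sublocale \<iota>: bounded_linear \<iota>
  by (rule bounded_linear_\<iota>)

lemma norm_v: "(norm (v i))\<^sup>2 = l (i div 2) powr (- s)"
  using inner_v_\<iota>[of i "g i"] by (simp add: power2_norm_eq_inner v_def inner_g)

lemma dense_\<iota>: "closure (\<iota> ` S) = UNIV" if "closure S = UNIV"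
proof -
  have "\<iota> ` closure S \<subseteq> closure (\<iota> ` S)"
    by (intro image_closure_subset closed_closure closure_subset linear_continuous_on bounded_linear_\<iota>)
  then have "closure (range \<iota>) \<subseteq> closure (\<iota> ` S)"
    unfolding that by (rule closure_minimal) simp
  then show ?thesis using completion by (auto simp: is_completion_def)
qed

sublocale K: gaussian_on_basis v "\<lambda>i. \<beta> * l (i div 2)"
proof
  show "inner (v i) (v j) = 0" if "i \<noteq> j" for i j
    using that inner_v_\<iota>[of i "g j"] by (simp add: v_def inner_g)
  show "v i \<noteq> 0" for i
    using norm_v[of i] l_pos[of "i div 2"] by auto
  have "\<iota> ` span (range g) \<subseteq> span (range v)"
    using linear_span_image[OF \<iota>.linear, of "range g"] by (auto simp: v_def image_image)
  then have "closure (\<iota> ` span (range g)) \<subseteq> closure (span (range v))" by (rule closure_mono)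
  then show "closure (span (range v)) = UNIV"
    using dense_\<iota>[OF H.total] by auto
  show "\<beta> * l (i div 2) > 0" for i using \<beta>_pos l_pos by simp
  \<comment> \<open>The norm contributes the power - s of the eigenvalue and the variance the power
    - 1, so the trace condition is exactly the assumed summability, each term counted twice.\<close>
  have "(norm (v i))\<^sup>2 / (\<beta> * l (i div 2)) = (1 / \<beta>) * (l (i div 2) powr (- (1 + s)))" for i
    using l_pos[of "i div 2"] by (simp add: norm_v powr_diff powr_minus powr_add divide_simps)
  moreover have "summable (\<lambda>i. (1 / \<beta>) * (l (i div 2) powr (- (1 + s))))"
    by (intro summable_mult summable_div2 l_summable) simp
  ultimately show "summable (\<lambda>i. (norm (v i))\<^sup>2 / (\<beta> * l (i div 2)))" by simp
qed

text \<open>The weight of \<open>inner_v_\<iota>\<close> cancels against the squared norm of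
  \<open>v i\<close>, so \<open>K.coef\<close> is the continuous extension of the coordinates on
  \<open>'h\<close>.\<close>

lemma coef_\<iota>: "K.coef (\<iota> x) i = inner (g i) x"
  using l_pos[of "i div 2"] by (simp add: K.coef_def inner_v_\<iota> norm_v)

section \<open>The duality pairing in coordinates\<close>

lemma pairing_eqI:
  assumes "continuous_on UNIV f" "\<And>x. f (\<iota> x) = inner w x"
  shows "pairing \<iota> w = f"
  unfolding pairing_def by (rule cont_ext_eqI[OF dense_\<iota>]) (use assms in \<open>auto simp: Re_cinner\<close>)

lemma continuous_coef: "continuous_on S (\<lambda>u. K.coef u i)"
  by (rule linear_continuous_on[OF K.bounded_linear_coef])

lemma pairing_sum: "pairing \<iota> (\<Sum>i<N. w i *\<^sub>R g i) = (\<lambda>u. \<Sum>i<N. w i * K.coef u i)"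
  by (rule pairing_eqI) (auto intro!: continuous_intros continuous_coef simp: coef_\<iota> inner_sum_left)

lemma pairing_g: "pairing \<iota> (g i) = (\<lambda>u. K.coef u i)"
  by (rule pairing_eqI) (auto intro!: continuous_coef simp: coef_\<iota>)

lemma sum_in_sobolev: "(\<Sum>i<N. w i *\<^sub>R g i) \<in> sobolev e l s"
proof -
  have z: "cinner (e j) (\<Sum>i<N. w i *\<^sub>R g i) = 0" if "j \<notin> {..<N}" for j
  proof -
    have "cinner (e j) (\<Sum>i<N. w i *\<^sub>R g i) = (\<Sum>i<N. cinner (e j) (w i *\<^sub>R g i))"
      using bounded_linear_cinner_right[of "e j"] by (simp add: bounded_linear.linear linear_sum)
    also have "\<dots> = 0"
      using that by (intro sum.neutral ballI)
        (auto simp: g_def cinner_scaleR_right cinner_scaleC_right cinner_e)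
    finally show ?thesis .
  qed
  show ?thesis
    unfolding sobolev_def opow_dom_def mem_Collect_eq
    by (intro summable_finite[of "{..<N}"]) (simp_all add: z)
qed

text \<open>The functional is represented by \<open>\<Sum>\<^sub>i l\<^sub>i\<^sup>s w\<^sub>i v\<^sub>i\<close>, whose squared norm is that of
  \<open>w\<close> in \<open>H\<^sup>s\<close>.\<close>

lemma pairing_bounded_linear:
  assumes "w \<in> sobolev e l s"
  shows "bounded_linear (pairing \<iota> w)" "pairing \<iota> w (\<iota> x) = inner w x"
proof -
  let ?t = "\<lambda>i. (l (i div 2) powr s * inner (g i) w) *\<^sub>R v i"
  have "summable ?t"
  proof (rule summable_orthogonal)
    show "inner (?t i) (?t j) = 0" if "i \<noteq> j" for i j using K.orth[OF that] by simp
    let ?h = "\<lambda>j. (l j powr (s / 2) * cmod (cinner (e j) w))\<^sup>2"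
    have "summable ?h" using assms by (simp add: sobolev_def opow_dom_def)
    then have S: "summable (\<lambda>i. ?h (i div 2))" by (rule summable_div2) simp
    have B: "(norm (?t i))\<^sup>2 \<le> ?h (i div 2)" for i
    proof -
      let ?l = "l (i div 2)"
      have "(norm (?t i))\<^sup>2 = (?l powr s * ?l powr s * ?l powr (- s)) * (inner (g i) w)\<^sup>2"
        by (simp add: power_mult_distrib norm_v power2_eq_square[of "_ powr _"])
      also have "?l powr s * ?l powr s * ?l powr (- s) = (?l powr (s / 2))\<^sup>2"
        by (simp add: powr_add[symmetric] power2_eq_square)
      also have "\<bar>inner (g i) w\<bar> \<le> cmod (cinner (e (i div 2)) w)"
        unfolding inner_g_conv using abs_Re_le_cmod[of "cnj (phase i) * cinner (e (i div 2)) w"]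
        by (simp add: norm_mult phase_def split: if_splits)
      then have "(inner (g i) w)\<^sup>2 \<le> (cmod (cinner (e (i div 2)) w))\<^sup>2"
        by (simp add: abs_le_square_iff[symmetric])
      then have "(?l powr (s / 2))\<^sup>2 * (inner (g i) w)\<^sup>2 \<le> ?h (i div 2)"
        by (simp add: power_mult_distrib mult_left_mono)
      finally show ?thesis .
    qed
    show "summable (\<lambda>i. (norm (?t i))\<^sup>2)"
      by (rule summable_comparison_test'[OF S, of 0]) (use B in simp)
  qed
  then obtain z where z: "?t sums z" by (auto simp: summable_def)
  have "inner z (\<iota> x) = inner w x" for x
  proof -
    have S: "(\<lambda>i. inner (?t i) (\<iota> x)) sums inner z (\<iota> x)"
      by (rule bounded_linear.sums[OF bounded_linear_inner_left z])
    have E: "inner (?t i) (\<iota> x) = inner w (inner (g i) x *\<^sub>R g i)" for i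
      using l_pos[of "i div 2"] by (simp add: inner_v_\<iota> powr_minus inner_commute[of w])
    have "(\<lambda>i. inner w (inner (g i) x *\<^sub>R g i)) sums inner w x"
      by (rule bounded_linear.sums[OF bounded_linear_inner_right g_sums])
    then show ?thesis by (rule sums_unique2[OF S[unfolded E]])
  qed
  then have "pairing \<iota> w = inner z"
    by (intro pairing_eqI) (auto intro!: continuous_intros)
  then show "bounded_linear (pairing \<iota> w)" "pairing \<iota> w (\<iota> x) = inner w x"
    using \<open>\<And>x. inner z (\<iota> x) = inner w x\<close> by (auto intro: bounded_linear_inner_right)
qed

section \<open>The operator and its inverse in the eigenbasis\<close>

lemma symmetric_A: "x \<in> D \<Longrightarrow> y \<in> D \<Longrightarrow> cinner x (A y) = cinner (A x) y"
  using self_adj by (auto simp: self_adjoint_def adjoint_graph_def)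

lemma cinner_e_A: "x \<in> D \<Longrightarrow> cinner (e j) (A x) = complex_of_real (l j) * cinner (e j) x"
  using symmetric_A[of "e j" x] eig by (simp add: cinner_scaleR_left)

lemma inner_g_A: "x \<in> D \<Longrightarrow> inner (g i) (A x) = l (i div 2) * inner (g i) x"
  by (simp add: inner_g_conv cinner_e_A algebra_simps)

lemma scaleC_in_D: "x \<in> D \<Longrightarrow> z *\<^sub>C x \<in> D \<and> A (z *\<^sub>C x) = z *\<^sub>C A x"
  using self_adj by (simp add: self_adjoint_def densely_defined_linear_def)

text \<open>The formal solution y, with coefficients divided by the eigenvalues, converges because
  these are at least c. Testing it against \<open>A x\<close> shows that (y, w) lies in the graph of
  the adjoint, and self-adjointness turns this into y \<in> D and A y = w.\<close>

lemma surj_A: "w \<in> A ` D"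
proof -
  let ?t = "\<lambda>i. (inner (g i) w / l (i div 2)) *\<^sub>R g i"
  have "summable ?t"
  proof (rule summable_orthogonal)
    show "inner (?t i) (?t j) = 0" if "i \<noteq> j" for i j using that by (simp add: inner_g)
    have "summable (\<lambda>i. (norm (inner (g i) w *\<^sub>R g i))\<^sup>2)"
      by (rule summable_norm_orthogonal) (use g_sums in \<open>auto simp: inner_g summable_def\<close>)
    then have S: "summable (\<lambda>i. (inner (g i) w)\<^sup>2 / c\<^sup>2)" by (simp add: norm_g summable_divide)
    have B: "(norm (?t i))\<^sup>2 \<le> (inner (g i) w)\<^sup>2 / c\<^sup>2" for i
      using l_ge[of "i div 2"] c_pos l_pos[of "i div 2"]
      by (auto simp: norm_g power_divide intro!: divide_left_mono power_mono)
    show "summable (\<lambda>i. (norm (?t i))\<^sup>2)"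
      by (rule summable_comparison_test'[OF S, of 0]) (use B in simp)
  qed
  then obtain y where y: "?t sums y" by (auto simp: summable_def)
  have Re: "inner y (A x) = inner w x" if "x \<in> D" for x
  proof -
    have S: "(\<lambda>i. inner (?t i) (A x)) sums inner y (A x)"
      by (rule bounded_linear.sums[OF bounded_linear_inner_left y])
    have E: "inner (?t i) (A x) = inner w (inner (g i) x *\<^sub>R g i)" for i
      using l_pos[of "i div 2"] that by (simp add: inner_g_A inner_commute[of w])
    have "(\<lambda>i. inner w (inner (g i) x *\<^sub>R g i)) sums inner w x"
      by (rule bounded_linear.sums[OF bounded_linear_inner_right g_sums])
    then show ?thesis by (rule sums_unique2[OF S[unfolded E]])
  qed
  \<comment> \<open>The imaginary part is obtained from the real identity at the multiple of x by
    the imaginary unit, which is again in D.\<close>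
  have im: "Im (cinner a b) = - inner a (\<i> *\<^sub>C b)" for a b :: 'h
    by (simp add: Re_cinner[symmetric] cinner_scaleC_right)
  have "cinner y (A x) = cinner w x" if "x \<in> D" for x
    using Re[OF that] Re[of "\<i> *\<^sub>C x"] scaleC_in_D[OF that, of \<i>]
    by (intro complex_eqI) (simp_all add: Re_cinner im)
  then have "(y, w) \<in> adjoint_graph D A" by (simp add: adjoint_graph_def)
  then show ?thesis using self_adj by (auto simp: self_adjoint_def)
qed

text \<open>Symmetry of A makes the inner product of y and A y real; expanding y in the basis and
  using that its i-th coefficient is that of w divided by the eigenvalue gives the sum, which is
  \<beta> times the variance of the pairing with w.\<close>

lemma cinner_inv_A:
  "cinner w (inv_into D A w) = complex_of_real (\<Sum>i. (inner w (g i))\<^sup>2 / l (i div 2))"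
proof -
  define y where "y = inv_into D A w"
  have y: "y \<in> D" "A y = w"
    using surj_A[of w] by (simp_all add: y_def inv_into_into f_inv_into_f)
  have "cinner w y = cnj (cinner w y)"
    using symmetric_A[OF y(1) y(1)] cinner_commute[of w y] y(2) by simp
  then have "Im (cinner w y) = 0" by (metis Reals_cnj_iff complex_is_Real_iff)
  moreover have "(\<Sum>i. (inner w (g i))\<^sup>2 / l (i div 2)) = inner w y"
  proof (rule sums_unique[symmetric])
    have "(\<lambda>i. inner w (inner (g i) y *\<^sub>R g i)) sums inner w y"
      by (rule bounded_linear.sums[OF bounded_linear_inner_right g_sums])
    moreover have "inner w (inner (g i) y *\<^sub>R g i) = (inner w (g i))\<^sup>2 / l (i div 2)" for i
      using inner_g_A[OF y(1), of i] l_pos[of "i div 2"]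
      by (simp add: y(2) power2_eq_square inner_commute[of w])
    ultimately show "(\<lambda>i. (inner w (g i))\<^sup>2 / l (i div 2)) sums inner w y" by simp
  qed
  ultimately show ?thesis
    unfolding y_def[symmetric] by (intro complex_eqI) (simp_all add: Re_cinner)
qed

section \<open>Identification of the Gaussian state\<close>

lemma gauss_characteristic:
  assumes "w \<in> sobolev e l s"
  shows "(LINT u|K.gauss. exp (\<i> * complex_of_real (pairing \<iota> w u))) =
    exp (- (cinner w (inv_into D A w) / (2 * complex_of_real \<beta>)))"
proof -
  have "(\<Sum>i. (inner w (g i))\<^sup>2 / (\<beta> * l (i div 2))) = (\<Sum>i. (inner w (g i))\<^sup>2 / l (i div 2)) / \<beta>"
  proof -
    have "summable (\<lambda>i. (inner w (g i))\<^sup>2 / (\<beta> * l (i div 2)))"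
      using K.char_gauss(2)[OF pairing_bounded_linear(1)[OF assms]]
      by (simp add: v_def pairing_bounded_linear(2)[OF assms])
    then have "(\<Sum>i. \<beta> * ((inner w (g i))\<^sup>2 / (\<beta> * l (i div 2)))) = \<beta> * (\<Sum>i. (inner w (g i))\<^sup>2 / (\<beta> * l (i div 2)))"
      by (rule suminf_mult)
    then show ?thesis using \<beta>_pos by simp
  qed
  then show ?thesis
    using K.iexp_gauss[OF pairing_bounded_linear(1)[OF assms], of 1]
    by (simp add: v_def pairing_bounded_linear(2)[OF assms] cinner_inv_A exp_of_real[symmetric] mult.commute)
qed

text \<open>Finite real combinations of the \<open>g i\<close> belong to
  \<open>sobolev e l s\<close>, and the characteristic function on these already determines the law
  of the coordinates.\<close>

lemma gaussian_state_eq: "gaussian_state D A e l s \<iota> \<beta> = K.gauss"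
  unfolding gaussian_state_def
proof (rule the_equality, intro conjI ballI K.centered_gaussian_gauss gauss_characteristic)
  fix \<mu> :: "'k measure"
  assume \<mu>: "centered_gaussian \<mu> \<and> (\<forall>w\<in>sobolev e l s.
           (LINT u|\<mu>. exp (\<i> * complex_of_real (pairing \<iota> w u))) =
           exp (- (cinner w (inv_into D A w) / (2 * complex_of_real \<beta>))))"
  show "\<mu> = K.gauss"
  proof (rule K.eq_gaussI)
    show "borel_prob \<mu>" using \<mu> by (simp add: centered_gaussian_def)
    fix N and w :: "nat \<Rightarrow> real"
    have p: "(\<Sum>i<N. w i * K.coef u i) = pairing \<iota> (\<Sum>i<N. w i *\<^sub>R g i) u" for u
      by (simp add: pairing_sum)
    have "(LINT u|\<mu>. exp (\<i> * complex_of_real (pairing \<iota> (\<Sum>i<N. w i *\<^sub>R g i) u))) =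
      (LINT u|K.gauss. exp (\<i> * complex_of_real (pairing \<iota> (\<Sum>i<N. w i *\<^sub>R g i) u)))"
      unfolding gauss_characteristic[OF sum_in_sobolev] using \<mu> sum_in_sobolev by blast
    then show "(LINT u|\<mu>. iexp (\<Sum>i<N. w i * K.coef u i)) = (LINT u|K.gauss. iexp (\<Sum>i<N. w i * K.coef u i))"
      unfolding p .
  qed
qed

section \<open>Cylindrical functions, bracket and vector field in coordinates\<close>

lemma coords_eq: "coords \<iota> e n u = to_blocks n (K.coef u)"
proof
  fix i
  have "e j = g (2 * j)" "\<i> *\<^sub>C e j = g (Suc (2 * j))" for j by (simp_all add: g_even g_odd)
  then show "coords \<iota> e n u i = to_blocks n (K.coef u) i"
    by (simp add: coords_def to_blocks_def pair_index_def pairing_g)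
qed

lemma cyl_eq: "cyl \<iota> e = {\<lambda>u. F (K.coef u) | n F. 1 \<le> n \<and> F \<in> cylseq n}"
proof (intro set_eqI iffI)
  fix f assume "f \<in> cyl \<iota> e"
  then obtain n \<phi> where f: "1 \<le> n" "\<phi> \<in> Cc_infty (2 * n)" "f = (\<lambda>u. \<phi> (to_blocks n (K.coef u)))"
    by (auto simp: cyl_def coords_eq)
  then have "(\<lambda>x. \<phi> (to_blocks n x)) \<in> cylseq n" by (auto simp: cylseq_def)
  then show "f \<in> {\<lambda>u. F (K.coef u) | n F. 1 \<le> n \<and> F \<in> cylseq n}"
    unfolding mem_Collect_eq f(3) using f(1) by (intro exI[of _ n] exI[of _ "\<lambda>x. \<phi> (to_blocks n x)"]) simp
next
  fix f assume "f \<in> {\<lambda>u. F (K.coef u) | n F. 1 \<le> n \<and> F \<in> cylseq n}"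
  then obtain n \<phi> where "1 \<le> n" "\<phi> \<in> Cc_infty (2 * n)" "f = (\<lambda>u. \<phi> (to_blocks n (K.coef u)))"
    by (auto simp: cylseq_def)
  then show "f \<in> cyl \<iota> e"
    unfolding cyl_def coords_eq by blast
qed

lemma coef_shift: "K.coef (u + t *\<^sub>R v i) = (K.coef u)(i := K.coef u i + t)"
  by (auto simp: K.coef.add K.coef.scaleR K.coef_v)

text \<open>Moving along \<open>v i\<close> changes coordinate i alone, by
  \<open>coef_shift\<close>.\<close>

lemma dir_deriv_eq:
  assumes "F \<in> cylseq n"
  shows "dir_deriv \<iota> (g i) (\<lambda>u. F (K.coef u)) u = partial_deriv i F (K.coef u)"
proof -
  let ?x = "K.coef u"
  have "((\<lambda>t. F (?x(i := t))) has_real_derivative partial_deriv i F ?x) (at (0 + ?x i))"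
    using cylseq_DERIV[OF assms, of ?x i "?x i"] by simp
  then have "((\<lambda>t. F (?x(i := t + ?x i))) has_real_derivative partial_deriv i F ?x) (at 0)"
    by (simp only: DERIV_shift)
  then show ?thesis
    unfolding dir_deriv_def v_def[symmetric] coef_shift by (simp add: DERIV_imp_deriv add.commute)
qed

lemma poisson_eq:
  assumes F: "F \<in> cylseq n" and G: "G \<in> cylseq m"
  shows "poisson \<iota> e (\<lambda>u. F (K.coef u)) (\<lambda>u. G (K.coef u)) u =
    (\<Sum>j<n. partial_deriv (2 * j) F (K.coef u) * partial_deriv (2 * j + 1) G (K.coef u)
                - partial_deriv (2 * j) G (K.coef u) * partial_deriv (2 * j + 1) F (K.coef u))"
proof -
  have "poisson \<iota> e (\<lambda>u. F (K.coef u)) (\<lambda>u. G (K.coef u)) u =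
    (\<Sum>j. dir_deriv \<iota> (g (2 * j)) (\<lambda>u. F (K.coef u)) u * dir_deriv \<iota> (g (Suc (2 * j))) (\<lambda>u. G (K.coef u)) u
       - dir_deriv \<iota> (g (2 * j)) (\<lambda>u. G (K.coef u)) u * dir_deriv \<iota> (g (Suc (2 * j))) (\<lambda>u. F (K.coef u)) u)"
    by (simp add: poisson_def g_even g_odd)
  \<comment> \<open>From index n on, each product contains a vanishing derivative of F, whatever the
    order of G.\<close>
  then show ?thesis
    unfolding dir_deriv_eq[OF F] dir_deriv_eq[OF G]
    by (subst (asm) suminf_finite[of "{..<n}"]) (auto simp: cylseq_partial_ge[OF F])
qed

lemma grad_eq:
  assumes F: "F \<in> cylseq n"
  shows "grad \<iota> e (\<lambda>u. F (K.coef u)) u =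
    (\<Sum>j<n. partial_deriv (2 * j) F (K.coef u) *\<^sub>R g (2 * j) + partial_deriv (Suc (2 * j)) F (K.coef u) *\<^sub>R g (Suc (2 * j)))"
proof -
  have "grad \<iota> e (\<lambda>u. F (K.coef u)) u =
    (\<Sum>j. dir_deriv \<iota> (g (2 * j)) (\<lambda>u. F (K.coef u)) u *\<^sub>R g (2 * j) +
       dir_deriv \<iota> (g (Suc (2 * j))) (\<lambda>u. F (K.coef u)) u *\<^sub>R g (Suc (2 * j)))"
    by (simp add: grad_def g_even g_odd)
  then show ?thesis
    unfolding dir_deriv_eq[OF F]
    by (subst (asm) suminf_finite[of "{..<n}"]) (auto simp: cylseq_partial_ge[OF F])
qed

text \<open>Multiplication by - i exchanges the two coordinates of a pair with a sign, and symmetry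
  moves A onto the eigenvectors. The result is a finite combination of continuous coordinates, hence
  the continuous extension from the dense domain D.\<close>

lemma linear_field_eq:
  "linear_field D A \<iota> u (\<Sum>j<n. a j *\<^sub>R g (2 * j) + b j *\<^sub>R g (Suc (2 * j))) =
    (\<Sum>j<n. l j * (a j * K.coef u (2 * j + 1) - b j * K.coef u (2 * j)))"
proof -
  have "cont_ext \<iota> D (\<lambda>x. Re (cinner (\<Sum>j<n. a j *\<^sub>R g (2 * j) + b j *\<^sub>R g (Suc (2 * j))) ((- \<i>) *\<^sub>C A x)))
    = (\<lambda>u. \<Sum>j<n. l j * (a j * K.coef u (2 * j + 1) - b j * K.coef u (2 * j)))"
  proof (rule cont_ext_eqI[OF dense_\<iota>])
    show "closure D = UNIV" using self_adj by (simp add: self_adjoint_def densely_defined_linear_def)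
    show "continuous_on UNIV (\<lambda>u. \<Sum>j<n. l j * (a j * K.coef u (2 * j + 1) - b j * K.coef u (2 * j)))"
      by (intro continuous_intros continuous_coef)
    fix x assume x: "x \<in> D"
    have "inner (g (2 * j)) ((- \<i>) *\<^sub>C A x) = l j * inner (g (Suc (2 * j))) x"
      "inner (g (Suc (2 * j))) ((- \<i>) *\<^sub>C A x) = - l j * inner (g (2 * j)) x" for j
      unfolding inner_g_conv by (simp_all add: phase_def cinner_scaleC_right cinner_e_A[OF x])
    then show "(\<Sum>j<n. l j * (a j * K.coef (\<iota> x) (2 * j + 1) - b j * K.coef (\<iota> x) (2 * j))) =
      Re (cinner (\<Sum>j<n. a j *\<^sub>R g (2 * j) + b j *\<^sub>R g (Suc (2 * j))) ((- \<i>) *\<^sub>C A x))"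
      by (simp add: Re_cinner inner_sum_left inner_add_left coef_\<iota> algebra_simps)
  qed
  then show ?thesis by (simp add: linear_field_def)
qed

lemma kms_state_iff_kms_seq:
  assumes "borel_prob \<mu>"
  shows "kms_state \<iota> e \<beta> (linear_field D A \<iota>) \<mu> \<longleftrightarrow> kms_seq l \<beta> (distr \<mu> borel K.coef)"
proof -
  have [measurable_cong]: "sets \<mu> = sets borel" using assms by (simp add: borel_prob_def)
  have "(LINT u|\<mu>. poisson \<iota> e (\<lambda>u. F (K.coef u)) (\<lambda>u. G (K.coef u)) u) =
      (\<integral>x. (\<Sum>j<n. partial_deriv (2 * j) F x * partial_deriv (2 * j + 1) G x
                - partial_deriv (2 * j) G x * partial_deriv (2 * j + 1) F x) \<partial>distr \<mu> borel K.coef)" (is "?P")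
    and "(LINT u|\<mu>. linear_field D A \<iota> u (grad \<iota> e (\<lambda>u. F (K.coef u)) u) * G (K.coef u)) =
      (\<integral>x. (\<Sum>j<n. l j * (partial_deriv (2 * j) F x * x (2 * j + 1)
                - partial_deriv (2 * j + 1) F x * x (2 * j))) * G x \<partial>distr \<mu> borel K.coef)" (is "?L")
    if F: "F \<in> cylseq n" and G: "G \<in> cylseq m" for F G n m
  proof -
    have [measurable]: "F \<in> borel_measurable borel" "G \<in> borel_measurable borel"
      "partial_deriv k F \<in> borel_measurable borel" "partial_deriv k G \<in> borel_measurable borel" for k
      using F G by (auto intro: borel_measurable_continuous_onI cylseq_continuous cylseq_partial)
    show ?P unfolding poisson_eq[OF F G] by (subst integral_distr) auto
    show ?L unfolding grad_eq[OF F] linear_field_eq by (subst integral_distr) auto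
  qed
  note eq = this
  show ?thesis
  proof
    assume "kms_state \<iota> e \<beta> (linear_field D A \<iota>) \<mu>"
    then have k: "(LINT u|\<mu>. poisson \<iota> e F G u) = \<beta> * (LINT u|\<mu>. linear_field D A \<iota> u (grad \<iota> e F u) * G u)"
      if "F \<in> cyl \<iota> e" "G \<in> cyl \<iota> e" for F G
      using that by (simp add: kms_state_def)
    show "kms_seq l \<beta> (distr \<mu> borel K.coef)"
      unfolding kms_seq_def
    proof (intro allI impI ballI)
      fix n m F G assume "1 \<le> n" "1 \<le> m" and F: "F \<in> cylseq n" and G: "G \<in> cylseq m"
      then have "(\<lambda>u. F (K.coef u)) \<in> cyl \<iota> e" "(\<lambda>u. G (K.coef u)) \<in> cyl \<iota> e"
        unfolding cyl_eq by blast+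
      from k[OF this] show "(\<integral>x. (\<Sum>j<n. partial_deriv (2 * j) F x * partial_deriv (2 * j + 1) G x
                - partial_deriv (2 * j) G x * partial_deriv (2 * j + 1) F x) \<partial>distr \<mu> borel K.coef) =
        \<beta> * (\<integral>x. (\<Sum>j<n. l j * (partial_deriv (2 * j) F x * x (2 * j + 1)
                - partial_deriv (2 * j + 1) F x * x (2 * j))) * G x \<partial>distr \<mu> borel K.coef)"
        unfolding eq[OF F G] .
    qed
  next
    assume k: "kms_seq l \<beta> (distr \<mu> borel K.coef)"
    show "kms_state \<iota> e \<beta> (linear_field D A \<iota>) \<mu>"
      unfolding kms_state_def
    proof (intro conjI ballI assms)
      fix F' G' assume "F' \<in> cyl \<iota> e" "G' \<in> cyl \<iota> e"
      then obtain n F m G where FG: "1 \<le> n" "F \<in> cylseq n" "F' = (\<lambda>u. F (K.coef u))"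
          "1 \<le> m" "G \<in> cylseq m" "G' = (\<lambda>u. G (K.coef u))"
        unfolding cyl_eq by blast
      show "(LINT u|\<mu>. poisson \<iota> e F' G' u) = \<beta> * (LINT u|\<mu>. linear_field D A \<iota> u (grad \<iota> e F' u) * G' u)"
        unfolding FG(3,6) eq[OF FG(2,5)] using k FG unfolding kms_seq_def by blast
    qed
  qed
qed

lemma kms_state_iff_gaussian:
  assumes "borel_prob \<mu>"
  shows "kms_state \<iota> e \<beta> (linear_field D A \<iota>) \<mu> \<longleftrightarrow> \<mu> = gaussian_state D A e l s \<iota> \<beta>"
proof -
  have "\<mu> = K.gauss \<longleftrightarrow> distr \<mu> borel K.coef = gauss_seq (\<lambda>i. \<beta> * l (i div 2))"
    using assms by (intro K.eq_gauss_iff) (simp add: borel_prob_def)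
  also have "\<dots> \<longleftrightarrow> kms_seq l \<beta> (distr \<mu> borel K.coef)"
  proof
    assume eq: "distr \<mu> borel K.coef = gauss_seq (\<lambda>i. \<beta> * l (i div 2))"
    show "kms_seq l \<beta> (distr \<mu> borel K.coef)"
      unfolding eq by (rule kms_seq_gauss_seq[OF l_pos \<beta>_pos])
  next
    assume "kms_seq l \<beta> (distr \<mu> borel K.coef)"
    then show "distr \<mu> borel K.coef = gauss_seq (\<lambda>i. \<beta> * l (i div 2))"
      by (intro kms_seq_imp_gauss K.prob_space_distr_coef[OF assms] l_pos \<beta>_pos) simp_all
  qed
  finally show ?thesis
    by (simp add: gaussian_state_eq kms_state_iff_kms_seq[OF assms])
qed

end

theorem theorem4p8:
  fixes D :: "'h::complex_hilbert set" and A :: "'h \<Rightarrow> 'h"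
    and e :: "nat \<Rightarrow> 'h" and l :: "nat \<Rightarrow> real" and c s \<beta> :: real
    and \<iota> :: "'h \<Rightarrow> 'k::complex_hilbert" and \<mu> :: "'k measure"
  assumes "self_adjoint D A"
    and "c > 0" and "\<forall>x\<in>D. Re (cinner x (A x)) \<ge> c * (norm x)\<^sup>2"
    and "compact_resolvent D A"
    and "orthonormal_basis e" and "\<forall>j. e j \<in> D \<and> A (e j) = l j *\<^sub>R e j"
    and "s \<ge> 0" and "summable (\<lambda>j. l j powr (- (1 + s)))"
    and "is_completion (neg_sobolev_ip e l s) \<iota>"
    and "\<beta> > 0" and "borel_prob \<mu>"
  shows "kms_state \<iota> e \<beta> (linear_field D A \<iota>) \<mu> \<longleftrightarrow> \<mu> = gaussian_state D A e l s \<iota> \<beta>"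
proof -
  interpret sobolev_setting D A e l c s \<beta> \<iota>
    using assms by unfold_locales auto
  show ?thesis using assms by (intro kms_state_iff_gaussian)
qed

end
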